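(* Let $K$ be a finite extension of $\mathbb{F}_q(t)$, let $\phi:\mathbb{F}_q[t]\to K\{\tau\}$ be a Drinfeld module, and let $S$ be a finite set of places of $K$. If $\beta\in K$ is not torsion for $\phi$, then there are only finitely many $Q\in\mathbb{F}_q[t]$ such that $\phi_Q(\beta)$ is $S$-integral with respect to the point $0$.
   Context: Let $p$ be a prime, $q$ a power of $p$, $\overline{K}$ an algebraic closure of $K$, and $\tau:x\mapsto x^q$. $K\{\tau\}$ is the ring of polynomials in $\tau$ with coefficients in $K$, with usual addition and with composition of functions as multiplication; an element $\sum c_i\tau^i$ acts on $\overline{K}$ by $x\mapsto\sum c_i x^{q^i}$. A Drinfeld module is a ring homomorphism $\phi:\mathbb{F}_q[t]\to K\{\tau\}$, $a\mapsto\phi_a$, such that the coefficient of $\tau^0$ in $\phi_a$ is $a$ for every $a$, and $\phi_a\neq a\tau^0$ for some $a$. A point $\alpha\in\overline{K}$ is torsion for $\phi$ if $\phi_Q(\alpha)=0$ for some $Q\in\mathbb{F}_q[t]\setminus\mathbb{F}_q$. $M_K$ is the set of all places of $K$; each $v\in M_K$ carries an absolute value $|\cdot|_v$, which extends uniquely to $\mathbb{C}_v$, the completion of an algebraic closure of the completion $K_v$. An embedding $\overline{K}\to\mathbb{C}_v$ over $K$ is fixed, and $|x|_v$ for $x\in\overline{K}$ is defined through it. For a finite set $S\subset M_K$ and $\alpha\in\overline{K}$, a point $\beta\in\overline{K}$ is $S$-integral with respect to $\alpha$ if for every place $v\in M_K\setminus S$ and every pair of field morphisms $\sigma,\sigma':\overline{K}\to\overline{K}$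 fixing $K$: if $|\sigma'(\alpha)|_v\le 1$ then $|\sigma'(\alpha)-\sigma(\beta)|_v\ge 1$; and if $|\sigma'(\alpha)|_v>1$ then $|\sigma(\beta)|_v\le 1$. (For $\alpha=0$ and $\beta\in K$ this says $|\beta|_v\geq 1$ for all $v\notin S$.) *)

theory Defs
  imports "HOL-Algebra.Algebraic_Closure_Type" "HOL-Computational_Algebra.Fraction_Field"
    "HOL-Library.Cardinality"
begin

text \<open>
  \<open>F\<^sub>q\<close> is a finite field type \<open>'f\<close> with \<open>q = CARD('f)\<close>, \<open>F\<^sub>q(t)\<close> is
  \<^typ>\<open>'f::{finite,field} poly fract\<close>, \<open>K\<close> is a field type \<open>'k\<close> together with the
  structure map \<open>\<iota>\<close>, and the algebraic closure of \<open>K\<close> is \<^typ>\<open>'k::field alg_closure\<close>.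
\<close>

definition finite_extension_of_Fqt :: "('f::{finite,field} poly fract \<Rightarrow> 'k::field) \<Rightarrow> bool" where
  "finite_extension_of_Fqt \<iota> \<longleftrightarrow>
     \<iota> \<in> ring_hom ring_of_type_algebra ring_of_type_algebra \<and>
     (\<exists>B. finite B \<and> Modules.module.span (\<lambda>c x. \<iota> c * x) B = UNIV)"


section \<open>Drinfeld modules\<close>

text \<open>
  An element \<open>\<Sum>c\<^sub>i \<tau>\<^sup>i\<close> of \<open>K{\<tau>}\<close> is represented by the polynomial \<open>\<Sum>c\<^sub>i X^(q^i)\<close> through
  which it acts, so that multiplication is composition of polynomials (\<open>f g\<close> acts as \<open>f\<close> after \<open>g\<close>) and \<open>\<tau>\<^sup>0\<close> is \<open>X\<close>.
\<close>

definition tau_ring :: "nat \<Rightarrow> 'k::field poly ring" where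
  "tau_ring q =
     \<lparr>carrier = {f. \<forall>n. coeff f n \<noteq> 0 \<longrightarrow> (\<exists>i. n = q ^ i)},
      monoid.mult = pcompose, one = [:0, 1:], ring.zero = 0, add = (+)\<rparr>"

definition tau_coeff :: "nat \<Rightarrow> 'k::field poly \<Rightarrow> nat \<Rightarrow> 'k" where
  "tau_coeff q f i = coeff f (q ^ i)"

definition tau_monom :: "nat \<Rightarrow> 'k::field \<Rightarrow> nat \<Rightarrow> 'k poly" where
  "tau_monom q c i = monom c (q ^ i)"

definition drinfeld_module ::
  "('f::{finite,field} poly fract \<Rightarrow> 'k::field) \<Rightarrow> ('f poly \<Rightarrow> 'k poly) \<Rightarrow> bool" where
  "drinfeld_module \<iota> \<phi> \<longleftrightarrow>
     \<phi> \<in> ring_hom ring_of_type_algebra (tau_ring CARD('f)) \<and>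
     (\<forall>a. tau_coeff CARD('f) (\<phi> a) 0 = \<iota> (Fraction_Field.Fract a 1)) \<and>
     (\<exists>a. \<phi> a \<noteq> tau_monom CARD('f) (\<iota> (Fraction_Field.Fract a 1)) 0)"

definition drinfeld_act ::
  "('f::{finite,field} poly \<Rightarrow> 'k::field poly) \<Rightarrow> 'f poly \<Rightarrow> 'k alg_closure \<Rightarrow> 'k alg_closure" where
  "drinfeld_act \<phi> Q x = poly (map_poly to_ac (\<phi> Q)) x"

definition torsion_point ::
  "('f::{finite,field} poly \<Rightarrow> 'k::field poly) \<Rightarrow> 'k alg_closure \<Rightarrow> bool" where
  "torsion_point \<phi> x \<longleftrightarrow> (\<exists>Q. Q \<notin> range (\<lambda>c. [:c:]) \<and> drinfeld_act \<phi> Q x = 0)"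


section \<open>Absolute values and places\<close>

definition absolute_value :: "'c ring \<Rightarrow> ('c \<Rightarrow> real) \<Rightarrow> bool" where
  "absolute_value R N \<longleftrightarrow>
     (\<forall>x\<in>carrier R. N x \<ge> 0 \<and> (N x = 0 \<longleftrightarrow> x = \<zero>\<^bsub>R\<^esub>)) \<and>
     (\<forall>x\<in>carrier R. \<forall>y\<in>carrier R. N (x \<otimes>\<^bsub>R\<^esub> y) = N x * N y) \<and>
     (\<forall>x\<in>carrier R. \<forall>y\<in>carrier R. N (x \<oplus>\<^bsub>R\<^esub> y) \<le> N x + N y)"

definition nontrivial_absolute_values :: "('k::field \<Rightarrow> real) set" where
  "nontrivial_absolute_values =
     {N. absolute_value ring_of_type_algebra N \<and> (\<exists>x. x \<noteq> 0 \<and> N x \<noteq> 1)}"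

definition equivalent_abs :: "(('k::field \<Rightarrow> real) \<times> ('k \<Rightarrow> real)) set" where
  "equivalent_abs =
     {(N, N'). N \<in> nontrivial_absolute_values \<and> N' \<in> nontrivial_absolute_values \<and>
       (\<exists>s>0. \<forall>x. N' x = N x powr s)}"

text \<open>The set \<open>M\<^sub>K\<close>; a place is an equivalence class of nontrivial absolute values.\<close>

type_synonym 'k place = "('k \<Rightarrow> real) set"

definition places :: "'k::field place set" where
  "places = nontrivial_absolute_values // equivalent_abs"


section \<open>The field \<open>C\<^sub>v\<close>\<close>

definition completion_of :: "'c ring \<Rightarrow> ('c \<Rightarrow> real) \<Rightarrow> 'c set \<Rightarrow> 'c set \<Rightarrow> bool" where
  "completion_of R N B A \<longleftrightarrow>
     B \<subseteq> A \<and> A \<subseteq> carrier R \<and>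
     (\<forall>x\<in>A. \<forall>e>0. \<exists>y\<in>B. N (x \<ominus>\<^bsub>R\<^esub> y) < e) \<and>
     (\<forall>s. (\<forall>n::nat. s n \<in> A) \<and>
          (\<forall>e>0. \<exists>M. \<forall>m\<ge>M. \<forall>n\<ge>M. N (s m \<ominus>\<^bsub>R\<^esub> s n) < e) \<longrightarrow>
          (\<exists>x\<in>A. (\<lambda>n. N (s n \<ominus>\<^bsub>R\<^esub> x)) \<longlonglongrightarrow> 0))"

text \<open>
  \<open>is_Cv N C NC j\<close>: the field \<open>C\<close> with absolute value \<open>NC\<close> and structure map \<open>j: K \<rightarrow> C\<close> is a
  model of \<open>C\<^sub>v\<close>, where \<open>N\<close> is the absolute value of \<open>K\<close> at \<open>v\<close>. Since the completion \<open>Kv\<close>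
  of \<open>K\<close> and its algebraic closure \<open>L\<close> embed into \<open>C\<^sub>v\<close>, they are taken to be subfields of \<open>C\<close>.
\<close>

definition is_Cv ::
  "('k::field \<Rightarrow> real) \<Rightarrow> 'c ring \<Rightarrow> ('c \<Rightarrow> real) \<Rightarrow> ('k \<Rightarrow> 'c) \<Rightarrow> bool" where
  "is_Cv N C NC j \<longleftrightarrow>
     field C \<and> absolute_value C NC \<and>
     j \<in> ring_hom ring_of_type_algebra C \<and> (\<forall>x. NC (j x) = N x) \<and>
     (\<exists>Kv L. subfield Kv C \<and> completion_of C NC (range j) Kv \<and>
             subfield L C \<and> algebraic_closure (C\<lparr>carrier := L\<rparr>) Kv \<and>
             completion_of C NC L (carrier C))"

text \<open>
  The data fixed once and for all: for each place \<open>v\<close> a representative \<open>absK v\<close> of \<open>v\<close>, a model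
  \<open>C v\<close> of \<open>C\<^sub>v\<close> with its absolute value \<open>absC v\<close>, and an embedding \<open>emb v\<close> over \<open>K\<close> of the
  algebraic closure of \<open>K\<close> into \<open>C v\<close>. The structure map of \<open>C v\<close> is the restriction
  of \<open>emb v\<close> to \<open>K\<close>.
\<close>

definition place_data ::
  "('k::field place \<Rightarrow> 'k \<Rightarrow> real) \<Rightarrow> ('k place \<Rightarrow> 'c ring) \<Rightarrow> ('k place \<Rightarrow> 'c \<Rightarrow> real) \<Rightarrow>
   ('k place \<Rightarrow> 'k alg_closure \<Rightarrow> 'c) \<Rightarrow> bool" where
  "place_data absK C absC emb \<longleftrightarrow>
     (\<forall>v\<in>places. absK v \<in> v \<and>
        emb v \<in> ring_hom ring_of_type_algebra (C v) \<and>
        is_Cv (absK v) (C v) (absC v) (\<lambda>x. emb v (to_ac x)))"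


section \<open>Integrality\<close>

definition K_morphisms :: "('k::field alg_closure \<Rightarrow> 'k alg_closure) set" where
  "K_morphisms =
     {\<sigma> \<in> ring_hom ring_of_type_algebra ring_of_type_algebra. \<forall>x. \<sigma> (to_ac x) = to_ac x}"

definition S_integral ::
  "('k::field place \<Rightarrow> 'c \<Rightarrow> real) \<Rightarrow> ('k place \<Rightarrow> 'k alg_closure \<Rightarrow> 'c) \<Rightarrow> 'k place set \<Rightarrow>
   'k alg_closure \<Rightarrow> 'k alg_closure \<Rightarrow> bool" where
  "S_integral absC emb S \<alpha> \<beta> \<longleftrightarrow>
     (\<forall>v \<in> places - S. \<forall>\<sigma> \<in> K_morphisms. \<forall>\<sigma>' \<in> K_morphisms.
        (absC v (emb v (\<sigma>' \<alpha>)) \<le> 1 \<longrightarrow> absC v (emb v (\<sigma>' \<alpha> - \<sigma> \<beta>)) \<ge> 1) \<and>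
        (absC v (emb v (\<sigma>' \<alpha>)) > 1 \<longrightarrow> absC v (emb v (\<sigma> \<beta>)) \<le> 1))"

end

(*
  Enlarge S so that the coefficients of phi and beta are S-integral and the leading coefficient
  is an S-unit. If phi_Q(beta) is S-integral with respect to 0 it is then an S-unit, and S-units
  modulo p-th powers form a finite set. So if there were infinitely many such Q, infinitely many
  would satisfy phi_Q(beta) = g w^p with the same g. Write Q = t R + c and y = phi_R(beta), so that
    (a_r y^(q^r) + ... + a_1 y^q + a_0 y + c beta) / g
  is a p-th power for infinitely many S-integers y. These are unbounded at some place v, where the
  leading term dominates; as an element of K that is a v-adic limit of p-th powers is a p-th
  power (K has degree p over K^p), a_i / g is a p-th power for all i >= 1. The same argument for
  phi_t phi_t shows that a_0 is a p-th power, and then beta / g is one too. Conjugating phi by g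
  and taking p-th roots gives data of the same kind in which a_0 is replaced by its p-th root.
  This descent stops because a_0 = t is not infinitely p-divisible.
*)

theory Submission
  imports Defs "HOL-Algebra.Sylow"
begin

section \<open>Ultrametric absolute values\<close>

text \<open>The facts about places rest on one property of \<open>K\<close>: any n + 1 elements are
  linearly dependent over F_q(t). Discreteness of values, finite residue fields and finitely many
  places above a prime are read off such relations; passing to 1/t covers the poles of t. Only the
  existence of poles needs a construction, by valuation rings. No completion enters: an element that
  is not a p-th power keeps a positive distance from K^p, measured in the basis 1, g, ..., g^(p-1)
  of K over K^p, where the value of g generates the value group. Dominance of the leading term does
  not reach a_0, as y itself need not be a p-th power. Hence phi_t phi_t: its coefficient of tau^r
  is a_0 a_r plus terms in g K^p, and division by a_r, also in g K^p, cancels g. Taking p-th roots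
  also affects constants, so the new orbit is compared with the old one along the automorphism that
  raises the coefficients of Q to the power p. The induction is on k such that a_0 is not a p^k-th
  power; for a_0 = t such k exists since the order of t at a pole is a nonzero integer.\<close>

locale valued =
  fixes N :: "'k::field \<Rightarrow> real"
  assumes nonneg: "0 \<le> N x"
    and zero_iff: "N x = 0 \<longleftrightarrow> x = 0"
    and mult: "N (x * y) = N x * N y"
    and ultra: "N (x + y) \<le> max (N x) (N y)"
    and nontriv: "\<exists>x. x \<noteq> 0 \<and> N x \<noteq> 1"
begin

lemma zero [simp]: "N 0 = 0"
  by (simp add: zero_iff)

lemma pos_iff [simp]: "0 < N x \<longleftrightarrow> x \<noteq> 0"
  using nonneg[of x] zero_iff[of x] by auto

lemma one [simp]: "N 1 = 1"
  using mult[of 1 1] zero_iff[of 1] by simp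

lemma power: "N (x ^ n) = N x ^ n"
  by (induction n) (auto simp: mult)

lemma minus [simp]: "N (- x) = N x"
proof -
  have "N (- 1) ^ 2 = 1"
    by (simp flip: power)
  then have "N (- 1) = 1"
    using nonneg[of "- 1"] by (simp add: power2_eq_1_iff)
  then show ?thesis
    using mult[of "- 1" x] by simp
qed

lemma diff_le: "N (x - y) \<le> max (N x) (N y)"
  using ultra[of x "- y"] by simp

lemma inverse: "N (inverse x) = inverse (N x)"
proof (cases "x = 0")
  case False
  then have "N x * N (inverse x) = 1"
    by (simp flip: mult)
  then show ?thesis
    using False by (metis inverse_unique)
qed simp

lemma divide: "N (x / y) = N x / N y"
  by (simp add: divide_inverse mult inverse)

lemma power_int: "N (x powi k) = N x powi k"
  by (cases "k \<ge> 0") (auto simp: power_int_def power inverse)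

lemma sum_le: "0 \<le> B \<Longrightarrow> (\<And>i. i \<in> A \<Longrightarrow> N (f i) \<le> B) \<Longrightarrow> N (sum f A) \<le> B"
proof (induction A rule: infinite_finite_induct)
  case (insert i A)
  then have "N (f i) \<le> B" "N (sum f A) \<le> B"
    by auto
  then show ?case
    using insert.hyps ultra[of "f i" "sum f A"] by simp
qed auto

lemma sum_less: "0 < B \<Longrightarrow> (\<And>i. i \<in> A \<Longrightarrow> N (f i) < B) \<Longrightarrow> N (sum f A) < B"
proof (induction A rule: infinite_finite_induct)
  case (insert i A)
  then have "N (f i) < B" "N (sum f A) < B"
    by auto
  then show ?case
    using insert.hyps ultra[of "f i" "sum f A"] by simp
qed auto

lemma add_less: "N x < B \<Longrightarrow> N y < B \<Longrightarrow> N (x + y) < B"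
  using ultra[of x y] by simp

lemma add_le: "N x \<le> B \<Longrightarrow> N y \<le> B \<Longrightarrow> N (x + y) \<le> B"
  using ultra[of x y] by simp

lemma add_dominant: "N x < N y \<Longrightarrow> N (x + y) = N y"
  using ultra[of x y] diff_le[of "x + y" x] by simp

text \<open>If the largest value were attained once, that term, being minus the sum of the others,
  would be smaller than itself. This converts algebraic relations into equations between
  values.\<close>

lemma two_maximal_terms:
  assumes "finite A" "sum f A = 0" "i0 \<in> A" "f i0 \<noteq> 0"
  shows "\<exists>i\<in>A. \<exists>j\<in>A. i \<noteq> j \<and> f i \<noteq> 0 \<and> N (f i) = N (f j) \<and> (\<forall>k\<in>A. N (f k) \<le> N (f i))"
proof -
  define m where "m = Max ((\<lambda>i. N (f i)) ` A)"
  have m: "\<And>k. k \<in> A \<Longrightarrow> N (f k) \<le> m"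
    using assms unfolding m_def by simp
  have "m \<in> (\<lambda>i. N (f i)) ` A"
    using assms unfolding m_def by (intro Max_in) auto
  then obtain i where i: "i \<in> A" "N (f i) = m"
    by auto
  have mpos: "0 < m"
    using m[OF assms(3)] assms(4) pos_iff[of "f i0"] by linarith
  have "\<exists>j\<in>A - {i}. N (f j) = m"
  proof (rule ccontr)
    assume "\<not> ?thesis"
    then have "N (sum f (A - {i})) < m"
      using m mpos by (intro sum_less) (auto simp: order_less_le)
    then have "N (f i) < m"
      using assms(1,2) i by (simp add: sum.remove[of A i] add_eq_0_iff)
    with i show False
      by simp
  qed
  then show ?thesis
    using i m mpos by (metis DiffE insertI1 pos_iff)
qed

lemma poly_le_1: "(\<And>i. N (coeff G i) \<le> 1) \<Longrightarrow> N x \<le> 1 \<Longrightarrow> N (poly G x) \<le> 1"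
proof (induction G)
  case (pCons a G)
  have "N a \<le> 1" "\<And>i. N (coeff G i) \<le> 1"
    using pCons.prems(1)[of 0] pCons.prems(1)[of "Suc i" for i] by simp_all
  then show ?case
    using pCons by (auto simp: mult intro!: add_le mult_le_one nonneg)
qed auto

text \<open>The coefficients of the quotient by X - x are values at x of shifted tails of
  \<open>G\<close>.\<close>

lemma synthetic_div_le_1:
  "(\<And>i. N (coeff G i) \<le> 1) \<Longrightarrow> N x \<le> 1 \<Longrightarrow> N (coeff (synthetic_div G x) i) \<le> 1"
proof (induction G arbitrary: i)
  case (pCons a G)
  have G: "\<And>i. N (coeff G i) \<le> 1"
    using pCons.prems(1)[of "Suc i" for i] by simp
  then show ?case
    using pCons poly_le_1[OF G] by (auto simp: coeff_pCons split: nat.split)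
qed auto

text \<open>A polynomial of degree \<open>n\<close> with more than \<open>n\<close> roots in the residue field reduces to 0.\<close>

lemma residue_roots:
  assumes "degree G \<le> n" "\<And>i. N (coeff G i) \<le> 1" "finite Z" "n < card Z"
    "\<And>x. x \<in> Z \<Longrightarrow> N x \<le> 1" "\<And>x y. x \<in> Z \<Longrightarrow> y \<in> Z \<Longrightarrow> x \<noteq> y \<Longrightarrow> N (x - y) = 1"
    "\<And>x. x \<in> Z \<Longrightarrow> N (poly G x) < 1"
  shows "N (coeff G i) < 1"
  using assms
proof (induction n arbitrary: G Z i)
  case 0
  then obtain x where x: "x \<in> Z"
    by fastforce
  obtain g where "G = [:g:]"
    using 0 degree_eq_zeroE by blast
  then show ?case
    using 0(7)[OF x] by (cases i) auto
next
  case (Suc n)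
  obtain x0 where x0: "x0 \<in> Z"
    using Suc.prems(4) by fastforce
  define H where "H = synthetic_div G x0"
  have G: "G = [:- x0, 1:] * H + [:poly G x0:]"
    unfolding H_def by (rule synthetic_div_correct'[symmetric])
  \<comment> \<open>The other points of \<open>Z\<close> are still roots of \<open>H\<close> in the
    residue field, because \<open>x - x0\<close> has value 1 there.\<close>
  have H1: "N (coeff H i) < 1" for i
  proof (rule Suc.IH[of H "Z - {x0}"])
    show "degree H \<le> n"
      using Suc.prems(1) by (simp add: H_def degree_synthetic_div)
    show "N (coeff H i) \<le> 1" for i
      unfolding H_def using Suc.prems(2,5) x0 by (intro synthetic_div_le_1) auto
    show "n < card (Z - {x0})"
      using Suc.prems(3,4) x0 by simp
    fix x assume x: "x \<in> Z - {x0}"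
    have "poly G x - poly G x0 = (x - x0) * poly H x"
      by (subst G) (simp add: algebra_simps)
    then have "N (poly H x) = N (poly G x - poly G x0)"
      using Suc.prems(6)[of x x0] x x0 by (simp add: mult)
    also have "\<dots> < 1"
      using diff_le[of "poly G x" "poly G x0"] Suc.prems(7)[OF x0] Suc.prems(7)[of x] x by simp
    finally show "N (poly H x) < 1" .
  qed (use Suc.prems in auto)
  have x0H: "N (x0 * coeff H i) < 1" for i
    using Suc.prems(5)[OF x0] H1[of i] nonneg
    by (simp add: mult) (metis mult_left_le_one_le order_le_less_trans)
  have "coeff G i = (case i of 0 \<Rightarrow> 0 | Suc j \<Rightarrow> coeff H j) + - (x0 * coeff H i)
      + (case i of 0 \<Rightarrow> poly G x0 | Suc _ \<Rightarrow> 0)"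
    by (subst G) (auto simp: coeff_pCons algebra_simps split: nat.split)
  moreover have "N (case i of 0 \<Rightarrow> 0 | Suc j \<Rightarrow> coeff H j) < 1"
      "N (case i of 0 \<Rightarrow> poly G x0 | Suc _ \<Rightarrow> 0) < 1" "N (- (x0 * coeff H i)) < 1"
    using H1 Suc.prems(7)[OF x0] x0H by (auto split: nat.split)
  ultimately show ?case
    by (metis add_less)
qed

end

text \<open>In characteristic \<open>p\<close>, \<open>|x + y|\<^sup>m \<le> 2 max(|x|, |y|)\<^sup>m\<close> for \<open>m = p\<^sup>k\<close> arbitrarily large.\<close>

lemma valuedI:
  fixes N :: "'k::field \<Rightarrow> real"
  assumes "prime CHAR('k)" "N \<in> nontrivial_absolute_values"
  shows "valued N"
proof
  have nn: "\<And>x. 0 \<le> N x" and z: "\<And>x. N x = 0 \<longleftrightarrow> x = 0"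
    and m: "\<And>x y. N (x * y) = N x * N y" and tri: "\<And>x y. N (x + y) \<le> N x + N y"
    and nt: "\<exists>x. x \<noteq> 0 \<and> N x \<noteq> 1"
    using assms(2)
    by (auto simp: nontrivial_absolute_values_def absolute_value_def ring_of_type_algebra_def)
  show "\<And>x. 0 \<le> N x" "\<And>x. N x = 0 \<longleftrightarrow> x = 0" "\<And>x y. N (x * y) = N x * N y"
    "\<exists>x. x \<noteq> 0 \<and> N x \<noteq> 1"
    by fact+
  have "N 1 = 1"
    using m[of 1 1] z[of 1] by simp
  then have pw: "N (x ^ k) = N x ^ k" for x k
    by (induction k) (auto simp: m)
  show "N (x + y) \<le> max (N x) (N y)" for x y
  proof (rule ccontr)
    assume *: "\<not> ?thesis"
    define a where "a = max (N x) (N y)"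
    have a: "0 \<le> a" "N x \<le> a" "N y \<le> a" "a < N (x + y)"
      using nn[of x] * unfolding a_def by auto
    have bound: "N (x + y) ^ (CHAR('k) ^ k) \<le> 2 * a ^ (CHAR('k) ^ k)" for k
    proof -
      have "N (x + y) ^ (CHAR('k) ^ k) = N (x ^ (CHAR('k) ^ k) + y ^ (CHAR('k) ^ k))"
        using freshmans_dream'[OF assms(1) refl, of x y k] by (simp flip: pw)
      also have "\<dots> \<le> N x ^ (CHAR('k) ^ k) + N y ^ (CHAR('k) ^ k)"
        using tri by (simp flip: pw)
      also have "\<dots> \<le> 2 * a ^ (CHAR('k) ^ k)"
        using power_mono[OF a(2) nn, of "CHAR('k) ^ k"] power_mono[OF a(3) nn, of "CHAR('k) ^ k"] by simp
      finally show ?thesis .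
    qed
    have apos: "0 < a"
    proof (rule ccontr)
      assume "\<not> 0 < a"
      then show False
        using bound[of 0] a by simp
    qed
    \<comment> \<open>By \<open>bound\<close> infinitely many powers of \<open>b\<close> are at most
      2, which is impossible for a number above 1.\<close>
    define b where "b = N (x + y) / a"
    have b: "1 < b"
      using apos a by (simp add: b_def)
    obtain k where k: "2 < b ^ k"
      using real_arch_pow[OF b] by blast
    have "k \<le> CHAR('k) ^ k"
      using prime_ge_2_nat[OF assms(1)] power_gt_expt[of "CHAR('k)" k] by simp
    then have "b ^ k \<le> b ^ (CHAR('k) ^ k)"
      using b by (intro power_increasing) auto
    also have "\<dots> \<le> 2"
      using bound[of k] apos by (simp add: b_def power_divide divide_le_eq)
    finally show False
      using k by simp
  qed
qed

subsection \<open>Weak approximation\<close>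

text \<open>Induction on \<open>V\<close>, with \<open>z\<close> good for \<open>V\<close> and
  \<open>y\<close> separating \<open>N0\<close> from the new \<open>W\<close>. If
  \<open>W z <= 1\<close>, the product \<open>y * z ^ n\<close> works. If \<open>W z > 1\<close>,
  the factor \<open>z ^ n\<close> is replaced by \<open>z ^ m / (1 + z ^ m)\<close>, of value 1
  where \<open>z\<close> is large and at most \<open>N z ^ n\<close> where it is small.\<close>

lemma weak_approximation:
  fixes V :: "('k::field \<Rightarrow> real) set"
  assumes "finite V" "\<And>N. N \<in> V \<Longrightarrow> valued N" "valued N0"
    and sep: "\<And>N. N \<in> V \<Longrightarrow> \<exists>z. N0 z > 1 \<and> N z < 1"
  shows "\<exists>z. N0 z > 1 \<and> (\<forall>N\<in>V. N z < 1)"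
  using assms
proof (induction V rule: finite_induct)
  case empty
  interpret valued N0 by fact
  obtain x where "x \<noteq> 0" "N0 x \<noteq> 1"
    using nontriv by blast
  then have "N0 x > 1 \<or> N0 (inverse x) > 1"
    by (cases "N0 x > 1") (auto simp: inverse one_less_inverse_iff)
  then show ?case
    by auto
next
  case (insert W V)
  interpret N0: valued N0 by fact
  interpret W: valued W
    using insert by simp
  obtain z where z: "N0 z > 1" "\<And>N. N \<in> V \<Longrightarrow> N z < 1"
    using insert by auto
  obtain y where y: "N0 y > 1" "W y < 1"
    using insert.prems(3) by blast
  have "\<exists>n. \<forall>N\<in>V. N y * N z ^ n < 1"
  proof -
    have "\<exists>n. \<forall>m\<ge>n. N y * N z ^ m < 1" if "N \<in> V" for N
    proof -
      interpret N: valued N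
        using insert.prems(1) that by simp
      have "(\<lambda>n. N y * N z ^ n) \<longlonglongrightarrow> N y * 0"
        using z(2)[OF that] N.nonneg by (intro tendsto_mult_left LIMSEQ_realpow_zero) auto
      then have "\<forall>\<^sub>F n in sequentially. N y * N z ^ n < 1"
        by (rule order_tendstoD) simp
      then show ?thesis
        by (simp add: eventually_sequentially)
    qed
    then obtain h where h: "\<And>N m. N \<in> V \<Longrightarrow> h N \<le> m \<Longrightarrow> N y * N z ^ m < 1"
      by metis
    have "\<forall>N\<in>V. h N \<le> sum h V"
      using insert.hyps(1) by (auto intro: member_le_sum)
    then show ?thesis
      using h by blast
  qed
  then obtain n where n: "\<And>N. N \<in> V \<Longrightarrow> N y * N z ^ n < 1"
    by blast
  show ?case
  proof (cases "W z > 1")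
    case False
    have "W (y * z ^ n) < 1"
      using y(2) False W.nonneg power_le_one[OF W.nonneg, of z n]
      by (simp add: W.mult W.power) (metis mult_left_le mult.commute order_le_less_trans linorder_not_less)
    moreover have "N0 (y * z ^ n) > 1"
      using y(1) z(1) by (simp add: N0.mult N0.power less_1_mult' one_le_power less_imp_le
          mult_le_mono1 order_less_le_trans[OF y(1)] mult_le_cancel_left1)
    moreover have "N (y * z ^ n) < 1" if "N \<in> V" for N
    proof -
      interpret N: valued N
        using insert.prems(1) that by simp
      show ?thesis
        using n[OF that] by (simp add: N.mult N.power)
    qed
    ultimately show ?thesis
      by blast
  next
    case True
    \<comment> \<open>The exponent is positive even for \<open>n = 0\<close>, so that the value of
      \<open>z ^ m\<close> differs strictly from 1 and \<open>add_dominant\<close> evaluates the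
      denominator.\<close>
    define m where "m = Suc n"
    have big: "U (z ^ m / (1 + z ^ m)) = 1" if "valued U" "U z > 1" for U
    proof -
      interpret U: valued U by fact
      have "U 1 < U (z ^ m)"
        using that by (simp add: U.power m_def one_less_power del: power_Suc)
      then have "U (1 + z ^ m) = U (z ^ m)"
        by (rule U.add_dominant)
      then show ?thesis
        using \<open>U 1 < U (z ^ m)\<close> by (simp add: U.divide)
    qed
    have small: "U (z ^ m / (1 + z ^ m)) \<le> U z ^ n" if "valued U" "U z < 1" for U
    proof -
      interpret U: valued U by fact
      have "U (z ^ m) < U 1"
        using that U.nonneg[of z] by (simp add: U.power m_def power_less_one_iff del: power_Suc)
      then have "U (z ^ m + 1) = 1"
        using U.add_dominant by force
      then have "U (z ^ m / (1 + z ^ m)) = U z ^ m"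
        by (simp add: U.divide U.power add.commute)
      then show ?thesis
        using that U.nonneg[of z] by (simp add: m_def mult_left_le_one_le)
    qed
    have "N0 (y * (z ^ m / (1 + z ^ m))) > 1" "W (y * (z ^ m / (1 + z ^ m))) < 1"
      using y big[OF N0.valued_axioms z(1)] big[OF W.valued_axioms True]
      by (simp_all add: N0.mult W.mult del: times_divide_eq_right)
    moreover have "N (y * (z ^ m / (1 + z ^ m))) < 1" if "N \<in> V" for N
    proof -
      interpret N: valued N
        using insert.prems(1) that by simp
      have "N (y * (z ^ m / (1 + z ^ m))) \<le> N y * N z ^ n"
        unfolding N.mult using small[OF N.valued_axioms z(2)[OF that]] N.nonneg
        by (intro mult_left_mono) auto
      then show ?thesis
        using n[OF that] by simp
    qed
    ultimately show ?thesis
      by blast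
  qed
qed

section \<open>Places of a finite extension of a rational function field\<close>

locale constants =
  fixes const :: "'f::{finite,field} \<Rightarrow> 'k::field"
  assumes const_add: "const (a + b) = const a + const b"
    and const_mult: "const (a * b) = const a * const b"
    and const_one [simp]: "const 1 = 1"
begin

lemma const_zero [simp]: "const 0 = 0"
  using const_add[of 0 0] by (metis add.right_neutral add_left_cancel)

lemma const_power: "const (a ^ m) = const a ^ m"
  by (induction m) (auto simp: const_mult)

lemma const_uminus: "const (- a) = - const a"
  using const_add[of a "- a"] by (simp add: add_eq_0_iff)

lemma const_eq_0_iff [simp]: "const a = 0 \<longleftrightarrow> a = 0"
  by (metis const_mult const_one const_zero right_inverse mult_zero_left zero_neq_one)

lemma const_of_nat: "const (of_nat m) = of_nat m"
  by (induction m) (auto simp: const_add)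

lemma CHAR_eq: "CHAR('k) = CHAR('f)"
proof -
  have "of_nat m = (0 :: 'k) \<longleftrightarrow> of_nat m = (0 :: 'f)" for m
    using const_of_nat[of m] const_eq_0_iff[of "of_nat m"] by simp
  then show ?thesis
    by (metis CHAR_eqI of_nat_CHAR of_nat_eq_0_iff_char_dvd)
qed

lemma prime_CHAR_const: "prime CHAR('f)"
  by (simp add: finite_imp_CHAR_pos prime_CHAR_semidom)

lemma prime_CHAR: "prime CHAR('k)"
  using prime_CHAR_const by (simp add: CHAR_eq)

text \<open>A finite field is perfect: Frobenius is injective, hence surjective.\<close>

lemma const_root: "\<exists>d. const c = const d ^ CHAR('k)"
proof -
  have "inj (\<lambda>x::'f. x ^ CHAR('f))"
  proof (rule injI)
    fix x y :: 'f assume "x ^ CHAR('f) = y ^ CHAR('f)"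
    then have "(x - y) ^ CHAR('f) = 0"
      using freshmans_dream[OF prime_CHAR_const refl, of "x - y" y] by simp
    then show "x = y"
      by simp
  qed
  then obtain d where "c = d ^ CHAR('f)"
    by (metis finite_UNIV_inj_surj surjD finite)
  then show ?thesis
    by (auto simp: const_power CHAR_eq)
qed

text \<open>The point \<open>T\<close> is left variable: besides \<open>t\<close> it is
  \<open>inverse t\<close> for the poles of t, a p-th root of the previous point in the descent, and
  an arbitrary \<open>y\<close>, whose transcendence over F_q is stated as \<open>ev y c\<close>
  being nonzero for all nonzero \<open>c\<close>.\<close>

definition ev :: "'k \<Rightarrow> 'f poly \<Rightarrow> 'k" where
  "ev T P = poly (map_poly const P) T"

lemma ev_0 [simp]: "ev T 0 = 0"
  by (simp add: ev_def)

lemma ev_pCons [simp]: "ev T (pCons c P) = const c + T * ev T P"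
  by (simp add: ev_def map_poly_pCons)

lemma ev_1 [simp]: "ev T 1 = 1"
  by (simp add: one_pCons)

lemma ev_add: "ev T (P + Q) = ev T P + ev T Q"
proof (induction P arbitrary: Q)
  case (pCons a P)
  then show ?case
    by (cases Q) (auto simp: const_add algebra_simps)
qed simp

lemma ev_smult: "ev T (smult c P) = const c * ev T P"
  by (induction P) (auto simp: const_mult algebra_simps)

lemma ev_mult: "ev T (P * Q) = ev T P * ev T Q"
  by (induction P) (auto simp: ev_add ev_smult algebra_simps)

lemma ev_uminus: "ev T (- P) = - ev T P"
  using ev_add[of T P "- P"] by (simp add: add_eq_0_iff)

lemma ev_diff: "ev T (P - Q) = ev T P - ev T Q"
  using ev_add[of T P "- Q"] by (simp add: ev_uminus)

lemma ev_power: "ev T (P ^ m) = ev T P ^ m"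
  by (induction m) (auto simp: ev_mult)

lemma ev_sum: "ev T (sum P A) = (\<Sum>i\<in>A. ev T (P i))"
  by (induction A rule: infinite_finite_induct) (auto simp: ev_add)

lemma ev_monom: "ev T (monom c m) = const c * T ^ m"
  by (induction m) (auto simp: monom_0 monom_Suc algebra_simps)

lemma finite_bounded_degree: "finite {P :: 'f poly. degree P \<le> m}"
proof (rule finite_subset)
  show "{P :: 'f poly. degree P \<le> m} \<subseteq> Poly ` {xs. set xs \<subseteq> UNIV \<and> length xs \<le> Suc m}"
  proof
    fix P :: "'f poly"
    assume "P \<in> {P. degree P \<le> m}"
    then have "length (coeffs P) \<le> Suc m"
      by (cases "P = 0") (auto simp: length_coeffs_degree)
    then show "P \<in> Poly ` {xs. set xs \<subseteq> UNIV \<and> length xs \<le> Suc m}"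
      by (intro image_eqI[of _ _ "coeffs P"]) auto
  qed
  show "finite (Poly ` {xs :: 'f list. set xs \<subseteq> UNIV \<and> length xs \<le> Suc m})"
    by (intro finite_imageI finite_lists_length_le) simp
qed

text \<open>Two powers of \<open>c\<close> coincide by finiteness, so two powers of the positive
  number \<open>N (const c)\<close> do.\<close>

lemma valued_const:
  assumes "valued N" "c \<noteq> 0"
  shows "N (const c) = 1"
proof -
  interpret valued N by fact
  have "\<not> inj (\<lambda>m::nat. c ^ m)"
    using finite_imageD[of "\<lambda>m::nat. c ^ m" UNIV] by auto
  then obtain i j :: nat where "i \<noteq> j" "c ^ i = c ^ j"
    by (auto simp: inj_def)
  then have "N (const c) ^ i = N (const c) ^ j" "N (const c) > 0" "i \<noteq> j"
    using assms(2) by (auto simp flip: power const_power)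
  then show ?thesis
    by (metis power_inject_exp' linorder_neqE_linordered_idom power_inject_exp
        power_strict_decreasing_iff order_less_irrefl linorder_neqE_nat)
qed

lemma valued_const_le: "valued N \<Longrightarrow> N (const c) \<le> 1"
  using valued_const[of N c] by (cases "c = 0") (auto simp: valued.zero)

end

section \<open>Value groups, residue fields and places above a prime polynomial\<close>

text \<open>\<open>n + 1\<close> elements of \<open>K\<close> are linearly dependent over \<open>F(T)\<close>.\<close>

locale dependent = constants const
  for const :: "'f::{finite,field} \<Rightarrow> 'k::field" +
  fixes T :: 'k and n :: nat
  assumes ev_eq_0: "ev T P = 0 \<Longrightarrow> P = 0"
    and dep: "\<exists>c. (\<exists>i\<le>n. c i \<noteq> 0) \<and> (\<Sum>i\<le>n. ev T (c i) * z i) = 0"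
begin

lemma ev_eq_0_iff [simp]: "ev T P = 0 \<longleftrightarrow> P = 0"
  using ev_eq_0 by auto

text \<open>As long as \<open>P\<close> divides every coefficient it is divided out, which lowers
  the total degree. What survives is a relation that stays nontrivial modulo
  \<open>P\<close>.\<close>

lemma dep_primitive:
  assumes "\<not> P dvd 1" "P \<noteq> 0"
  shows "\<exists>c. (\<exists>i\<le>n. \<not> P dvd c i) \<and> (\<Sum>i\<le>n. ev T (c i) * z i) = 0"
proof -
  have "\<exists>c. (\<exists>i\<le>n. \<not> P dvd c i) \<and> (\<Sum>i\<le>n. ev T (c i) * z i) = 0"
    if "\<exists>i\<le>n. c i \<noteq> 0" "(\<Sum>i\<le>n. ev T (c i) * z i) = 0" for c
    using that
  proof (induction "\<Sum>i\<le>n. degree (c i)" arbitrary: c rule: less_induct)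
    case less
    show ?case
    proof (cases "\<forall>i\<le>n. P dvd c i")
      case False
      then show ?thesis
        using less.prems by blast
    next
      case True
      then obtain d where d: "\<And>i. i \<le> n \<Longrightarrow> c i = P * d i"
        unfolding dvd_def by metis
      have Pdeg: "degree P > 0"
        using assms is_unit_iff_degree[of P] by auto
      have deg: "c i \<noteq> 0 \<Longrightarrow> degree (d i) < degree (c i)" "degree (d i) \<le> degree (c i)" if "i \<le> n" for i
        using d[OF that] Pdeg assms(2) by (cases "d i = 0"; simp add: degree_mult_eq)+
      have "(\<Sum>i\<le>n. degree (d i)) < (\<Sum>i\<le>n. degree (c i))"
        using less.prems(1) deg by (intro sum_strict_mono_ex1) auto
      moreover have "\<exists>i\<le>n. d i \<noteq> 0"
        using less.prems(1) d by auto
      moreover have "ev T P * (\<Sum>i\<le>n. ev T (d i) * z i) = 0"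
        using less.prems(2) d by (simp add: sum_distrib_left ev_mult mult.assoc)
      then have "(\<Sum>i\<le>n. ev T (d i) * z i) = 0"
        using assms(2) by simp
      ultimately show ?thesis
        by (rule less.hyps)
    qed
  qed
  then show ?thesis
    using dep[of z] by blast
qed

text \<open>Apply \<open>two_maximal_terms\<close> to a relation between 1, z, ..., z^n. A power of
  \<open>N z\<close> with nonzero exponent i - j, of size at most n, is thus a ratio of values of
  polynomials in \<open>T\<close>.\<close>

lemma value_relation:
  assumes "valued N" "z \<noteq> 0"
  shows "\<exists>a b i j. i \<le> n \<and> j \<le> n \<and> i \<noteq> j \<and> a \<noteq> 0 \<and> b \<noteq> 0 \<and>
    N (ev T a) * N z ^ i = N (ev T b) * N z ^ j"
proof -
  interpret valued N by fact
  obtain c where c: "\<exists>i\<le>n. c i \<noteq> 0" "(\<Sum>i\<le>n. ev T (c i) * z ^ i) = 0"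
    using dep[of "\<lambda>i. z ^ i"] by blast
  then obtain i0 where "i0 \<le> n" "c i0 \<noteq> 0"
    by blast
  then obtain i j where ij: "i \<le> n" "j \<le> n" "i \<noteq> j" "ev T (c i) * z ^ i \<noteq> 0"
      "N (ev T (c i) * z ^ i) = N (ev T (c j) * z ^ j)"
    using two_maximal_terms[of "{..n}" "\<lambda>i. ev T (c i) * z ^ i" i0] c(2) assms(2) by auto
  then have "ev T (c j) * z ^ j \<noteq> 0"
    by (metis zero_iff)
  then have "c i \<noteq> 0" "c j \<noteq> 0"
    using ij by auto
  then show ?thesis
    using ij by (auto simp: mult power)
qed

text \<open>\<open>P\<close> generates the prime of F_q[T] below the place. It is a uniformizer for
  F_q(T) only: in K its value may be a proper power of a generator of the value group.\<close>

definition uniformizes :: "('k \<Rightarrow> real) \<Rightarrow> 'f poly \<Rightarrow> bool" where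
  "uniformizes N P \<longleftrightarrow> P \<noteq> 0 \<and> N (ev T P) < 1 \<and> (\<forall>c. \<not> P dvd c \<longrightarrow> N (ev T c) = 1)"

lemma ev_le_1: "valued N \<Longrightarrow> N T \<le> 1 \<Longrightarrow> N (ev T c) \<le> 1"
proof (induction c)
  case (pCons a c)
  interpret valued N by fact
  show ?case
    using pCons valued_const_le[OF pCons.prems(1), of a]
    by (auto simp: mult intro!: add_le mult_le_one nonneg)
qed (simp add: valued.zero)

lemma uniformizes_not_unit: "valued N \<Longrightarrow> uniformizes N P \<Longrightarrow> \<not> P dvd 1"
proof
  assume N: "valued N" and P: "uniformizes N P" "P dvd 1"
  interpret valued N by fact
  obtain a where "P = [:a:]" "a \<noteq> 0"
    using P is_unit_poly_iff[of P] by fastforce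
  then have "N (ev T P) = 1"
    using valued_const[OF N, of a] by simp
  then show False
    using P by (simp add: uniformizes_def)
qed

text \<open>A nonzero polynomial of least degree among those of value below 1 works, by division
  with remainder. Such polynomials exist, as otherwise all nonzero ones have value 1 and
  \<open>value_relation\<close> makes \<open>N\<close> trivial.\<close>

lemma ex_uniformizes:
  assumes "valued N" "N T \<le> 1"
  shows "\<exists>P. uniformizes N P"
proof -
  interpret valued N by fact
  have "\<exists>c. c \<noteq> 0 \<and> N (ev T c) < 1"
  proof (rule ccontr)
    assume "\<not> ?thesis"
    then have one: "c \<noteq> 0 \<Longrightarrow> N (ev T c) = 1" for c
      using ev_le_1[OF assms, of c] by fastforce
    have le: "N z \<le> 1" for z
    proof (rule ccontr)
      assume z: "\<not> N z \<le> 1"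
      then have "z \<noteq> 0"
        by auto
      then obtain i j where "i \<noteq> j" "N z ^ i = N z ^ j"
        using value_relation[OF assms(1)] one by (metis mult_1)
      then show False
        using z \<open>i \<noteq> j\<close> by (simp add: power_inject_exp)
    qed
    have "N z = 1" if "z \<noteq> 0" for z
    proof -
      have "N z * N (Fields.inverse z) = 1"
        using that by (simp flip: mult)
      then show ?thesis
        using le[of z] le[of "Fields.inverse z"] nonneg[of z] nonneg[of "Fields.inverse z"]
        by (metis antisym mult.commute mult_left_le mult_left_le)
    qed
    then show False
      using nontriv by blast
  qed
  then obtain P where P: "P \<noteq> 0 \<and> N (ev T P) < 1"
    "\<And>c. c \<noteq> 0 \<and> N (ev T c) < 1 \<Longrightarrow> degree P \<le> degree c"
    using ex_has_least_nat[of "\<lambda>c. c \<noteq> 0 \<and> N (ev T c) < 1" _ degree] by blast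
  have "N (ev T c) = 1" if "\<not> P dvd c" for c
  proof -
    have r: "c mod P \<noteq> 0"
      using that by (simp add: mod_eq_0_iff_dvd)
    then have "degree (c mod P) < degree P"
      using P degree_mod_less[of P c] by auto
    then have "\<not> N (ev T (c mod P)) < 1"
      using P(2)[of "c mod P"] r by linarith
    then have *: "N (ev T (c mod P)) = 1"
      using ev_le_1[OF assms, of "c mod P"] by simp
    have "N (ev T (c div P * P)) \<le> N (ev T P)"
      using ev_le_1[OF assms, of "c div P"] by (simp add: ev_mult mult mult_left_le_one_le nonneg)
    then have "N (ev T (c div P * P) + ev T (c mod P)) = N (ev T (c mod P))"
      using * P by (intro add_dominant) auto
    then show ?thesis
      using * by (simp flip: ev_add)
  qed
  then show ?thesis
    using P unfolding uniformizes_def by blast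
qed

lemma multiplicity_decomp:
  fixes P c :: "'f poly"
  assumes "\<not> P dvd 1" "P \<noteq> 0" "c \<noteq> 0"
  shows "\<exists>k d. c = P ^ k * d \<and> \<not> P dvd d"
  using assms(3)
proof (induction "degree c" arbitrary: c rule: less_induct)
  case less
  show ?case
  proof (cases "P dvd c")
    case True
    then obtain d where d: "c = P * d"
      by (auto simp: dvd_def)
    have "degree P > 0"
      using assms is_unit_iff_degree[of P] by auto
    then have "degree d < degree c" "d \<noteq> 0"
      using d less.prems assms(2) by (auto simp: degree_mult_eq)
    then obtain k e where "d = P ^ k * e" "\<not> P dvd e"
      using less.hyps by blast
    then show ?thesis
      using d by (intro exI[of _ "Suc k"] exI[of _ e]) auto
  next
    case False
    then show ?thesis
      by (intro exI[of _ 0] exI[of _ c]) auto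
  qed
qed

lemma value_of_ev:
  assumes "valued N" "uniformizes N P" "c \<noteq> 0"
  shows "\<exists>k. N (ev T c) = N (ev T P) ^ k"
proof -
  interpret valued N by fact
  obtain k d where "c = P ^ k * d" "\<not> P dvd d"
    using multiplicity_decomp[of P c] uniformizes_not_unit[OF assms(1,2)] assms
    by (auto simp: uniformizes_def)
  then show ?thesis
    using assms(2) by (auto simp: uniformizes_def ev_mult ev_power mult power)
qed

text \<open>Polynomials in \<open>T\<close> have logarithmic values in l Z, with l coming from the
  prime below. So \<open>value_relation\<close> puts (i - j) ln N z into l Z, and as 0 < |i - j| <=
  n, the common denominator n! serves for all z.\<close>

lemma discrete:
  assumes "valued N" "N T \<le> 1"
  shows "\<exists>\<rho>>0. \<forall>z. z \<noteq> 0 \<longrightarrow> (\<exists>m::int. ln (N z) = of_int m * \<rho>)"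
proof -
  interpret valued N by fact
  obtain P where P: "uniformizes N P"
    using ex_uniformizes[OF assms] by blast
  define l where "l = - ln (N (ev T P))"
  have l: "l > 0"
    using P unfolding l_def uniformizes_def by auto
  have lnc: "\<exists>k::nat. ln (N (ev T c)) = - real k * l" if "c \<noteq> 0" for c
    using value_of_ev[OF assms(1) P that] P by (auto simp: l_def uniformizes_def ln_realpow)
  have key: "\<exists>m::int. ln (N z) = of_int m * (l / fact n)" if z: "z \<noteq> 0" for z
  proof -
    obtain c c' i j where ij: "i \<le> n" "j \<le> n" "i \<noteq> j" and c: "c \<noteq> 0" "c' \<noteq> 0"
      and eq: "N (ev T c) * N z ^ i = N (ev T c') * N z ^ j"
      using value_relation[OF assms(1) z] by blast
    obtain a b where ab: "ln (N (ev T c)) = - real a * l" "ln (N (ev T c')) = - real b * l"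
      using lnc c by metis
    have "ln (N (ev T c) * N z ^ i) = ln (N (ev T c') * N z ^ j)"
      using eq by simp
    then have *: "- real a * l + real i * ln (N z) = - real b * l + real j * ln (N z)"
      using c z ab by (simp add: ln_mult ln_realpow zero_iff)
    define d where "d = nat \<bar>int i - int j\<bar>"
    have "d \<noteq> 0" "d \<le> n"
      using ij by (auto simp: d_def)
    then obtain e where e: "fact n = d * e"
      using dvd_fact[of d n] by (auto simp: dvd_def)
    have e': "(fact n :: real) = real_of_int (int d) * real_of_int (int e)"
      using arg_cong[OF e, of real] by simp
    define s where "s = sgn (int i - int j)"
    have ds: "int i - int j = s * int d"
      using ij by (auto simp: s_def d_def sgn_if)
    have ss: "s * s = 1"
      using ij by (auto simp: s_def sgn_if)
    have ss': "real_of_int s * real_of_int s = 1"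
      using ss by (simp flip: of_int_mult)
    have "real_of_int (int i - int j) * ln (N z) = (real a - real b) * l"
      using * by (simp add: algebra_simps)
    then have "real_of_int s * real_of_int (s * int d) * ln (N z) = real_of_int s * (real a - real b) * l"
      by (simp add: ds mult.assoc)
    then have "real_of_int (int d) * ln (N z) = real_of_int (s * (int a - int b)) * l"
      using ss' by (simp add: mult.assoc[symmetric])
    then have "real_of_int (int d) * ln (N z) * real e = real_of_int (s * (int a - int b) * int e) * l"
      by simp
    then have "ln (N z) * fact n = real_of_int (s * (int a - int b) * int e) * l"
      by (simp add: e' mult_ac)
    then have "ln (N z) = real_of_int (s * (int a - int b) * int e) * (l / fact n)"
      by (simp add: field_simps)
    then show ?thesis
      by blast
  qed
  then show ?thesis
    using l by (intro exI[of _ "l / fact n"]) auto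
qed

text \<open>\<open>A\<close> stands for representatives of distinct residue classes. Each satisfies
  a polynomial congruence with coefficients reduced modulo \<open>P\<close>, and only finitely many
  such congruences exist. If \<open>A\<close> were infinite, n + 1 elements would share one: too
  many roots for a polynomial of degree at most n that is nonzero in the residue field.\<close>

lemma finite_residue_field:
  assumes "valued N" "N T \<le> 1"
    and A: "\<And>x. x \<in> A \<Longrightarrow> N x \<le> 1" "\<And>x y. x \<in> A \<Longrightarrow> y \<in> A \<Longrightarrow> x \<noteq> y \<Longrightarrow> N (x - y) = 1"
  shows "finite A"
proof (rule ccontr)
  assume inf: "infinite A"
  interpret valued N by fact
  obtain P where P: "uniformizes N P"
    using ex_uniformizes[OF assms(1,2)] by blast
  define C where "C = {c :: nat \<Rightarrow> 'f poly. c ` {..n} \<subseteq> {c. degree c \<le> degree P} \<and> (\<forall>i. i \<notin> {..n} \<longrightarrow> c i = 0)}"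
  have finC: "finite C"
  proof -
    have "C \<subseteq> {c. \<forall>i. (i \<in> {..n} \<longrightarrow> c i \<in> {c. degree c \<le> degree P}) \<and> (i \<notin> {..n} \<longrightarrow> c i = 0)}"
      by (auto simp: C_def)
    moreover have "finite {c. \<forall>i. (i \<in> {..n} \<longrightarrow> c i \<in> {c :: 'f poly. degree c \<le> degree P}) \<and> (i \<notin> {..n} \<longrightarrow> c i = 0)}"
      by (intro finite_set_of_finite_funs finite_bounded_degree) simp
    ultimately show ?thesis
      by (rule finite_subset)
  qed
  have ex: "\<exists>c\<in>C. (\<exists>i\<le>n. \<not> P dvd c i) \<and> N (\<Sum>i\<le>n. ev T (c i) * x ^ i) < 1" if "x \<in> A" for x
  proof -
    obtain c where c: "\<exists>i\<le>n. \<not> P dvd c i" "(\<Sum>i\<le>n. ev T (c i) * x ^ i) = 0"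
      using dep_primitive[of P "\<lambda>i. x ^ i"] P uniformizes_not_unit[OF assms(1) P]
      by (auto simp: uniformizes_def)
    \<comment> \<open>Reduction modulo \<open>P\<close> keeps the relation primitive; its sum need
      not vanish any more but has value at most \<open>N (ev T P)\<close>, which is below 1.\<close>
    define c' where "c' i = (if i \<le> n then c i mod P else 0)" for i
    have "degree (c i mod P) \<le> degree P" for i
      using degree_mod_less[of P "c i"] P by (fastforce simp: uniformizes_def)
    then have "c' \<in> C"
      by (auto simp: C_def c'_def)
    moreover have "\<exists>i\<le>n. \<not> P dvd c' i"
      using c(1) by (auto simp: c'_def dvd_mod_iff)
    moreover have "N (\<Sum>i\<le>n. ev T (c' i) * x ^ i) < 1"
    proof -
      have c_split: "ev T (c i) = ev T P * ev T (c i div P) + ev T (c i mod P)" for i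
        by (simp flip: ev_mult ev_add)
      have "(\<Sum>i\<le>n. ev T (c' i) * x ^ i) = (\<Sum>i\<le>n. ev T (c i) * x ^ i) + - (\<Sum>i\<le>n. ev T P * (ev T (c i div P) * x ^ i))"
        by (simp add: c_split c'_def algebra_simps sum.distrib)
      then have eq: "N (\<Sum>i\<le>n. ev T (c' i) * x ^ i) = N (ev T P) * N (\<Sum>i\<le>n. ev T (c i div P) * x ^ i)"
        using c(2) by (simp add: mult flip: sum_distrib_left)
      have "N (\<Sum>i\<le>n. ev T (c i div P) * x ^ i) \<le> 1"
        using ev_le_1[OF assms(1,2)] A(1)[OF that]
        by (intro sum_le) (auto simp: mult power intro!: mult_le_one power_le_one nonneg zero_le_power)
      then have "N (\<Sum>i\<le>n. ev T (c' i) * x ^ i) \<le> N (ev T P)"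
        unfolding eq by (simp add: mult_left_le nonneg)
      then show ?thesis
        using P by (simp add: uniformizes_def)
    qed
    ultimately show ?thesis
      by blast
  qed
  then obtain h where h: "\<And>x. x \<in> A \<Longrightarrow> h x \<in> C" "\<And>x. x \<in> A \<Longrightarrow> \<exists>i\<le>n. \<not> P dvd h x i"
    "\<And>x. x \<in> A \<Longrightarrow> N (\<Sum>i\<le>n. ev T (h x i) * x ^ i) < 1"
    by metis
  have "\<exists>c\<in>C. infinite {x \<in> A. h x = c}"
  proof (rule ccontr)
    assume "\<not> ?thesis"
    then have "finite (\<Union>c\<in>C. {x \<in> A. h x = c})"
      using finC by auto
    moreover have "A \<subseteq> (\<Union>c\<in>C. {x \<in> A. h x = c})"
      using h(1) by auto
    ultimately show False
      using inf finite_subset by blast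
  qed
  then obtain c where c: "infinite {x \<in> A. h x = c}"
    by blast
  then obtain B where B: "B \<subseteq> {x \<in> A. h x = c}" "card B = Suc n" "finite B"
    using infinite_arbitrarily_large by blast
  then obtain x0 where "x0 \<in> B"
    by fastforce
  then obtain i where i: "i \<le> n" "\<not> P dvd c i"
    using B h(2)[of x0] by auto
  define G where "G = (\<Sum>i\<le>n. monom (ev T (c i)) i)"
  have coeffG: "coeff G j = (if j \<le> n then ev T (c j) else 0)" for j
    by (auto simp: G_def coeff_sum)
  have polyG: "poly G x = (\<Sum>i\<le>n. ev T (c i) * x ^ i)" for x
    by (simp add: G_def poly_sum poly_monom)
  have "N (coeff G i) < 1"
  proof (rule residue_roots[of G n B])
    show "degree G \<le> n"
      unfolding G_def by (intro degree_sum_le) (auto intro: order_trans[OF degree_monom_le])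
    show "N (coeff G j) \<le> 1" for j
      using ev_le_1[OF assms(1,2)] by (simp add: coeffG)
    show "N (poly G x) < 1" if "x \<in> B" for x
      using h(3)[of x] B that by (auto simp: polyG)
  qed (use A B in auto)
  moreover have "N (ev T (c i)) = 1"
    using P i by (auto simp: uniformizes_def)
  ultimately show False
    using i by (simp add: coeffG)
qed

text \<open>Weak approximation gives elements \<open>z i\<close>, each large at the i-th of n + 1
  places and small at the others. In a primitive relation between them, a term whose coefficient is
  not divisible by \<open>P\<close> dominates at its own place, so the sum cannot vanish.\<close>

lemma card_places_le:
  assumes fin: "finite V" and V: "\<And>N. N \<in> V \<Longrightarrow> valued N" "\<And>N. N \<in> V \<Longrightarrow> uniformizes N P"
    and sep: "\<And>N N'. N \<in> V \<Longrightarrow> N' \<in> V \<Longrightarrow> N \<noteq> N' \<Longrightarrow> \<exists>z. N z > 1 \<and> N' z < 1"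
    and T: "\<And>N. N \<in> V \<Longrightarrow> N T \<le> 1"
  shows "card V \<le> n"
proof (rule ccontr)
  assume "\<not> card V \<le> n"
  then obtain W where W: "W \<subseteq> V" "card W = Suc n" "finite W"
    by (metis obtain_subset_with_card_n Suc_leI not_le_imp_less)
  obtain e where e: "bij_betw e {..n} W"
    using W using finite_same_card_bij[of "{..n}" W] by auto
  have eV: "e i \<in> V" if "i \<le> n" for i
    using e W that by (auto simp: bij_betw_def)
  have ex: "\<exists>z. e i z > 1 \<and> (\<forall>N\<in>V - {e i}. N z < 1)" if "i \<le> n" for i
    using fin V(1) eV[OF that] sep by (intro weak_approximation) auto
  obtain z where z: "\<And>i. i \<le> n \<Longrightarrow> e i (z i) > 1" "\<And>i N. i \<le> n \<Longrightarrow> N \<in> V \<Longrightarrow> N \<noteq> e i \<Longrightarrow> N (z i) < 1"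
    using ex by (metis Diff_iff singletonD)
  have "e 0 \<in> V"
    using eV by simp
  then have "\<not> P dvd 1" "P \<noteq> 0"
    using uniformizes_not_unit[of "e 0" P] V[of "e 0"] by (auto simp: uniformizes_def)
  then obtain c where c: "\<exists>i\<le>n. \<not> P dvd c i" "(\<Sum>i\<le>n. ev T (c i) * z i) = 0"
    using dep_primitive by metis
  then obtain i where i: "i \<le> n" "\<not> P dvd c i"
    by blast
  interpret valued "e i"
    using V(1) eV i by blast
  have ci: "e i (ev T (c i)) = 1"
    using V(2)[OF eV[OF i(1)]] i(2) by (simp add: uniformizes_def)
  have "e i (\<Sum>j\<in>{..n} - {i}. ev T (c j) * z j) < 1"
  proof (rule sum_less)
    fix j assume j: "j \<in> {..n} - {i}"
    then have "e j \<noteq> e i"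
      using e i(1) by (auto simp: bij_betw_def inj_on_def)
    then have "e i (z j) < 1"
      using z(2)[of j "e i"] j eV[OF i(1)] by auto
    moreover have "e i (ev T (c j)) \<le> 1"
      using ev_le_1 T[OF eV[OF i(1)]] V(1)[OF eV[OF i(1)]] by blast
    ultimately show "e i (ev T (c j) * z j) < 1"
      by (simp add: mult nonneg) (metis mult_left_le_one_le nonneg order_le_less_trans)
  qed simp
  moreover have "ev T (c i) * z i = - (\<Sum>j\<in>{..n} - {i}. ev T (c j) * z j)"
    using c(2) i(1) by (simp add: sum.remove[of _ i] add_eq_0_iff2)
  ultimately have "e i (ev T (c i) * z i) < 1"
    by simp
  then show False
    using z(1)[OF i(1)] ci by (simp add: mult)
qed

text \<open>The prime \<open>P\<close> below a place in \<open>V\<close> divides \<open>c\<close>,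
  so its degree is bounded and finitely many \<open>P\<close> occur, each with at most
  \<open>n\<close> places.\<close>

lemma finite_places_below:
  assumes V: "\<And>N. N \<in> V \<Longrightarrow> valued N" "\<And>N. N \<in> V \<Longrightarrow> N T \<le> 1"
    and less: "\<And>N. N \<in> V \<Longrightarrow> N (ev T c) < 1" and c: "c \<noteq> 0"
    and sep: "\<And>N N'. N \<in> V \<Longrightarrow> N' \<in> V \<Longrightarrow> N \<noteq> N' \<Longrightarrow> \<exists>z. N z > 1 \<and> N' z < 1"
  shows "finite V"
proof -
  have fin: "finite {N \<in> V. uniformizes N P}" for P
  proof (rule ccontr)
    assume "infinite {N \<in> V. uniformizes N P}"
    then obtain W where W: "W \<subseteq> {N \<in> V. uniformizes N P}" "card W = Suc n" "finite W"
      using infinite_arbitrarily_large by blast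
    then have "card W \<le> n"
      using V sep by (intro card_places_le[where P = P]) (simp_all add: subset_iff)
    with W show False
      by simp
  qed
  have "V \<subseteq> (\<Union>P\<in>{P. degree P \<le> degree c}. {N \<in> V. uniformizes N P})"
  proof
    fix N assume N: "N \<in> V"
    then obtain P where P: "uniformizes N P"
      using V ex_uniformizes by blast
    then have "P dvd c"
      using less[OF N] by (force simp: uniformizes_def)
    then show "N \<in> (\<Union>P\<in>{P. degree P \<le> degree c}. {N \<in> V. uniformizes N P})"
      using N P c by (auto intro!: dvd_imp_degree_le)
  qed
  then show ?thesis
    using fin finite_bounded_degree by (meson finite_UN_I finite_subset)
qed

end

subsection \<open>Existence of places\<close>

context constants
begin

definition subalgebra :: "'k set \<Rightarrow> bool" where
  "subalgebra A \<longleftrightarrow> range const \<subseteq> A \<and> (\<forall>x\<in>A. \<forall>y\<in>A. x + y \<in> A \<and> x * y \<in> A)"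

lemma subalgebraD:
  assumes "subalgebra A"
  shows "const c \<in> A" "0 \<in> A" "1 \<in> A" "x \<in> A \<Longrightarrow> y \<in> A \<Longrightarrow> x + y \<in> A"
    "x \<in> A \<Longrightarrow> y \<in> A \<Longrightarrow> x * y \<in> A" "x \<in> A \<Longrightarrow> - x \<in> A"
    "x \<in> A \<Longrightarrow> y \<in> A \<Longrightarrow> x - y \<in> A" "x \<in> A \<Longrightarrow> x ^ m \<in> A"
    "(\<And>i. i \<in> I \<Longrightarrow> f i \<in> A) \<Longrightarrow> sum f I \<in> A"
proof -
  show c: "const c \<in> A" for c
    using assms by (auto simp: subalgebra_def)
  show z: "0 \<in> A" and o: "1 \<in> A"
    using c[of 0] c[of 1] by simp_all
  show a: "x \<in> A \<Longrightarrow> y \<in> A \<Longrightarrow> x + y \<in> A" and m: "x \<in> A \<Longrightarrow> y \<in> A \<Longrightarrow> x * y \<in> A" for x y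
    using assms by (auto simp: subalgebra_def)
  show u: "x \<in> A \<Longrightarrow> - x \<in> A" for x
    using m[of "const (- 1)" x] c[of "- 1"] const_uminus[of 1] by simp
  show "x \<in> A \<Longrightarrow> y \<in> A \<Longrightarrow> x - y \<in> A"
    using a[of x "- y"] u[of y] by simp
  show "x \<in> A \<Longrightarrow> x ^ m \<in> A"
    by (induction m) (auto intro: m o)
  show "(\<And>i. i \<in> I \<Longrightarrow> f i \<in> A) \<Longrightarrow> sum f I \<in> A"
    by (induction I rule: infinite_finite_induct) (auto intro: a z)
qed

lemma ev_in_subalgebra: "subalgebra A \<Longrightarrow> T \<in> A \<Longrightarrow> ev T c \<in> A"
  by (induction c) (auto intro: subalgebraD)

text \<open>This set is the ring A[z], the extension against which maximality is tested.\<close>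

lemma subalgebra_poly:
  assumes "subalgebra A"
  shows "subalgebra {poly g z |g. \<forall>i. coeff g i \<in> A}" (is "subalgebra ?B")
  unfolding subalgebra_def
proof (intro conjI ballI)
  show "range const \<subseteq> ?B"
  proof clarify
    fix c
    show "\<exists>g. const c = poly g z \<and> (\<forall>i. coeff g i \<in> A)"
      using subalgebraD[OF assms] by (intro exI[of _ "[:const c:]"]) (auto simp: coeff_pCons split: nat.split)
  qed
  fix u v assume "u \<in> ?B" "v \<in> ?B"
  then obtain g h where gh: "u = poly g z" "v = poly h z" "\<And>i. coeff g i \<in> A" "\<And>i. coeff h i \<in> A"
    by auto
  show "u + v \<in> ?B"
    using gh subalgebraD[OF assms] by (intro CollectI exI[of _ "g + h"]) auto
  show "u * v \<in> ?B"
    using gh subalgebraD[OF assms]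
    by (intro CollectI exI[of _ "g * h"]) (auto simp: coeff_mult intro!: subalgebraD(9)[OF assms])
qed

text \<open>
  A subalgebra containing \<open>y\<^sup>-\<^sup>1\<close> that is maximal among those not containing \<open>y\<close> is a valuation ring.
\<close>

context
  fixes M :: "'k set" and y :: 'k
  assumes M: "subalgebra M" "inverse y \<in> M" "y \<notin> M"
    and maximal: "\<And>A. subalgebra A \<Longrightarrow> M \<subseteq> A \<Longrightarrow> y \<notin> A \<Longrightarrow> A = M"
begin

private lemma y_nonzero: "y \<noteq> 0"
  using M subalgebraD(2) by auto

text \<open>The element 1/y lies in the Jacobson radical of \<open>M\<close>. With s = 1 - b/y one
  has y s = y - b, hence y s^k is congruent to y modulo \<open>M\<close>. So M[1/s], which is
  \<open>B\<close>, still misses y and equals \<open>M\<close> by maximality.\<close>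

private lemma unit:
  assumes b: "b \<in> M"
  shows "1 - inverse y * b \<noteq> 0" "inverse (1 - inverse y * b) \<in> M"
proof -
  define s where "s = 1 - inverse y * b"
  have s: "s \<in> M"
    unfolding s_def using M b by (auto intro: subalgebraD)
  have ys: "y * s = y - b"
    using y_nonzero by (simp add: s_def field_simps)
  then have nz: "s \<noteq> 0"
    using M(3) b by auto
  have yk: "y * s ^ k - y \<in> M" for k
  proof (induction k)
    case 0
    then show ?case
      using subalgebraD(2)[OF M(1)] by simp
  next
    case (Suc k)
    have "y * s ^ Suc k = (y - b) * s ^ k"
      by (simp flip: ys)
    then have "y * s ^ Suc k - y = (y * s ^ k - y) - b * s ^ k"
      by (simp add: algebra_simps)
    then show ?case
      using subalgebraD(7)[OF M(1) Suc subalgebraD(5)[OF M(1) b subalgebraD(8)[OF M(1) s]]] by metis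
  qed
  define B where "B = {a * inverse s ^ k |a k. a \<in> M}"
  have "M \<subseteq> B"
    unfolding B_def by (metis (mono_tags, lifting) CollectI mult_1_right power_0 subsetI)
  moreover have "subalgebra B"
    unfolding subalgebra_def
  proof (intro conjI ballI)
    show "range const \<subseteq> B"
      using \<open>M \<subseteq> B\<close> M by (auto simp: subalgebra_def)
    fix u v assume "u \<in> B" "v \<in> B"
    then obtain a k c l where uv: "u = a * inverse s ^ k" "v = c * inverse s ^ l" "a \<in> M" "c \<in> M"
      by (auto simp: B_def)
    have "u + v = (a * s ^ l + c * s ^ k) * inverse s ^ (k + l)"
      using nz unfolding uv(1,2) by (simp add: field_simps power_add)
    moreover have "a * s ^ l + c * s ^ k \<in> M"
      using uv s M by (auto intro!: subalgebraD)
    ultimately show "u + v \<in> B"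
      unfolding B_def by blast
    have "u * v = (a * c) * inverse s ^ (k + l)"
      using uv by (simp add: power_add)
    moreover have "a * c \<in> M"
      using uv M by (auto intro!: subalgebraD)
    ultimately show "u * v \<in> B"
      unfolding B_def by blast
  qed
  moreover have "y \<notin> B"
  proof
    assume "y \<in> B"
    then obtain a k where "y = a * inverse s ^ k" "a \<in> M"
      by (auto simp: B_def)
    then have "y * s ^ k \<in> M"
      using nz by (simp add: field_simps)
    then have "y * s ^ k - (y * s ^ k - y) \<in> M"
      by (rule subalgebraD(7)[OF M(1) _ yk])
    then show False
      using M by simp
  qed
  ultimately have "B = M"
    using maximal by blast
  moreover have "inverse s \<in> B"
    unfolding B_def using subalgebraD(3)[OF M(1)] by (intro CollectI exI[of _ 1]) auto
  ultimately show "1 - inverse y * b \<noteq> 0" "inverse (1 - inverse y * b) \<in> M"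
    using nz by (auto simp: s_def)
qed

text \<open>A witness that y lies in M[z], in the classical form of a relation expressing 1 by
  powers of z with coefficients in the ideal generated by 1/y.\<close>

private definition rep :: "'k \<Rightarrow> 'k poly \<Rightarrow> bool" where
  "rep z g \<longleftrightarrow> (\<forall>i. coeff g i \<in> M) \<and> inverse y * poly g z = 1"

private lemma ex_rep:
  assumes "z \<notin> M"
  shows "\<exists>g. rep z g"
proof -
  let ?B = "{poly g z |g. \<forall>i. coeff g i \<in> M}"
  have "M \<subseteq> ?B"
  proof
    fix a assume "a \<in> M"
    then show "a \<in> ?B"
      using subalgebraD(2)[OF M(1)]
      by (intro CollectI exI[of _ "[:a:]"]) (auto simp: coeff_pCons split: nat.split)
  qed
  moreover have "z \<in> ?B"
    using subalgebraD(2,3)[OF M(1)]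
    by (intro CollectI exI[of _ "[:0, 1:]"]) (auto simp: coeff_pCons split: nat.split)
  ultimately have "y \<in> ?B"
    using maximal[OF subalgebra_poly[OF M(1), of z]] assms by blast
  then obtain g where "y = poly g z" "\<forall>i. coeff g i \<in> M"
    by auto
  then show ?thesis
    using y_nonzero by (metis rep_def left_inverse)
qed

private lemma rep_degree: "rep z g \<Longrightarrow> degree g > 0"
proof (rule ccontr)
  assume g: "rep z g" "\<not> degree g > 0"
  then obtain a where a: "g = [:a:]"
    using degree_eq_zeroE by blast
  then have "a \<in> M" "inverse y * a = 1"
    using g(1) by (auto simp: rep_def dest: spec[of _ 0])
  then have "y = a"
    using y_nonzero by (simp add: field_simps)
  then show False
    using M \<open>a \<in> M\<close> by simp
qed

text \<open>Since 1 - x h_0 is a unit by \<open>unit\<close>, the relation for 1/z can be solved for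
  1 as a combination of z^-1, ..., z^-m over \<open>M\<close>. Multiplying the top term of
  \<open>g\<close> by it leaves only powers of z below the m-th.\<close>

private lemma rep_reduce:
  assumes g: "rep z g" and h: "rep (inverse z) h" and deg: "degree h \<le> degree g" and z: "z \<noteq> 0"
  shows "\<exists>g'. rep z g' \<and> degree g' < degree g"
proof -
  define x where "x = inverse y"
  define m where "m = degree g"
  define s where "s = 1 - x * coeff h 0"
  have s: "s \<noteq> 0" "inverse s \<in> M"
    using unit[of "coeff h 0"] h by (auto simp: s_def x_def rep_def)
  have m: "m > 0"
    using rep_degree[OF g] by (simp add: m_def)
  have hm: "degree h \<le> m"
    using deg by (simp add: m_def)
  define k where "k = inverse s * x * coeff g m"
  have k: "k \<in> M"
    using g M s by (auto simp: k_def rep_def x_def intro!: subalgebraD)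
  define r where "r = (\<Sum>i\<in>{1..m}. monom (k * coeff h i) (m - i))"
  have "poly h (inverse z) = (\<Sum>i\<le>m. coeff h i * inverse z ^ i)"
    using hm unfolding poly_altdef
    by (intro sum.mono_neutral_left) (auto simp: coeff_eq_0)
  also have "\<dots> = coeff h 0 + (\<Sum>i\<in>{1..m}. coeff h i * inverse z ^ i)"
    by (simp add: sum.atMost_shift atMost_atLeast0 sum.atLeast_Suc_atMost)
  finally have "s = x * (\<Sum>i\<in>{1..m}. coeff h i * inverse z ^ i)"
    using h by (simp add: rep_def s_def x_def algebra_simps)
  then have one: "1 = inverse s * x * (\<Sum>i\<in>{1..m}. coeff h i * inverse z ^ i)"
    using s(1) by (simp add: field_simps)
  have "poly r z = (\<Sum>i\<in>{1..m}. k * coeff h i * z ^ (m - i))"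
    by (simp add: r_def poly_sum poly_monom)
  also have "\<dots> = (\<Sum>i\<in>{1..m}. coeff g m * z ^ m * (inverse s * x * (coeff h i * inverse z ^ i)))"
    using z by (intro sum.cong) (auto simp: k_def power_diff field_simps)
  also have "\<dots> = coeff g m * z ^ m * (inverse s * x * (\<Sum>i\<in>{1..m}. coeff h i * inverse z ^ i))"
    by (simp only: sum_distrib_left)
  also have "\<dots> = coeff g m * z ^ m"
    by (simp only: one[symmetric] mult_1_right)
  finally have polyr: "poly r z = coeff g m * z ^ m" .
  define g' where "g' = g - monom (coeff g m) m + r"
  have "poly g' z = poly g z"
    by (simp add: g'_def polyr poly_monom)
  moreover have "coeff r i \<in> M" for i
    unfolding r_def coeff_sum using k h subalgebraD[OF M(1)] by (auto simp: rep_def intro!: subalgebraD(9)[OF M(1)])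
  then have "coeff g' i \<in> M" for i
    using g subalgebraD[OF M(1)] by (auto simp: g'_def rep_def)
  ultimately have "rep z g'"
    using g by (simp add: rep_def)
  moreover have "degree g' < m"
  proof -
    have "coeff r i = 0" if "i \<ge> m" for i
      using that m by (auto simp: r_def coeff_sum intro!: sum.neutral)
    then have "coeff g' i = 0" if "i \<ge> m" for i
      using that by (cases "i = m") (auto simp: g'_def m_def coeff_eq_0)
    then show ?thesis
      using m by (metis degree_0 leading_coeff_0_iff linorder_not_le)
  qed
  ultimately show ?thesis
    by (auto simp: m_def)
qed

text \<open>If both were missing, take relations of least degree for z and for 1/z;
  \<open>rep_reduce\<close> would shorten one whose degree is not the smaller.\<close>

lemma maximal_is_valuation_ring:
  assumes z: "z \<noteq> 0"
  shows "z \<in> M \<or> inverse z \<in> M"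
proof (rule ccontr)
  assume "\<not> ?thesis"
  then obtain g0 h0 where "rep z g0" "rep (inverse z) h0"
    using ex_rep by metis
  then obtain g h where g: "rep z g" "\<And>g'. rep z g' \<Longrightarrow> degree g \<le> degree g'"
    and h: "rep (inverse z) h" "\<And>h'. rep (inverse z) h' \<Longrightarrow> degree h \<le> degree h'"
    using ex_has_least_nat[of "rep z" g0 degree] ex_has_least_nat[of "rep (inverse z)" h0 degree] by blast
  show False
  proof (cases "degree h \<le> degree g")
    case True
    then show False
      using rep_reduce[OF g(1) h(1)] g(2) z by fastforce
  next
    case False
    then show False
      using rep_reduce[OF h(1), of g] g(1) h(2) z by fastforce
  qed
qed

end

text \<open>Zorn's lemma starts from F_q[1/y], which misses y because y is transcendental over
  F_q.\<close>

lemma ex_valuation_ring: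
  assumes y: "\<And>c. c \<noteq> 0 \<Longrightarrow> ev y c \<noteq> 0"
  shows "\<exists>V. subalgebra V \<and> (\<forall>z. z \<noteq> 0 \<longrightarrow> z \<in> V \<or> inverse z \<in> V) \<and> y \<notin> V"
proof -
  define x where "x = inverse y"
  have "ev y [:0, 1:] \<noteq> 0"
    by (rule y) simp
  then have y0: "y \<noteq> 0"
    by simp
  define \<A> where "\<A> = {A. subalgebra A \<and> x \<in> A \<and> y \<notin> A}"
  have "subalgebra (range (ev x))"
    unfolding subalgebra_def
  proof (intro conjI ballI)
    show "range const \<subseteq> range (ev x)"
    proof
      fix w assume "w \<in> range const"
      then obtain a where "w = const a"
        by auto
      then have "w = ev x [:a:]"
        by simp
      then show "w \<in> range (ev x)"
        by blast
    qed
  qed (auto simp flip: ev_add ev_mult)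
  moreover have "x \<in> range (ev x)"
    by (intro image_eqI[of _ _ "[:0, 1:]"]) auto
  moreover have "y \<notin> range (ev x)"
  proof
    assume "y \<in> range (ev x)"
    then obtain c where c: "y = ev x c"
      by auto
    define D where "D = degree c"
    \<comment> \<open>\<open>y\<^sup>D\<^sup>+\<^sup>1 - y\<^sup>D ev x c\<close> as a polynomial in \<open>y\<close>\<close>
    define e where "e = monom 1 (Suc D) - (\<Sum>i\<le>D. monom (coeff c i) (D - i))"
    have "ev x c = (\<Sum>i\<le>D. const (coeff c i) * x ^ i)"
      by (simp add: ev_def poly_altdef D_def coeff_map_poly degree_map_poly)
    then have "y ^ D * ev x c = (\<Sum>i\<le>D. const (coeff c i) * y ^ (D - i))"
      using y0 by (auto simp: sum_distrib_left x_def power_diff field_simps intro!: sum.cong)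
    then have "ev y e = y ^ Suc D - y ^ D * ev x c"
      by (simp add: e_def ev_diff ev_sum ev_monom)
    then have "ev y e = 0"
      by (simp flip: c)
    moreover have "coeff e (Suc D) = 1"
      by (auto simp: e_def coeff_sum intro!: sum.neutral)
    then have "e \<noteq> 0"
      by auto
    ultimately show False
      using y[of e] by auto
  qed
  ultimately have "\<A> \<noteq> {}"
    by (auto simp: \<A>_def)
  moreover have "\<Union>\<C> \<in> \<A>" if "\<C> \<noteq> {}" "subset.chain \<A> \<C>" for \<C>
  proof -
    have C: "\<And>A. A \<in> \<C> \<Longrightarrow> A \<in> \<A>" "\<And>A B. A \<in> \<C> \<Longrightarrow> B \<in> \<C> \<Longrightarrow> A \<subseteq> B \<or> B \<subseteq> A"
      using that(2) by (auto simp: subset_chain_def)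
    have "subalgebra (\<Union>\<C>)"
      unfolding subalgebra_def
    proof (intro conjI ballI)
      show "range const \<subseteq> \<Union>\<C>"
        using C(1) \<open>\<C> \<noteq> {}\<close> by (fastforce simp: \<A>_def subalgebra_def)
      fix u v assume "u \<in> \<Union>\<C>" "v \<in> \<Union>\<C>"
      then obtain A where A: "A \<in> \<C>" "u \<in> A" "v \<in> A"
        using C(2) by blast
      then have "u + v \<in> A" "u * v \<in> A"
        using C(1)[of A] by (auto simp: \<A>_def intro: subalgebraD)
      then show "u + v \<in> \<Union>\<C>" "u * v \<in> \<Union>\<C>"
        using A by auto
    qed
    then show ?thesis
      using C(1) that(1) by (auto simp: \<A>_def)
  qed
  ultimately obtain M where M: "M \<in> \<A>" "\<And>A. A \<in> \<A> \<Longrightarrow> M \<subseteq> A \<Longrightarrow> A = M"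
    using subset_Zorn_nonempty[of \<A>] by blast
  have "z \<in> M \<or> inverse z \<in> M" if "z \<noteq> 0" for z
    using M that by (intro maximal_is_valuation_ring[of M y]) (auto simp: \<A>_def x_def)
  then show ?thesis
    using M(1) by (auto simp: \<A>_def)
qed

end

section \<open>From a valuation ring containing T to a real absolute value\<close>

context dependent
begin

context
  fixes V :: "'k set" and y :: 'k
  assumes V: "subalgebra V" and val: "\<And>z. z \<noteq> 0 \<Longrightarrow> z \<in> V \<or> inverse z \<in> V"
    and TV: "T \<in> V" and y: "y \<notin> V"
begin

private definition U :: "'k set" where
  "U = {z. z \<noteq> 0 \<and> z \<in> V \<and> inverse z \<in> V}"

private definition m :: "'k set" where
  "m = V - U"

private lemma U_mult: "a \<in> U \<Longrightarrow> b \<in> U \<Longrightarrow> a * b \<in> U"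
  using subalgebraD(5)[OF V] by (auto simp: U_def)

private lemma U_inverse: "a \<in> U \<Longrightarrow> inverse a \<in> U"
  by (auto simp: U_def)

private lemma U_1: "1 \<in> U"
  using subalgebraD(3)[OF V] by (auto simp: U_def)

private lemma U_power: "a \<in> U \<Longrightarrow> a ^ k \<in> U"
  by (induction k) (auto intro: U_mult U_1)

private lemma m_mult: "a \<in> V \<Longrightarrow> b \<in> m \<Longrightarrow> a * b \<in> m"
proof -
  assume ab: "a \<in> V" "b \<in> m"
  have "a * b \<notin> U"
  proof
    assume u: "a * b \<in> U"
    then have "b \<noteq> 0" "a \<noteq> 0"
      by (auto simp: U_def)
    have "a * inverse (a * b) \<in> V"
      using u ab by (intro subalgebraD(5)[OF V]) (auto simp: U_def)
    moreover have "a * inverse (a * b) = inverse b"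
      using \<open>a \<noteq> 0\<close> by simp
    ultimately have "inverse b \<in> V"
      by metis
    then show False
      using ab \<open>b \<noteq> 0\<close> by (auto simp: m_def U_def)
  qed
  then show ?thesis
    using ab subalgebraD(5)[OF V] by (auto simp: m_def)
qed

private lemma m_0: "0 \<in> m"
  using subalgebraD(2)[OF V] by (auto simp: m_def U_def)

private lemma m_add: "a \<in> m \<Longrightarrow> b \<in> m \<Longrightarrow> a + b \<in> m"
proof -
  have *: "a + b \<in> m" if "a \<in> m" "b \<in> m" "a \<noteq> 0" "b * inverse a \<in> V" for a b
  proof -
    have "(1 + b * inverse a) * a \<in> m"
      using that subalgebraD(3)[OF V] by (intro m_mult subalgebraD(4)[OF V])
    moreover have "(1 + b * inverse a) * a = a + b"
      using that by (simp add: field_simps)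
    ultimately show ?thesis
      by simp
  qed
  assume ab: "a \<in> m" "b \<in> m"
  show ?thesis
  proof (cases "a = 0 \<or> b = 0")
    case False
    then have "b * inverse a \<in> V \<or> a * inverse b \<in> V"
      using val[of "b * inverse a"] by (auto simp: mult.commute)
    then show ?thesis
      using *[of a b] *[of b a] ab False by (auto simp: add.commute)
  qed (use ab in auto)
qed

private lemma m_sum: "(\<And>i. i \<in> I \<Longrightarrow> f i \<in> m) \<Longrightarrow> sum f I \<in> m"
  by (induction I rule: infinite_finite_induct) (auto intro: m_add m_0)

private lemma m_uminus: "a \<in> m \<Longrightarrow> - a \<in> m"
  using m_mult[of "- 1" a] subalgebraD(3,6)[OF V] by auto

private lemma not_in_V: "z \<notin> V \<Longrightarrow> inverse z \<in> m"
  using val[of z] subalgebraD(2)[OF V] by (auto simp: m_def U_def)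

text \<open>Counterpart of \<open>two_maximal_terms\<close> while no absolute value is available:
  sizes are compared by divisibility in \<open>V\<close>, which is total. If a largest term had no
  equivalent partner, dividing the sum by it would put -1 into \<open>m\<close>.\<close>

private lemma two_equivalent_terms:
  assumes "finite A" "sum f A = 0" "i0 \<in> A" "f i0 \<noteq> 0"
  shows "\<exists>i\<in>A. \<exists>j\<in>A. i \<noteq> j \<and> f i \<noteq> 0 \<and> f j \<noteq> 0 \<and> f i / f j \<in> U"
proof (rule ccontr)
  assume no: "\<not> ?thesis"
  have maximal: "\<exists>i\<in>B. \<forall>j\<in>B. f j / f i \<in> V" if "finite B" "B \<noteq> {}" "\<And>i. i \<in> B \<Longrightarrow> f i \<noteq> 0" for B
    using that
  proof (induction B rule: finite_ne_induct)
    case (singleton x)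
    then have "f x / f x \<in> V"
      using subalgebraD(3)[OF V] singleton[of x] by simp
    then show ?case
      by simp
  next
    case (insert k B)
    then obtain i where i: "i \<in> B" "\<And>j. j \<in> B \<Longrightarrow> f j / f i \<in> V"
      by auto
    have nz: "f i \<noteq> 0" "f k \<noteq> 0"
      using insert.prems i(1) by blast+
    have self: "f k / f k \<in> V"
      using subalgebraD(3)[OF V] nz by simp
    show ?case
    proof (cases "f k / f i \<in> V")
      case True
      then show ?thesis
        using i by (intro bexI[of _ i]) auto
    next
      case False
      then have ik: "f i / f k \<in> V"
        using val[of "f k / f i"] nz by simp
      have "f j / f k \<in> V" if "j \<in> B" for j
        using subalgebraD(5)[OF V i(2)[OF that] ik] nz by simp
      then show ?thesis
        using self by (intro bexI[of _ k]) auto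
    qed
  qed
  have "\<exists>i\<in>{i \<in> A. f i \<noteq> 0}. \<forall>j\<in>{i \<in> A. f i \<noteq> 0}. f j / f i \<in> V"
    by (rule maximal) (use assms(1,3,4) in auto)
  then obtain i where i: "i \<in> A" "f i \<noteq> 0" "\<And>j. j \<in> A \<Longrightarrow> f j \<noteq> 0 \<Longrightarrow> f j / f i \<in> V"
    by blast
  have "(\<Sum>j\<in>A - {i}. f j / f i) \<in> m"
  proof (rule m_sum)
    fix j assume "j \<in> A - {i}"
    then show "f j / f i \<in> m"
      using i no m_0 by (cases "f j = 0") (auto simp: m_def)
  qed
  moreover have "(\<Sum>j\<in>A - {i}. f j) = - f i"
    using assms i by (simp add: sum.remove[of A i] add_eq_0_iff)
  then have "(\<Sum>j\<in>A - {i}. f j / f i) = - 1"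
    using i by (simp flip: sum_divide_distrib)
  ultimately have "1 \<in> m"
    using m_uminus[of "- 1"] by simp
  then show False
    using U_1 by (auto simp: m_def)
qed

text \<open>Least degree, as for \<open>ex_uniformizes\<close>. Some nonzero polynomial in
  \<open>T\<close> does lie in \<open>m\<close>: take a relation between powers of 1/y, which is in
  \<open>m\<close>, and cancel the lowest power; the lowest coefficient is then a multiple of 1/y in
  \<open>V\<close>.\<close>

private lemma ex_prime_element:
  "\<exists>P. P \<noteq> 0 \<and> ev T P \<in> m \<and> (\<forall>c. \<not> P dvd c \<longrightarrow> ev T c \<in> U)"
proof -
  have evV: "ev T c \<in> V" for c
    using ev_in_subalgebra[OF V TV] .
  have "\<exists>c. c \<noteq> 0 \<and> ev T c \<in> m"
  proof -
    obtain c where c: "\<exists>i\<le>n. c i \<noteq> 0" "(\<Sum>i\<le>n. ev T (c i) * inverse y ^ i) = 0"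
      using dep[of "\<lambda>i. inverse y ^ i"] by blast
    have x: "inverse y \<in> m"
      using not_in_V[OF y] .
    have y0: "y \<noteq> 0"
      using y subalgebraD(2)[OF V] by auto
    define d where "d = (LEAST i. i \<le> n \<and> c i \<noteq> 0)"
    have d: "d \<le> n" "c d \<noteq> 0" "\<And>i. i < d \<Longrightarrow> i \<le> n \<Longrightarrow> c i = 0"
      using LeastI_ex[of "\<lambda>i. i \<le> n \<and> c i \<noteq> 0"] c(1) not_less_Least[of _ "\<lambda>i. i \<le> n \<and> c i \<noteq> 0"]
      unfolding d_def by blast+
    have "(\<Sum>i\<le>n. ev T (c i) * inverse y ^ i) = (\<Sum>i\<in>{d..n}. ev T (c i) * inverse y ^ i)"
      using d(3) by (intro sum.mono_neutral_right) auto
    also have "\<dots> = inverse y ^ d * (\<Sum>i\<in>{d..n}. ev T (c i) * inverse y ^ (i - d))"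
      using y0 by (auto simp: sum_distrib_left power_diff field_simps intro!: sum.cong)
    finally have "(\<Sum>i\<in>{d..n}. ev T (c i) * inverse y ^ (i - d)) = 0"
      using c(2) y0 by simp
    then have "ev T (c d) + (\<Sum>i\<in>{Suc d..n}. ev T (c i) * inverse y ^ (i - d)) = 0"
      using d(1) by (simp add: sum.atLeast_Suc_atMost)
    moreover have "(\<Sum>i\<in>{Suc d..n}. ev T (c i) * inverse y ^ (i - d)) \<in> m"
    proof (rule m_sum)
      fix i assume "i \<in> {Suc d..n}"
      then obtain k where "i - d = Suc k"
        by (cases "i - d") auto
      then have "ev T (c i) * inverse y ^ (i - d) = (ev T (c i) * inverse y ^ k) * inverse y"
        by simp
      also have "\<dots> \<in> m"
        using x evV by (intro m_mult subalgebraD(5,8)[OF V]) (auto simp: m_def)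
      finally show "ev T (c i) * inverse y ^ (i - d) \<in> m" .
    qed
    ultimately have "ev T (c d) \<in> m"
      using m_uminus by (simp add: add_eq_0_iff2)
    then show ?thesis
      using d by blast
  qed
  then obtain P where P: "P \<noteq> 0 \<and> ev T P \<in> m" "\<And>c. c \<noteq> 0 \<and> ev T c \<in> m \<Longrightarrow> degree P \<le> degree c"
    using ex_has_least_nat[of "\<lambda>c. c \<noteq> 0 \<and> ev T c \<in> m" _ degree] by blast
  have "ev T c \<in> U" if "\<not> P dvd c" for c
  proof -
    have r: "c mod P \<noteq> 0"
      using that by (simp add: mod_eq_0_iff_dvd)
    then have "degree (c mod P) < degree P"
      using P degree_mod_less[of P c] by auto
    then have "ev T (c mod P) \<notin> m"
      using P(2)[of "c mod P"] r by auto
    moreover have "ev T (c div P * P) \<in> m"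
      using P evV by (auto simp: ev_mult intro: m_mult)
    moreover have "ev T (c mod P) = ev T c + - ev T (c div P * P)"
      by (simp flip: ev_diff add: minus_div_mult_eq_mod)
    ultimately have "ev T c \<notin> m"
      using m_add[of "ev T c" "- ev T (c div P * P)"] m_uminus by auto
    then show ?thesis
      using evV[of c] by (auto simp: m_def)
  qed
  then show ?thesis
    using P by blast
qed

text \<open>The value group of \<open>V\<close> is not known to be real in advance. A relation
  between powers of z gives z^j \<pi>^k in \<open>U\<close> with j > 0, so every value is a rational
  multiple of that of \<pi>, and the exponential turns these rationals into an absolute value with
  unit ball \<open>V\<close>.\<close>

lemma ex_valued_of_valuation_ring: "\<exists>N. valued N \<and> N y > 1"
proof -
  obtain P where P: "P \<noteq> 0" "ev T P \<in> m" "\<And>c. \<not> P dvd c \<Longrightarrow> ev T c \<in> U"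
    using ex_prime_element by blast
  define \<pi> where "\<pi> = ev T P"
  have \<pi>: "\<pi> \<in> m" "\<pi> \<noteq> 0"
    using P by (auto simp: \<pi>_def)
  have notunit: "\<not> P dvd 1"
  proof
    assume "P dvd 1"
    then obtain a where "P = [:a:]" "a dvd 1"
      using is_unit_poly_iff[of P] by auto
    have "a \<noteq> 0"
      using \<open>P = [:a:]\<close> P(1) by simp
    then have "const a * const (inverse a) = 1"
      by (simp flip: const_mult)
    then have "inverse (const a) = const (inverse a)"
      by (rule inverse_unique)
    then have "ev T P \<in> U"
      using subalgebraD(1)[OF V] \<open>P = [:a:]\<close> \<open>a \<noteq> 0\<close> by (auto simp: U_def)
    then show False
      using P by (auto simp: m_def)
  qed
  have ev_pi: "\<exists>k u. u \<in> U \<and> ev T c = \<pi> ^ k * u" if c: "c \<noteq> 0" for c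
  proof -
    obtain k d where "c = P ^ k * d" "\<not> P dvd d"
      using multiplicity_decomp[OF notunit P(1) c] by blast
    then show ?thesis
      using P(3) by (intro exI[of _ k] exI[of _ "ev T d"]) (simp add: ev_mult ev_power \<pi>_def)
  qed
  have pi_pow: "\<pi> ^ k \<in> V" for k
    using \<pi> by (intro subalgebraD(8)[OF V]) (auto simp: m_def)
  have pi_pow_Suc: "\<pi> ^ Suc k \<in> m" for k
    using m_mult[OF pi_pow[of k] \<pi>(1)] by (simp add: mult.commute)
  have pi_unit: "a = 0" if "\<pi> powi a \<in> U" for a
  proof (rule ccontr)
    assume "a \<noteq> 0"
    have "\<pi> ^ nat \<bar>a\<bar> \<in> U"
      using that U_inverse[OF that] by (cases "a \<ge> 0") (auto simp: power_int_def power_inverse)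
    moreover obtain k where "nat \<bar>a\<bar> = Suc k"
      using \<open>a \<noteq> 0\<close> by (cases "nat \<bar>a\<bar>") auto
    ultimately show False
      using pi_pow_Suc[of k] by (auto simp: m_def)
  qed

  \<comment> \<open>\<open>rel z r\<close>: the additive valuation of \<open>z\<close> is \<open>r\<close> if that of \<open>\<pi>\<close> is 1.\<close>
  define rel where "rel z r \<longleftrightarrow>
    (\<exists>j k. j > 0 \<and> r = - real_of_int k / real j \<and> z ^ j * \<pi> powi k \<in> U)" for z r
  have relI: "rel z (- real_of_int k / real j)" if "j > 0" "z ^ j * \<pi> powi k \<in> U" for z j k
    using that unfolding rel_def by blast
  have ex_rel: "\<exists>r. rel z r" if z: "z \<noteq> 0" for z
  proof -
    obtain c where c: "\<exists>i\<le>n. c i \<noteq> 0" "(\<Sum>i\<le>n. ev T (c i) * z ^ i) = 0"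
      using dep[of "\<lambda>i. z ^ i"] by blast
    then obtain i0 where "i0 \<le> n" "c i0 \<noteq> 0"
      by blast
    then obtain i j where ij: "i \<noteq> j" "ev T (c i) * z ^ i \<noteq> 0" "ev T (c j) * z ^ j \<noteq> 0"
        "(ev T (c i) * z ^ i) / (ev T (c j) * z ^ j) \<in> U"
      using two_equivalent_terms[of "{..n}" "\<lambda>i. ev T (c i) * z ^ i" i0] c(2) z by auto
    have *: "\<exists>r. rel z r" if "(ev T a * z ^ i) / (ev T b * z ^ j) \<in> U" "j < i" "a \<noteq> 0" "b \<noteq> 0" for i j a b
    proof -
      obtain k u l v where *: "u \<in> U" "ev T a = \<pi> ^ k * u" "v \<in> U" "ev T b = \<pi> ^ l * v"
        using ev_pi \<open>a \<noteq> 0\<close> \<open>b \<noteq> 0\<close> by metis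
      then have "u \<noteq> 0" "v \<noteq> 0"
        by (auto simp: U_def)
      then have "(ev T a * z ^ i) / (ev T b * z ^ j) * (v * inverse u) = z ^ (i - j) * \<pi> powi (int k - int l)"
        using \<pi> z \<open>j < i\<close> * by (simp add: power_diff power_int_diff field_simps)
      moreover have "(ev T a * z ^ i) / (ev T b * z ^ j) * (v * inverse u) \<in> U"
        using that * by (intro U_mult U_inverse)
      ultimately show ?thesis
        using relI[of "i - j" z "int k - int l"] \<open>j < i\<close> by auto
    qed
    show ?thesis
    proof (cases "j < i")
      case True
      then show ?thesis
        using *[of "c i" i "c j" j] ij by auto
    next
      case False
      moreover have "(ev T (c j) * z ^ j) / (ev T (c i) * z ^ i) \<in> U"
        using U_inverse[OF ij(4)] by simp
      ultimately show ?thesis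
        using *[of "c j" j "c i" i] ij by auto
    qed
  qed
  have pw: "(\<pi> powi k) ^ j = \<pi> powi (k * int j)" for k j
    by (simp only: power_int_mult power_int_of_nat)
  \<comment> \<open>Raising to the powers j' and j makes the powers of z agree; the quotient is a
    power of \<pi> in \<open>U\<close>, so its exponent is 0.\<close>
  have rel_unique: "r = r'" if r1: "rel z r" and r2: "rel z r'" for z r r'
  proof -
    obtain j k where jk: "j > 0" "r = - real_of_int k / real j" "z ^ j * \<pi> powi k \<in> U"
      using r1 unfolding rel_def by blast
    obtain j' k' where jk': "j' > 0" "r' = - real_of_int k' / real j'" "z ^ j' * \<pi> powi k' \<in> U"
      using r2 unfolding rel_def by blast
    have z: "z \<noteq> 0"
      using jk(1,3) by (intro notI) (simp add: U_def)
    have "(z ^ j * \<pi> powi k) ^ j' * inverse ((z ^ j' * \<pi> powi k') ^ j) \<in> U"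
      by (rule U_mult[OF U_power[OF jk(3)] U_inverse[OF U_power[OF jk'(3)]]])
    also have "(z ^ j * \<pi> powi k) ^ j' = z ^ (j * j') * \<pi> powi (k * int j')"
      by (simp only: power_mult_distrib pw power_mult[symmetric])
    also have "(z ^ j' * \<pi> powi k') ^ j = z ^ (j * j') * \<pi> powi (k' * int j)"
      by (simp only: power_mult_distrib pw power_mult[symmetric] mult.commute[of j' j])
    also have "z ^ (j * j') * \<pi> powi (k * int j') * inverse (z ^ (j * j') * \<pi> powi (k' * int j)) = \<pi> powi (k * int j' - k' * int j)"
      using z power_int_diff[of \<pi> "k * int j'" "k' * int j"] \<pi>(2) by (simp add: field_simps)
    finally have "k * int j' = k' * int j"
      using pi_unit[of "k * int j' - k' * int j"] by simp
    then have "real_of_int k * real j' = real_of_int k' * real j"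
      by (metis (no_types) of_int_mult of_int_of_nat_eq)
    then show ?thesis
      using jk(1) jk'(1) unfolding jk(2) jk'(2) by (simp add: field_simps)
  qed
  have rel_mult: "rel (z * w) (r + s)" if r1: "rel z r" and r2: "rel w s" for z w r s
  proof -
    obtain j k where jk: "j > 0" "r = - real_of_int k / real j" "z ^ j * \<pi> powi k \<in> U"
      using r1 unfolding rel_def by blast
    obtain j' k' where jk': "j' > 0" "s = - real_of_int k' / real j'" "w ^ j' * \<pi> powi k' \<in> U"
      using r2 unfolding rel_def by blast
    have "(z ^ j * \<pi> powi k) ^ j' * (w ^ j' * \<pi> powi k') ^ j \<in> U"
      by (rule U_mult[OF U_power[OF jk(3)] U_power[OF jk'(3)]])
    also have "(z ^ j * \<pi> powi k) ^ j' = z ^ (j * j') * \<pi> powi (k * int j')"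
      by (simp only: power_mult_distrib pw power_mult[symmetric])
    also have "(w ^ j' * \<pi> powi k') ^ j = w ^ (j * j') * \<pi> powi (k' * int j)"
      by (simp only: power_mult_distrib pw power_mult[symmetric] mult.commute[of j' j])
    also have "z ^ (j * j') * \<pi> powi (k * int j') * (w ^ (j * j') * \<pi> powi (k' * int j)) = (z * w) ^ (j * j') * \<pi> powi (k * int j' + k' * int j)"
      using \<pi> by (simp add: power_mult_distrib power_int_add)
    finally have "rel (z * w) (- real_of_int (k * int j' + k' * int j) / real (j * j'))"
      using jk jk' by (intro relI) auto
    also have "- real_of_int (k * int j' + k' * int j) / real (j * j') = r + s"
      using jk(1) jk'(1) unfolding jk(2) jk'(2) by (simp add: field_simps)
    finally show ?thesis .
  qed
  have rel_inverse: "rel (inverse z) (- r)" if r1: "rel z r" for z r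
  proof -
    obtain j k where jk: "j > 0" "r = - real_of_int k / real j" "z ^ j * \<pi> powi k \<in> U"
      using r1 unfolding rel_def by blast
    have "inverse (z ^ j * \<pi> powi k) = inverse z ^ j * \<pi> powi (- k)"
      by (simp add: power_inverse power_int_minus)
    then have "rel (inverse z) (- real_of_int (- k) / real j)"
      using U_inverse[OF jk(3)] jk(1) by (intro relI) auto
    then show ?thesis
      using jk by simp
  qed
  have rel_m: "r > 0" if r1: "rel z r" and zm: "z \<in> m" for z r
  proof -
    obtain j k where jk: "j > 0" "r = - real_of_int k / real j" "z ^ j * \<pi> powi k \<in> U"
      using r1 unfolding rel_def by blast
    have "z ^ j \<in> m"
      using m_mult[of "z ^ (j - 1)" z] zm jk(1) subalgebraD(8)[OF V, of z "j - 1"]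
      by (simp add: m_def power_eq_if mult.commute)
    moreover have "\<pi> powi k \<in> V" if "k \<ge> 0"
      using that pi_pow by (simp add: power_int_def)
    ultimately have "\<not> k \<ge> 0"
      using m_mult[of "\<pi> powi k" "z ^ j"] jk(3) by (auto simp: m_def mult.commute)
    then show ?thesis
      using jk by (auto simp: divide_less_0_iff)
  qed
  have rel_U: "r = 0" if "rel z r" "z \<in> U" for z r
  proof -
    have "rel z 0"
      using that relI[of 1 z 0] by simp
    then show ?thesis
      using that rel_unique by blast
  qed
  have rel_V: "r \<ge> 0 \<longleftrightarrow> z \<in> V" if "rel z r" for z r
  proof (cases "z \<in> V")
    case True
    then show ?thesis
      using rel_m[OF that] rel_U[OF that] by (cases "z \<in> U") (auto simp: m_def)
  next
    case False
    then show ?thesis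
      using rel_m[OF rel_inverse[OF that] not_in_V] by auto
  qed
  define N where "N z = (if z = 0 then 0 else exp (- (THE r. rel z r)))" for z
  have N: "N z = exp (- r)" if "rel z r" for z r
  proof -
    have "z \<noteq> 0"
      using that unfolding rel_def by (intro notI) (auto simp: U_def)
    moreover have "(THE r. rel z r) = r"
      using that rel_unique by blast
    ultimately show ?thesis
      by (simp add: N_def)
  qed
  have N0: "N 0 = 0"
    by (simp add: N_def)
  have Nmult: "N (z * w) = N z * N w" for z w
  proof (cases "z = 0 \<or> w = 0")
    case False
    then obtain r s where rs: "rel z r" "rel w s"
      using ex_rel by metis
    then show ?thesis
      using N[OF rs(1)] N[OF rs(2)] N[OF rel_mult[OF rs]]
      by (simp flip: exp_add)
  qed (auto simp: N0)
  have NV: "N z \<le> 1 \<longleftrightarrow> z \<in> V" for z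
  proof (cases "z = 0")
    case False
    then obtain r where "rel z r"
      using ex_rel by blast
    then show ?thesis
      using N rel_V by simp
  qed (use N0 subalgebraD(2)[OF V] in auto)
  have Nnn: "N z \<ge> 0" for z
    by (simp add: N_def)
  \<comment> \<open>After division by the larger term the claim becomes that \<open>V\<close> is
    closed under adding 1.\<close>
  have ultra: "N (z + w) \<le> max (N z) (N w)" for z w
  proof -
    have *: "N (z + w) \<le> N w" if "N z \<le> N w" "w \<noteq> 0" for z w
    proof -
      have w: "N w > 0"
        using that by (simp add: N_def)
      have "N (z / w) * N w = N z"
        using that by (simp flip: Nmult)
      then have "N (z / w) * N w \<le> 1 * N w"
        using that by simp
      then have "N (z / w) \<le> 1"
        using w by (simp only: mult_le_cancel_right_pos)
      then have "z / w + 1 \<in> V"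
        using subalgebraD(3,4)[OF V] by (auto simp: NV)
      then have "N (z / w + 1) * N w \<le> N w"
        using NV Nnn w by (simp add: mult_left_le_one_le)
      then show ?thesis
        using that by (simp add: ring_distribs flip: Nmult)
    qed
    show ?thesis
    proof (cases "z = 0 \<or> w = 0")
      case False
      then show ?thesis
        using *[of z w] *[of w z] by (cases "N z \<le> N w") (auto simp: add.commute)
    qed auto
  qed
  have Ny: "N y > 1"
    using NV[of y] y by auto
  have "valued N"
  proof
    show "\<exists>x. x \<noteq> 0 \<and> N x \<noteq> 1"
      using Ny N0 by (intro exI[of _ y]) auto
  qed (use Nnn ultra Nmult N0 in \<open>auto simp: N_def\<close>)
  then show ?thesis
    using Ny by blast
qed

end

text \<open>Reversing a polynomial of degree at most D multiplies its value by T^-D. Exchanging t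
  and 1/t extends what is proved for places with |t| <= 1 to all others.\<close>

lemma dependent_inverse: "dependent const (inverse T) n"
proof -
  define rev where "rev D P = (\<Sum>i\<le>D. monom (coeff P i) (D - i))" for D and P :: "'f poly"
  have "ev T [:0, 1:] \<noteq> 0"
    by (subst ev_eq_0_iff) simp
  then have T0: "T \<noteq> 0"
    by simp
  have ev_altdef: "ev S P = (\<Sum>i\<le>D. const (coeff P i) * S ^ i)" if "degree P \<le> D" for S P D
  proof -
    have "ev S P = (\<Sum>i\<le>degree P. const (coeff P i) * S ^ i)"
      by (simp add: ev_def poly_altdef coeff_map_poly degree_map_poly)
    also have "\<dots> = (\<Sum>i\<le>D. const (coeff P i) * S ^ i)"
      using that by (intro sum.mono_neutral_left) (auto simp: coeff_eq_0)
    finally show ?thesis .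
  qed
  have ev_rev: "ev (inverse S) (rev D P) = inverse S ^ D * ev S P" if "degree P \<le> D" "S \<noteq> 0" for S P D
    unfolding ev_altdef[OF that(1)] using that(2)
    by (auto simp: rev_def ev_sum ev_monom sum_distrib_left power_diff field_simps intro!: sum.cong)
  have rev_eq_0: "P = 0" if "rev D P = 0" "degree P \<le> D" for D P
  proof (rule poly_eqI)
    fix i
    show "coeff P i = coeff 0 i"
    proof (cases "i \<le> D")
      case True
      have "coeff (rev D P) (D - i) = (\<Sum>j\<le>D. if j = i then coeff P j else 0)"
        unfolding rev_def coeff_sum using True by (intro sum.cong) auto
      then show ?thesis
        using that True by simp
    qed (use that in \<open>auto simp: coeff_eq_0\<close>)
  qed
  show ?thesis
  proof
    fix P :: "'f poly" assume P: "ev (inverse T) P = 0"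
    have "ev T (rev (degree P) P) = 0"
      using ev_rev[of P "degree P" "inverse T"] P T0 by simp
    then have "rev (degree P) P = 0"
      by simp
    then show "P = 0"
      using rev_eq_0[of "degree P" P] by simp
  next
    fix z :: "nat \<Rightarrow> 'k"
    obtain c where c: "\<exists>i\<le>n. c i \<noteq> 0" "(\<Sum>i\<le>n. ev T (c i) * z i) = 0"
      using dep[of z] by blast
    \<comment> \<open>One exponent for all coefficients, so that the whole relation is multiplied by
      a single power of 1/T.\<close>
    define D where "D = (\<Sum>i\<le>n. degree (c i))"
    have D: "degree (c i) \<le> D" if "i \<le> n" for i
      unfolding D_def using that by (intro member_le_sum) auto
    have "(\<Sum>i\<le>n. ev (inverse T) (rev D (c i)) * z i) = inverse T ^ D * (\<Sum>i\<le>n. ev T (c i) * z i)"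
      unfolding sum_distrib_left using ev_rev[OF D T0] by (intro sum.cong) auto
    then have "(\<Sum>i\<le>n. ev (inverse T) (rev D (c i)) * z i) = 0"
      using c(2) by simp
    moreover have "\<exists>i\<le>n. rev D (c i) \<noteq> 0"
      using c(1) rev_eq_0 D by blast
    ultimately show "\<exists>c. (\<exists>i\<le>n. c i \<noteq> 0) \<and> (\<Sum>i\<le>n. ev (inverse T) (c i) * z i) = 0"
      by (intro exI[of _ "\<lambda>i. rev D (c i)"]) simp
  qed
qed

lemma ex_valued:
  assumes "\<And>c. c \<noteq> 0 \<Longrightarrow> ev y c \<noteq> 0"
  shows "\<exists>N. valued N \<and> N y > 1"
proof -
  obtain V where V: "subalgebra V" "\<And>z. z \<noteq> 0 \<Longrightarrow> z \<in> V \<or> inverse z \<in> V" "y \<notin> V"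
    using ex_valuation_ring[OF assms] by blast
  show ?thesis
  proof (cases "T \<in> V")
    case True
    then show ?thesis
      using ex_valued_of_valuation_ring[OF V(1,2) _ V(3)] by blast
  next
    case False
    then have "inverse T \<in> V"
      using V subalgebraD(2)[OF V(1)] by metis
    then show ?thesis
      using dependent.ex_valued_of_valuation_ring[OF dependent_inverse V(1,2) _ V(3)] by blast
  qed
qed

end

section \<open>Finiteness theorems\<close>

lemma ln_powi: "x > 0 \<Longrightarrow> ln (x powi m) = of_int m * ln (x :: real)"
  by (cases "m \<ge> 0") (auto simp: power_int_def ln_realpow ln_inverse)

text \<open>Division with remainder by the least positive multiple of \<rho> that occurs as a
  logarithm. It serves for the full multiplicative group and for groups of S-units.\<close>

lemma discrete_subgroup_generator:
  assumes "valued N" and H: "\<And>x y. x \<in> H \<Longrightarrow> y \<in> H \<Longrightarrow> x * y \<in> H" "\<And>x. x \<in> H \<Longrightarrow> inverse x \<in> H"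
    "0 \<notin> H" and z0: "z0 \<in> H" "N z0 \<noteq> 1"
    and discrete: "\<rho> > 0" "\<And>z. z \<noteq> 0 \<Longrightarrow> \<exists>m::int. ln (N z) = of_int m * \<rho>"
  shows "\<exists>g\<in>H. N g > 1 \<and> (\<forall>z\<in>H. \<exists>m::int. N z = N g powi m)"
proof -
  interpret valued N by fact
  have lnz: "\<exists>m::int. ln (N z) = of_int m * \<rho>" if "z \<in> H" for z
    using discrete(2) H(3) that by metis
  have pos: "N z > 0" if "z \<in> H" for z
    using H(3) that by auto
  have one: "1 \<in> H"
    using H(1)[OF z0(1) H(2)[OF z0(1)]] H(3) z0(1) by (cases "z0 = 0") auto
  have powH: "z ^ k \<in> H" if "z \<in> H" for z k
    using that by (induction k) (auto intro: H one)
  have powiH: "z powi k \<in> H" if "z \<in> H" for z k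
    using that by (auto simp: power_int_def powH H)
  define ok where "ok k z \<longleftrightarrow> z \<in> H \<and> k > 0 \<and> ln (N z) = of_int (int k) * \<rho>" for k z
  have "\<exists>k z. ok k z"
  proof -
    obtain k where k: "ln (N z0) = of_int k * \<rho>"
      using lnz[OF z0(1)] by blast
    have "ln (N z0) \<noteq> 0"
      using z0(2) pos[OF z0(1)] by simp
    then have "k \<noteq> 0"
      using k by auto
    show ?thesis
    proof (cases "k > 0")
      case True
      then have "ok (nat k) z0"
        using k z0 by (simp add: ok_def)
      then show ?thesis
        by blast
    next
      case False
      then have "ok (nat (- k)) (inverse z0)"
        using k z0 \<open>k \<noteq> 0\<close> H(2) pos[OF z0(1)] by (simp add: ok_def inverse ln_inverse)
      then show ?thesis
        by blast
    qed
  qed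
  then obtain k where k: "\<exists>z. ok k z" "\<And>j. j < k \<Longrightarrow> \<not> (\<exists>z. ok j z)"
    using exists_least_iff[of "\<lambda>k. \<exists>z. ok k z"] by blast
  then obtain g where g: "ok k g"
    by blast
  then have gH: "g \<in> H" "k > 0" "ln (N g) = of_int (int k) * \<rho>"
    by (auto simp: ok_def)
  have "N g > 1"
    using gH discrete(1) pos[OF gH(1)] by (metis ln_gt_zero_imp_gt_one mult_pos_pos of_int_0_less_iff of_nat_0_less_iff)
  moreover have "\<exists>m::int. N z = N g powi m" if z: "z \<in> H" for z
  proof -
    obtain m where m: "ln (N z) = of_int m * \<rho>"
      using lnz[OF z] by blast
    define d where "d = m div int k"
    define w where "w = z * g powi (- d)"
    have wH: "w \<in> H"
      unfolding w_def using z gH by (intro H powiH)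
    have lnw: "ln (N w) = of_int (m mod int k) * \<rho>"
    proof -
      have "ln (N g powi (- d)) = of_int (- d) * ln (N g)"
        using pos[OF gH(1)] by (simp add: ln_powi)
      then have "ln (N w) = of_int m * \<rho> + of_int (- d) * (of_int (int k) * \<rho>)"
        using pos[OF z] pos[OF gH(1)] m gH(3) unfolding w_def by (simp add: mult power_int ln_mult zero_iff)
      also have "\<dots> = of_int (m - d * int k) * \<rho>"
        by (simp add: algebra_simps)
      also have "m - d * int k = m mod int k"
        by (simp add: d_def minus_div_mult_eq_mod)
      finally show ?thesis .
    qed
    have "m mod int k = 0"
    proof (rule ccontr)
      assume nz: "m mod int k \<noteq> 0"
      have "0 \<le> m mod int k" "m mod int k < int k"
        using gH(2) by simp_all
      with nz have j: "0 < nat (m mod int k)" "nat (m mod int k) < k" "int (nat (m mod int k)) = m mod int k"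
        by linarith+
      then have "ok (nat (m mod int k)) w"
        using wH lnw by (simp only: ok_def simp_thms)
      with j(2) show False
        using k(2) by blast
    qed
    then have "N w = 1"
      using lnw pos[OF wH] by simp
    then have "N z = N g powi d"
      using pos[OF gH(1)] by (simp add: w_def divide power_int power_int_minus flip: divide_inverse)
    then show ?thesis
      by blast
  qed
  ultimately show ?thesis
    using gH by blast
qed

text \<open>\<open>pdep\<close> says [K : K^p] <= p, with coefficients in K^p written as p-th
  powers. \<open>complete\<close> and \<open>distinct\<close> say that \<open>M\<close> indexes each
  class of absolute values exactly once.\<close>

locale function_field = dependent const t n
  for const :: "'f::{finite,field} \<Rightarrow> 'k::field" and t :: 'k and n :: nat +
  fixes M :: "'v set" and N :: "'v \<Rightarrow> 'k \<Rightarrow> real"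
    and p :: nat
  assumes p_CHAR: "p = CHAR('k)"
    and pdep: "\<exists>h. (\<exists>i\<le>p. h i \<noteq> 0) \<and> (\<Sum>i\<le>p. h i ^ p * z i) = (0 :: 'k)"
    and N_valued: "v \<in> M \<Longrightarrow> valued (N v)"
    and complete: "valued N' \<Longrightarrow> \<exists>v\<in>M. \<exists>s>0. \<forall>x. N v x = N' x powr s"
    and distinct: "v \<in> M \<Longrightarrow> w \<in> M \<Longrightarrow> v \<noteq> w \<Longrightarrow> s > 0 \<Longrightarrow> \<exists>x. N w x \<noteq> N v x powr s"
begin

lemma p_pos: "p > 0" "p > 1"
  using prime_CHAR prime_gt_0_nat prime_gt_1_nat by (auto simp: p_CHAR)

lemma p_add: "(x + y :: 'k) ^ p = x ^ p + y ^ p"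
  by (rule freshmans_dream[OF prime_CHAR p_CHAR])

lemma p_zero [simp]: "(0 :: 'k) ^ p = 0"
  using p_pos by simp

lemma p_minus: "(- x :: 'k) ^ p = - (x ^ p)"
proof -
  have "(- x) ^ p + x ^ p = (- x + x) ^ p"
    by (rule p_add[symmetric])
  then show ?thesis
    by (simp add: eq_neg_iff_add_eq_0)
qed

lemma p_diff: "(x - y :: 'k) ^ p = x ^ p - y ^ p"
  using p_add[of x "- y"] by (simp add: p_minus)

lemma t_nonzero: "t \<noteq> 0"
proof -
  have "ev t [:0, 1:] \<noteq> 0"
    by (subst ev_eq_0_iff) simp
  then show ?thesis
    by simp
qed

sublocale inv: dependent const "inverse t" n
  by (rule dependent_inverse)

lemma N_cases: "v \<in> M \<Longrightarrow> N v t \<le> 1 \<or> N v (inverse t) \<le> 1"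
proof -
  assume "v \<in> M"
  then interpret valued "N v"
    by (rule N_valued)
  show ?thesis
    using t_nonzero by (auto simp: inverse inverse_le_1_iff)
qed

lemma value_generator:
  assumes "v \<in> M"
  shows "\<exists>g. N v g > 1 \<and> (\<forall>z. z \<noteq> 0 \<longrightarrow> (\<exists>m::int. N v z = N v g powi m))"
proof -
  interpret valued "N v"
    using assms by (rule N_valued)
  obtain \<rho> where "\<rho> > 0" "\<And>z. z \<noteq> 0 \<Longrightarrow> \<exists>m::int. ln (N v z) = of_int m * \<rho>"
    using discrete[OF valued_axioms] inv.discrete[OF valued_axioms] N_cases[OF assms] by blast
  moreover obtain z0 where "z0 \<noteq> 0" "N v z0 \<noteq> 1"
    using nontriv by blast
  ultimately show ?thesis
    using discrete_subgroup_generator[of "N v" "UNIV - {0}" z0 \<rho>] valued_axioms by auto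
qed

lemma finite_residues:
  assumes "v \<in> M" "\<And>x. x \<in> A \<Longrightarrow> N v x \<le> 1" "\<And>x y. x \<in> A \<Longrightarrow> y \<in> A \<Longrightarrow> x \<noteq> y \<Longrightarrow> N v (x - y) = 1"
  shows "finite A"
  using N_cases[OF assms(1)]
proof
  assume "N v t \<le> 1"
  then show ?thesis
    using finite_residue_field[OF N_valued[OF assms(1)], of A] assms by blast
next
  assume "N v (inverse t) \<le> 1"
  then show ?thesis
    using inv.finite_residue_field[OF N_valued[OF assms(1)], of A] assms by blast
qed

text \<open>If the logarithms, normalized to 1 at \<pi>, agreed everywhere, \<open>N w\<close> would
  be a power of \<open>N v\<close>. Otherwise a rational m/k lies strictly between them at some z,
  and z^k \<pi>^-m separates the two places.\<close>

lemma separate: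
  assumes vw: "v \<in> M" "w \<in> M" "v \<noteq> w" and \<pi>: "N v \<pi> < 1" "N w \<pi> < 1" "\<pi> \<noteq> 0"
  shows "\<exists>z. N v z > 1 \<and> N w z < 1"
proof -
  interpret v: valued "N v"
    using vw by (intro N_valued)
  interpret w: valued "N w"
    using vw by (intro N_valued)
  define a where "a z = ln (N v z) / ln (N v \<pi>)" for z
  define b where "b z = ln (N w z) / ln (N w \<pi>)" for z
  have neg: "ln (N v \<pi>) < 0" "ln (N w \<pi>) < 0"
    using \<pi> by auto
  have "\<exists>z. z \<noteq> 0 \<and> a z < b z"
  proof (rule ccontr)
    assume no: "\<not> ?thesis"
    have eq: "a z = b z" if "z \<noteq> 0" for z
    proof -
      have "a (inverse z) = - a z" "b (inverse z) = - b z"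
        using that by (simp_all add: a_def b_def v.inverse w.inverse ln_inverse)
      then show ?thesis
        using no that by (metis antisym_conv3 inverse_nonzero_iff_nonzero neg_less_iff_less)
    qed
    define s where "s = ln (N w \<pi>) / ln (N v \<pi>)"
    have "s > 0"
      using neg by (simp add: s_def divide_neg_neg)
    have "N w z = N v z powr s" for z
    proof (cases "z = 0")
      case False
      have "ln (N w z) = s * ln (N v z)"
        using eq[OF False] neg by (simp add: a_def b_def s_def field_simps)
      then show ?thesis
        using False by (metis exp_ln powr_def v.pos_iff w.pos_iff less_irrefl)
    qed simp
    then show False
      using distinct[OF vw \<open>s > 0\<close>] by blast
  qed
  then obtain z where z: "z \<noteq> 0" "a z < b z"
    by blast
  obtain r where r: "r \<in> \<rat>" "a z < r" "r < b z"
    using Rats_dense_in_real[OF z(2)] by blast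
  obtain m k where mk: "r = real_of_int m / real k" "k \<noteq> 0"
    using r(1) unfolding Rats_eq_int_div_nat by blast
  define u where "u = z ^ k * \<pi> powi (- m)"
  have u: "u \<noteq> 0"
    using z \<pi> by (simp add: u_def)
  have lnu: "ln (U u) = ln (U \<pi>) * (real k * (ln (U z) / ln (U \<pi>)) - real_of_int m)"
    if "valued U" "ln (U \<pi>) < 0" for U
  proof -
    interpret U: valued U by fact
    have "ln (U u) = real k * ln (U z) - real_of_int m * ln (U \<pi>)"
      using z \<pi> by (simp add: u_def U.mult U.power U.power_int ln_mult ln_realpow ln_powi U.zero_iff)
    then show ?thesis
      using that by (simp add: field_simps)
  qed
  have "real k * a z < real_of_int m" "real_of_int m < real k * b z"
    using r mk by (simp_all add: field_simps)
  then have "ln (N v u) > 0" "ln (N w u) < 0"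
    using lnu[OF v.valued_axioms neg(1)] lnu[OF w.valued_axioms neg(2)] neg
    by (simp_all add: a_def b_def mult_neg_neg mult_neg_pos)
  then have "N v u > 1" "N w u < 1"
    using u by simp_all
  then show ?thesis
    by blast
qed

lemma N_inj: "inj_on N M"
proof (rule inj_onI, rule ccontr)
  fix v w assume vw: "v \<in> M" "w \<in> M" "N v = N w" "v \<noteq> w"
  then obtain x where "N w x \<noteq> N v x powr 1"
    using distinct[of v w 1] by auto
  then show False
    using vw valued.nonneg[OF N_valued[OF vw(2)], of x] by simp
qed

lemma finite_below:
  assumes "dependent const T n" and c: "c \<noteq> 0"
  shows "finite {v \<in> M. N v T \<le> 1 \<and> N v (ev T c) < 1}"
proof -
  interpret T: dependent const T n by fact
  let ?V = "{v \<in> M. N v T \<le> 1 \<and> N v (ev T c) < 1}"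
  have "finite (N ` ?V)"
  proof (rule T.finite_places_below[where c = c])
    fix N1 N2 assume "N1 \<in> N ` ?V" "N2 \<in> N ` ?V" "N1 \<noteq> N2"
    then show "\<exists>z. N1 z > 1 \<and> N2 z < 1"
      using c by (auto intro!: separate[where \<pi> = "ev T c"])
  qed (use c N_valued in auto)
  then show ?thesis
    by (rule finite_imageD) (use N_inj in \<open>auto intro: inj_on_subset\<close>)
qed

text \<open>Away from the poles of t and the zeros of the nonzero coefficients of a relation between
  powers of x, these coefficients have value 1. Two maximal terms then give
  \<open>N v x ^ i = N v x ^ j\<close>.\<close>

lemma finite_places_not_1:
  assumes "x \<noteq> 0"
  shows "finite {v \<in> M. N v x \<noteq> 1}"
proof -
  obtain c where c: "\<exists>i\<le>n. c i \<noteq> 0" "(\<Sum>i\<le>n. ev t (c i) * x ^ i) = 0"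
    using dep[of "\<lambda>i. x ^ i"] by blast
  then obtain i0 where i0: "i0 \<le> n" "c i0 \<noteq> 0"
    by blast
  let ?W = "{v \<in> M. N v (inverse t) \<le> 1 \<and> N v (ev (inverse t) [:0, 1:]) < 1} \<union>
    (\<Union>i\<in>{i. i \<le> n \<and> c i \<noteq> 0}. {v \<in> M. N v t \<le> 1 \<and> N v (ev t (c i)) < 1})"
  have "finite ?W"
    using finite_below[OF dependent_axioms] finite_below[OF inv.dependent_axioms, of "[:0, 1:]"] by auto
  moreover have "{v \<in> M. N v x \<noteq> 1} \<subseteq> ?W"
  proof (rule ccontr)
    assume "\<not> ?thesis"
    then obtain v where v: "v \<in> M" "N v x \<noteq> 1" "v \<notin> ?W"
      by blast
    interpret valued "N v"
      using v by (intro N_valued)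
    have tv: "N v t \<le> 1"
      using v(1,3) t_nonzero by (auto simp: inverse inverse_le_1_iff inverse_less_1_iff)
    have one: "N v (ev t (c i)) = 1" if "i \<le> n" "c i \<noteq> 0" for i
      using v(1,3) tv that ev_le_1[OF valued_axioms tv, of "c i"] by fastforce
    obtain i j where ij: "i \<le> n" "j \<le> n" "i \<noteq> j" "ev t (c i) * x ^ i \<noteq> 0"
      "N v (ev t (c i) * x ^ i) = N v (ev t (c j) * x ^ j)"
      using two_maximal_terms[of "{..n}" "\<lambda>i. ev t (c i) * x ^ i" i0] i0 c(2) assms by auto
    then have "ev t (c j) * x ^ j \<noteq> 0"
      by (metis zero_iff)
    then have "N v x ^ i = N v x ^ j"
      using ij one[of i] one[of j] by (simp add: mult power)
    then show False
      using v(2) assms ij(3) pos_iff[of x] power_inject_exp'[of "N v x" i j] by auto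
  qed
  ultimately show ?thesis
    by (rule finite_subset[rotated])
qed

lemma ex_place_gt_1:
  assumes "\<And>c. c \<noteq> 0 \<Longrightarrow> ev y c \<noteq> 0"
  shows "\<exists>v\<in>M. N v y > 1"
proof -
  obtain N' where N': "valued N'" "N' y > 1"
    using ex_valued[OF assms] by blast
  then obtain v s where "v \<in> M" "s > 0" "N v y = N' y powr s"
    using complete by blast
  then show ?thesis
    using N' by (intro bexI[of _ v]) auto
qed

text \<open>An element without poles is algebraic over F_q by \<open>ex_place_gt_1\<close>. In an
  equation with constant coefficients the nonzero coefficients have value 1, so two maximal terms
  force \<open>N v z = 1\<close>.\<close>

lemma constant_of_bounded:
  assumes le: "\<And>v. v \<in> M \<Longrightarrow> N v z \<le> 1" and z: "z \<noteq> 0" and v: "v \<in> M"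
  shows "N v z = 1"
proof -
  interpret valued "N v"
    using v by (intro N_valued)
  have "\<not> (\<forall>c. c \<noteq> 0 \<longrightarrow> ev z c \<noteq> 0)"
    using ex_place_gt_1[of z] le by (meson linorder_not_le)
  then obtain c where c: "c \<noteq> 0" "ev z c = 0"
    by blast
  have "(\<Sum>i\<le>degree c. const (coeff c i) * z ^ i) = 0"
    using c(2) by (simp add: ev_def poly_altdef coeff_map_poly degree_map_poly)
  moreover have "const (coeff c (degree c)) * z ^ degree c \<noteq> 0"
    using c(1) z by simp
  ultimately obtain i j where ij: "i \<noteq> j" "const (coeff c i) * z ^ i \<noteq> 0"
    "N v (const (coeff c i) * z ^ i) = N v (const (coeff c j) * z ^ j)"
    using two_maximal_terms[of "{..degree c}" "\<lambda>i. const (coeff c i) * z ^ i" "degree c"] by auto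
  then have "const (coeff c j) * z ^ j \<noteq> 0"
    by (metis zero_iff)
  then have "N v z ^ i = N v z ^ j"
    using ij valued_const[OF valued_axioms] by (simp add: mult power)
  then show ?thesis
    using z ij(1) pos_iff[of z] power_inject_exp'[of "N v z" i j] by auto
qed

text \<open>The generator above 1 of the value group, that is, the value of an element with a simple
  pole. A bound \<open>gen v ^ k\<close> is thus a bound k on the pole order at v.\<close>

definition gen :: "'v \<Rightarrow> real" where
  "gen v = (SOME r. r > 1 \<and> (\<exists>g. r = N v g) \<and> (\<forall>z. z \<noteq> 0 \<longrightarrow> (\<exists>m::int. N v z = r powi m)))"

lemma gen:
  assumes "v \<in> M"
  shows "gen v > 1" "\<exists>g. gen v = N v g" "z \<noteq> 0 \<Longrightarrow> \<exists>m::int. N v z = gen v powi m"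
proof -
  have "\<exists>r. r > 1 \<and> (\<exists>g. r = N v g) \<and> (\<forall>z. z \<noteq> 0 \<longrightarrow> (\<exists>m::int. N v z = r powi m))"
    using value_generator[OF assms] by blast
  from someI_ex[OF this]
  show "gen v > 1" "\<exists>g. gen v = N v g" "z \<noteq> 0 \<Longrightarrow> \<exists>m::int. N v z = gen v powi m"
    unfolding gen_def by blast+
qed

text \<open>
  Lowering the bound at one place by one step of its value group costs a factor of at most
  the size of the residue field.
\<close>

lemma finite_bounded:
  assumes "finite S" "\<And>v. v \<in> M - S \<Longrightarrow> k v = 0"
  shows "finite {y. \<forall>v\<in>M. N v y \<le> gen v ^ k v}"
  using assms
proof (induction "\<Sum>v\<in>S \<inter> M. k v" arbitrary: k rule: less_induct)
  case less
  define L where "L k = {y. \<forall>v\<in>M. N v y \<le> gen v ^ k v}" for k :: "'v \<Rightarrow> nat"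
  have L_add: "x + y \<in> L k" if "x \<in> L k" "y \<in> L k" for x y k
    using that valued.add_le[OF N_valued] by (auto simp: L_def)
  have L_diff: "x - y \<in> L k" if "x \<in> L k" "y \<in> L k" for x y k
    using that L_add[of x k "- y"] valued.minus[OF N_valued] by (auto simp: L_def)
  have L_0: "0 \<in> L k" for k
    using gen(1) valued.zero[OF N_valued] by (auto simp: L_def order_trans[OF less_imp_le[OF zero_less_one] less_imp_le])
  show ?case
  proof (cases "\<forall>v\<in>M. k v = 0")
    case True
    have "\<exists>v\<in>M. N v t > 1"
      by (rule ex_place_gt_1) simp
    then obtain v0 where v0: "v0 \<in> M"
      by blast
    have le1: "N v x \<le> 1" if "x \<in> L k" "v \<in> M" for x v
      using that True by (simp add: L_def)
    \<comment> \<open>Nonzero differences of elements without poles have value 1, so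
      \<open>L k\<close> injects into the residue field at \<open>v0\<close>.\<close>
    have "finite (L k)"
    proof (rule finite_residues[OF v0])
      fix x y assume "x \<in> L k" "y \<in> L k" "x \<noteq> y"
      then show "N v0 (x - y) = 1"
        using le1[OF L_diff] by (intro constant_of_bounded v0) auto
    qed (use le1 v0 in blast)
    then show ?thesis
      by (simp add: L_def)
  next
    case False
    then obtain v where v: "v \<in> M" "k v \<noteq> 0"
      by blast
    then have "v \<in> S"
      using less.prems(2)[of v] by auto
    interpret valued "N v"
      using v by (intro N_valued)
    define k' where "k' = k(v := k v - 1)"
    have "finite (L k')"
      unfolding L_def
    proof (rule less.hyps)
      show "(\<Sum>v\<in>S \<inter> M. k' v) < (\<Sum>v\<in>S \<inter> M. k v)"
        using v \<open>v \<in> S\<close> less.prems(1) by (intro sum_strict_mono_ex1) (auto simp: k'_def)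
    qed (use less.prems in \<open>auto simp: k'_def\<close>)
    have top: "N v x = gen v ^ k v" if xk: "x \<in> L k" "x \<notin> L k'" for x
    proof -
      have x0: "x \<noteq> 0"
        using xk L_0 by blast
      then obtain m :: int where m: "N v x = gen v powi m"
        using gen(3)[OF v(1)] by blast
      obtain w where "w \<in> M" "\<not> N w x \<le> gen w ^ k' w"
        using xk(2) unfolding L_def by blast
      moreover from this have "w = v"
        using xk(1) by (auto simp: L_def k'_def split: if_splits)
      ultimately have "\<not> gen v powi m \<le> gen v powi int (k v - 1)"
        using m by (simp add: k'_def)
      then have "m > int (k v - 1)"
        using gen(1)[OF v(1)] by (meson linorder_not_le power_int_increasing less_imp_le)
      moreover have "N v x \<le> gen v powi int (k v)"
        using xk(1) v by (simp add: L_def)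
      then have "m \<le> int (k v)"
        unfolding m using gen(1)[OF v(1)] by (meson linorder_not_le power_int_strict_increasing)
      ultimately have "m = int (k v)"
        using v by linarith
      then show ?thesis
        using m by simp
    qed
    \<comment> \<open>A canonical representative modulo \<open>L k'\<close>: congruent elements
      satisfy equivalent descriptions, hence get the same choice.\<close>
    define rep where "rep x = (SOME y. y \<in> L k \<and> x - y \<in> L k')" for x
    have rep: "rep x \<in> L k \<and> x - rep x \<in> L k'" if "x \<in> L k" for x
      unfolding rep_def by (rule someI[of _ x]) (use that L_0 in auto)
    have rep_eq: "rep x = rep y" if "x \<in> L k" "y \<in> L k" "rep x - rep y \<in> L k'" for x y
    proof -
      have "x - z \<in> L k' \<longleftrightarrow> y - z \<in> L k'" for z
      proof -
        have *: "(x - rep x) - (y - rep y) + (rep x - rep y) \<in> L k'"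
          using L_add[OF L_diff that(3)] rep[OF that(1)] rep[OF that(2)] by blast
        then have "x - y \<in> L k'"
          by (simp add: algebra_simps)
        then show ?thesis
          using L_add[of "x - y" k' "y - z"] L_diff[of "x - z" k' "x - y"] by auto
      qed
      then show ?thesis
        by (simp add: rep_def)
    qed
    have "finite (rep ` L k)"
    proof (rule ccontr)
      assume inf: "infinite (rep ` L k)"
      have diff: "N v (a - b) = gen v ^ k v" if "a \<in> rep ` L k" "b \<in> rep ` L k" "a \<noteq> b" for a b
        using that rep_eq rep by (intro top L_diff) auto
      obtain a b where ab: "a \<in> rep ` L k" "b \<in> rep ` L k" "a \<noteq> b"
        using inf by (metis finite.emptyI finite.insertI finite_subset insertCI subsetI)
      \<comment> \<open>Division by one fixed difference brings all differences of representatives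
        to value 1, so that they have distinct residues.\<close>
      define d where "d = a - b"
      have d: "N v d = gen v ^ k v" "d \<noteq> 0"
        using diff ab by (auto simp: d_def)
      have "finite ((\<lambda>x. x / d) ` rep ` L k)"
      proof (rule finite_residues[OF v(1)])
        fix x assume "x \<in> (\<lambda>x. x / d) ` rep ` L k"
        then obtain y where "y \<in> L k" "x = y / d"
          using rep by blast
        then have "N v y \<le> gen v ^ k v"
          using v by (auto simp: L_def)
        then show "N v x \<le> 1"
          using d gen(1)[OF v(1)] \<open>x = y / d\<close> by (simp add: divide divide_le_eq)
      next
        fix x y assume x: "x \<in> (\<lambda>x. x / d) ` rep ` L k" and y: "y \<in> (\<lambda>x. x / d) ` rep ` L k"
          and neq: "x \<noteq> y"
        obtain x' where x': "x = x' / d" "x' \<in> rep ` L k"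
          using x by (rule imageE)
        obtain y' where y': "y = y' / d" "y' \<in> rep ` L k"
          using y by (rule imageE)
        have xy: "x = x' / d" "y = y' / d" "x' \<in> rep ` L k" "y' \<in> rep ` L k" "x' \<noteq> y'"
          using x' y' neq by auto
        then have "N v (x - y) = N v (x' - y') / N v d"
          by (simp flip: divide add: diff_divide_distrib)
        then show "N v (x - y) = 1"
          using diff[OF xy(3-5)] d pos_iff[of d] gen(1)[OF v(1)] by simp
      qed
      then show False
        using inf d(2) by (auto dest!: finite_imageD simp: inj_on_def)
    qed
    moreover have "L k \<subseteq> (\<Union>a\<in>rep ` L k. (\<lambda>b. a + b) ` L k')"
    proof
      fix x assume x: "x \<in> L k"
      then have "x = rep x + (x - rep x)" "x - rep x \<in> L k'"
        using rep by auto
      then show "x \<in> (\<Union>a\<in>rep ` L k. (\<lambda>b. a + b) ` L k')"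
        using x by blast
    qed
    ultimately have "finite (L k)"
      using \<open>finite (L k')\<close> by (meson finite_UN_I finite_imageI finite_subset)
    then show ?thesis
      by (simp add: L_def)
  qed
qed

text \<open>Otherwise the pole orders on \<open>Y\<close> are bounded everywhere and
  \<open>finite_bounded\<close> applies.\<close>

lemma unbounded:
  assumes "finite S" "infinite Y" "\<And>y v. y \<in> Y \<Longrightarrow> v \<in> M - S \<Longrightarrow> N v y \<le> 1"
  shows "\<exists>v\<in>S \<inter> M. \<forall>B. \<exists>y\<in>Y. N v y > B"
proof (rule ccontr)
  assume "\<not> ?thesis"
  then obtain B where B: "\<And>v y. v \<in> S \<inter> M \<Longrightarrow> y \<in> Y \<Longrightarrow> N v y \<le> B v"
    by (metis linorder_not_le)
  have "\<exists>k. B v \<le> gen v ^ k" if "v \<in> M" for v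
    using real_arch_pow[OF gen(1)[OF that], of "B v"] less_imp_le by blast
  then obtain k where k: "\<And>v. v \<in> M \<Longrightarrow> B v \<le> gen v ^ k v"
    by metis
  define k' where "k' v = (if v \<in> S then k v else 0)" for v
  have "finite {y. \<forall>v\<in>M. N v y \<le> gen v ^ k' v}"
    by (rule finite_bounded[OF assms(1)]) (simp add: k'_def)
  moreover have "Y \<subseteq> {y. \<forall>v\<in>M. N v y \<le> gen v ^ k' v}"
    using B k assms(3) by (force simp: k'_def)
  ultimately show False
    using assms(2) finite_subset by blast
qed

text \<open>Induction on \<open>S\<close>. The values of units at a new place form a cyclic group,
  generated by that of some h; dividing u by h^m makes it a unit there too, and only m modulo p
  matters, whence the factors h^i with i < p. For empty \<open>S\<close> the units are among the
  finitely many elements without poles.\<close>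

lemma units_mod_powers:
  assumes "finite S"
  shows "\<exists>G. finite G \<and> 0 \<notin> G \<and> (\<forall>u. u \<noteq> 0 \<and> (\<forall>v\<in>M - S. N v u = 1) \<longrightarrow>
    (\<exists>g\<in>G. \<exists>w. w \<noteq> 0 \<and> u = g * w ^ p))"
  using assms
proof (induction S rule: finite_induct)
  case empty
  have "finite {y. \<forall>v\<in>M. N v y \<le> gen v ^ 0}"
    by (rule finite_bounded[of "{}"]) auto
  then have "finite ({y. \<forall>v\<in>M. N v y \<le> gen v ^ 0} - {0})"
    by simp
  moreover have "\<exists>w. w \<noteq> 0 \<and> u = u * w ^ p" for u :: 'k
    by (rule exI[of _ 1]) simp
  ultimately show ?case
    by (intro exI[of _ "{y. \<forall>v\<in>M. N v y \<le> gen v ^ 0} - {0}"]) fastforce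
next
  case (insert v S)
  then obtain G where G: "finite G" "0 \<notin> G"
    "\<And>u. u \<noteq> 0 \<Longrightarrow> (\<forall>v\<in>M - S. N v u = 1) \<Longrightarrow> \<exists>g\<in>G. \<exists>w. w \<noteq> 0 \<and> u = g * w ^ p"
    by auto
  define H where "H = {u. u \<noteq> 0 \<and> (\<forall>w\<in>M - insert v S. N w u = 1)}"
  show ?case
  proof (cases "v \<in> M \<and> (\<exists>z\<in>H. N v z \<noteq> 1)")
    case False
    then have "\<exists>g\<in>G. \<exists>w. w \<noteq> 0 \<and> u = g * w ^ p" if "u \<in> H" for u
      using that by (intro G(3)) (auto simp: H_def)
    then show ?thesis
      using G(1,2) by (intro exI[of _ G]) (auto simp: H_def)
  next
    case True
    then obtain z0 where v: "v \<in> M" and z0: "z0 \<in> H" "N v z0 \<noteq> 1"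
      by blast
    interpret valued "N v"
      using v by (rule N_valued)
    have H_mult: "x * y \<in> H" if "x \<in> H" "y \<in> H" for x y
      using that valued.mult[OF N_valued] by (auto simp: H_def)
    have H_inv: "Fields.inverse x \<in> H" if "x \<in> H" for x
      using that valued.inverse[OF N_valued] by (auto simp: H_def)
    have disc: "\<exists>m::int. ln (N v z) = of_int m * ln (gen v)" if z: "z \<noteq> 0" for z
    proof -
      obtain m :: int where "N v z = gen v powi m"
        using gen(3)[OF v z] by blast
      then have "ln (N v z) = of_int m * ln (gen v)"
        using gen(1)[OF v] by (simp add: ln_powi)
      then show ?thesis
        by blast
    qed
    obtain h where h: "h \<in> H" "N v h > 1" "\<And>z. z \<in> H \<Longrightarrow> \<exists>m::int. N v z = N v h powi m"
      using discrete_subgroup_generator[OF valued_axioms H_mult H_inv _ z0, of "ln (gen v)"] disc gen(1)[OF v]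
      by (auto simp: H_def)
    have H_pow: "x powi m \<in> H" if "x \<in> H" for x m
      using that valued.power_int[OF N_valued] by (auto simp: H_def)
    define G' where "G' = (\<lambda>(i, g). h ^ i * g) ` ({..<p} \<times> G)"
    have "\<exists>g\<in>G'. \<exists>w. w \<noteq> 0 \<and> u = g * w ^ p" if u: "u \<in> H" for u
    proof -
      obtain m where m: "N v u = N v h powi m"
        using h(3)[OF u] by blast
      define u' where "u' = u * h powi (- m)"
      have "u' \<in> H"
        unfolding u'_def using u h by (intro H_mult H_pow)
      moreover have "N v u' = 1"
        using m h(2) by (simp add: u'_def mult power_int power_int_minus inverse power_int_eq_0_iff)
      ultimately obtain g w where gw: "g \<in> G" "w \<noteq> 0" "u' = g * w ^ p"
        using G(3)[of u'] by (auto simp: H_def)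
      have h0: "h \<noteq> 0"
        using h by (auto simp: H_def)
      define i where "i = nat (m mod int p)"
      define d where "d = m div int p"
      have i: "i < p" "m = d * int p + int i"
        using p_pos by (auto simp: i_def d_def nat_less_iff)
      have "u = h powi m * u'"
        using h0 by (simp add: u'_def power_int_minus)
      also have "h powi m = (h powi d) ^ p * h ^ i"
        using h0 by (simp add: i(2) power_int_add power_int_mult)
      finally have "u = (h ^ i * g) * (h powi d * w) ^ p"
        by (simp add: gw(3) power_mult_distrib mult_ac)
      moreover have "h ^ i * g \<in> G'"
        using i gw by (auto simp: G'_def)
      ultimately show ?thesis
        using h0 gw(2) by (intro bexI[of _ "h ^ i * g"] exI[of _ "h powi d * w"]) auto
    qed
    moreover have "finite G'"
      using G(1) by (simp add: G'_def)
    moreover have "0 \<notin> G'"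
      using G(2) h(1) by (auto simp: G'_def H_def)
    ultimately show ?thesis
      by (intro exI[of _ G']) (auto simp: H_def)
  qed
qed

subsection \<open>Approximation by \<open>p\<close>-th powers\<close>

text \<open>A nonzero term of index i has as value a power of \<open>gen v\<close> with exponent
  congruent to i modulo p. Different terms thus have different values, and the sum has the largest
  of them.\<close>

lemma independent_terms:
  assumes v: "v \<in> M" and i: "i < p" and g: "gen v = N v g"
  shows "N v (r i ^ p * g ^ i) \<le> N v (\<Sum>j<p. r j ^ p * g ^ j)"
proof (rule ccontr)
  assume *: "\<not> ?thesis"
  interpret valued "N v"
    using v by (rule N_valued)
  define R where "R = (\<Sum>j<p. r j ^ p * g ^ j)"
  \<comment> \<open>The negative of the sum is appended as term p, so that the total is 0 and
    \<open>two_maximal_terms\<close> applies; that term is too small to be one of the maximal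
    ones.\<close>
  define f where "f j = (if j < p then r j ^ p * g ^ j else - R)" for j
  have lt: "N v R < N v (f i)"
    using * i by (simp add: R_def f_def)
  then have nz: "f i \<noteq> 0"
    using nonneg[of R] by auto
  have "sum f {..p} = sum f {..<p} + f p"
    by (simp add: lessThan_Suc_atMost[symmetric])
  also have "sum f {..<p} = R"
    unfolding R_def by (intro sum.cong) (auto simp: f_def)
  finally have "sum f {..p} = 0"
    by (simp add: f_def)
  then obtain a b where ab: "a \<le> p" "b \<le> p" "a \<noteq> b" "f a \<noteq> 0" "N v (f a) = N v (f b)"
    "\<forall>k\<in>{..p}. N v (f k) \<le> N v (f a)"
    using two_maximal_terms[of "{..p}" f i] nz i by auto
  have "N v (f i) \<le> N v (f a)"
    using ab(6) i by auto
  then have ap: "a < p" "b < p"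
    using lt ab by (auto simp: f_def split: if_splits)
  have nzb: "f b \<noteq> 0"
    using ab(4,5) by (metis zero_iff)
  have "r a \<noteq> 0" "r b \<noteq> 0"
    using ab(4) nzb ap p_pos by (auto simp: f_def)
  then obtain k l :: int where kl: "N v (r a) = gen v powi k" "N v (r b) = gen v powi l"
    using gen(3)[OF v] by metis
  have g1: "gen v > 1"
    by (rule gen(1)[OF v])
  have val: "N v (f c) = gen v powi (m * int p + int c)" if "c < p" "N v (r c) = gen v powi m" for c m
    using that g1 by (simp add: f_def mult power power_int_add power_int_mult flip: g)
  have "gen v powi (k * int p + int a) = gen v powi (l * int p + int b)"
    using val[OF ap(1) kl(1)] val[OF ap(2) kl(2)] ab(5) by simp
  then have eq: "k * int p + int a = l * int p + int b"
    using g1 by (metis linorder_neqE_linordered_idom order_less_irrefl power_int_strict_increasing)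
  have "int a = (k * int p + int a) mod int p"
    using ap by simp
  also have "\<dots> = int b"
    unfolding eq using ap by simp
  finally show False
    using ab(3) by simp
qed

text \<open>In the basis 1, g, ..., g^(p-1) of K over K^p, subtracting s^p changes the coefficient
  of 1 only. A nonzero coefficient of some g^i with i >= 1 therefore bounds the distance from below,
  by \<open>independent_terms\<close>.\<close>

lemma power_gap:
  assumes v: "v \<in> M" and g: "\<nexists>s. b = s ^ p"
  shows "\<exists>c>0. \<forall>s. c \<le> N v (b - s ^ p)"
proof -
  interpret valued "N v"
    using v by (rule N_valued)
  obtain g where g: "gen v = N v g"
    using gen(2)[OF v] by blast
  then have g0: "g \<noteq> 0"
    using gen(1)[OF v] by auto
  obtain h where h: "\<exists>i\<le>p. h i \<noteq> 0" "(\<Sum>i\<le>p. h i ^ p * (if i < p then g ^ i else b)) = 0"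
    using pdep[of "\<lambda>i. if i < p then g ^ i else b"] by blast
  have h2: "(\<Sum>i<p. h i ^ p * g ^ i) + h p ^ p * b = 0"
    using h(2) by (simp add: lessThan_Suc_atMost[symmetric])
  \<comment> \<open>Otherwise the powers of g alone would be dependent over K^p.\<close>
  have hp: "h p \<noteq> 0"
  proof
    assume 0: "h p = 0"
    then obtain i where i: "i < p" "h i \<noteq> 0"
      using h(1) by (metis order_le_less)
    have "N v (h i ^ p * g ^ i) \<le> N v (\<Sum>j<p. h j ^ p * g ^ j)"
      by (rule independent_terms[OF v i(1) g])
    also have "\<dots> = 0"
      using h2 0 by simp
    finally have "h i ^ p * g ^ i = 0"
      using nonneg[of "h i ^ p * g ^ i"] zero_iff[of "h i ^ p * g ^ i"] by linarith
    then show False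
      using i g0 by simp
  qed
  define r where "r i = - (h i / h p)" for i
  have "b = - (\<Sum>i<p. h i ^ p * g ^ i) / h p ^ p"
    using h2 hp by (simp add: field_simps add_eq_0_iff)
  also have "\<dots> = (\<Sum>i<p. r i ^ p * g ^ i)"
    by (simp add: r_def p_minus power_divide sum_divide_distrib sum_negf)
  finally have b: "b = (\<Sum>i<p. r i ^ p * g ^ i)" .
  have split: "(\<Sum>i<p. f i) = f 0 + (\<Sum>i\<in>{1..<p}. f i)" for f :: "nat \<Rightarrow> 'k"
    using p_pos by (simp add: lessThan_atLeast0 sum.atLeast_Suc_lessThan)
  have "\<exists>i. 1 \<le> i \<and> i < p \<and> r i \<noteq> 0"
  proof (rule ccontr)
    assume "\<not> ?thesis"
    then have "b = r 0 ^ p"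
      unfolding b split using p_pos by (auto intro!: sum.neutral)
    then show False
      using assms(2) by blast
  qed
  then obtain i where i: "1 \<le> i" "i < p" "r i \<noteq> 0"
    by blast
  have "N v (r i ^ p * g ^ i) \<le> N v (b - s ^ p)" for s
  proof -
    define r' where "r' j = (if j = 0 then r 0 - s else r j)" for j
    have "(\<Sum>j<p. r' j ^ p * g ^ j) = b - s ^ p"
      unfolding b split by (simp add: r'_def p_diff)
    then show ?thesis
      using independent_terms[OF v i(2) g, of r'] i(1) by (simp add: r'_def)
  qed
  moreover have "N v (r i ^ p * g ^ i) > 0"
    using i g0 by simp
  ultimately show ?thesis
    by blast
qed

text \<open>Divide by y^(q^(r+1)), a p-th power because p divides q. The distance of the leading
  coefficient from a p-th power becomes at most C |y|^(q^r - q^(r+1)), below the gap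
  \<open>c\<close> once |y| is large.\<close>

lemma leading_coeff_power:
  assumes v: "v \<in> M" and unb: "\<And>B. \<exists>y\<in>Y. N v y > B" and "p dvd q" "q > 0"
    and pow: "\<And>y. y \<in> Y \<Longrightarrow> \<exists>s. (\<Sum>i\<le>Suc r. b i * y ^ (q ^ i)) + \<gamma> = s ^ p"
  shows "\<exists>s. b (Suc r) = s ^ p"
proof (rule ccontr)
  assume no: "\<not> ?thesis"
  interpret valued "N v"
    using v by (rule N_valued)
  obtain c where c: "c > 0" "\<And>s. c \<le> N v (b (Suc r) - s ^ p)"
    using power_gap[OF v, of "b (Suc r)"] no by blast
  obtain m where m: "q ^ Suc r = m * p"
    using \<open>p dvd q\<close> by (metis dvd_def dvd_power_same dvd_mult2 mult.commute power_Suc)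
  define C where "C = (\<Sum>i\<le>r. N v (b i)) + N v \<gamma>"
  have C: "N v (b i) \<le> C" if "i \<le> r" for i
    using member_le_sum[of i "{..r}" "\<lambda>i. N v (b i)"] that nonneg nonneg[of \<gamma>]
    unfolding C_def by (auto intro: add_increasing2)
  have C': "N v \<gamma> \<le> C" "C \<ge> 0"
    using sum_nonneg[of "{..r}" "\<lambda>i. N v (b i)"] nonneg unfolding C_def by auto
  \<comment> \<open>This size suffices: q^(r+1) >= q^r + 1, so the leading power gains at least one
    factor |y|, which exceeds C / c.\<close>
  obtain y where y: "y \<in> Y" "N v y > max 1 (C / c)"
    using unb by blast
  then have y1: "N v y > 1" and yc: "N v y * c > C" and y0: "y \<noteq> 0"
    using c(1) by (auto simp: divide_less_eq)
  obtain s where s: "(\<Sum>i\<le>Suc r. b i * y ^ (q ^ i)) + \<gamma> = s ^ p"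
    using pow[OF y(1)] by blast
  define R where "R = (\<Sum>i\<le>r. b i * y ^ (q ^ i)) + \<gamma>"
  have R: "N v R \<le> C * N v y ^ (q ^ r)"
    unfolding R_def
  proof (rule add_le)
    show "N v (\<Sum>i\<le>r. b i * y ^ (q ^ i)) \<le> C * N v y ^ (q ^ r)"
    proof (rule sum_le)
      fix i assume i: "i \<in> {..r}"
      have "q ^ i \<le> q ^ r"
        using i \<open>q > 0\<close> by (intro power_increasing) auto
      then have "N v y ^ q ^ i \<le> N v y ^ q ^ r"
        by (rule power_increasing) (use y1 in simp)
      then show "N v (b i * y ^ q ^ i) \<le> C * N v y ^ q ^ r"
        unfolding mult power using i C C' by (intro mult_mono) (auto intro: zero_le_power nonneg)
    qed (use C' nonneg in auto)
    show "N v \<gamma> \<le> C * N v y ^ q ^ r"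
      using C' y1 one_le_power[of "N v y" "q ^ r"] by (metis less_imp_le mult.right_neutral mult_mono nonneg order_trans zero_le_one mult_left_mono)
  qed
  have "b (Suc r) - (s / y ^ m) ^ p = - R / y ^ (q ^ Suc r)"
  proof -
    have "(s / y ^ m) ^ p = s ^ p / y ^ (q ^ Suc r)"
      unfolding m by (simp add: power_divide power_mult)
    also have "s ^ p = R + b (Suc r) * y ^ (q ^ Suc r)"
      using s by (simp add: R_def add_ac)
    finally show ?thesis
      using y0 by (simp add: field_simps)
  qed
  then have "c \<le> N v R / N v y ^ (q ^ Suc r)"
    using c(2)[of "s / y ^ m"] by (simp add: divide power del: power_Suc)
  moreover have "N v y ^ (q ^ Suc r) > 0"
    using y0 by (intro zero_less_power) simp
  ultimately have "c * N v y ^ (q ^ Suc r) \<le> N v R"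
    by (simp only: pos_le_divide_eq)
  also have "\<dots> \<le> C * N v y ^ (q ^ r)"
    by (rule R)
  also have "\<dots> < N v y * c * N v y ^ (q ^ r)"
    using yc y0 by (intro mult_strict_right_mono) auto
  also have "\<dots> = c * N v y ^ Suc (q ^ r)"
    by simp
  finally have "N v y ^ (q ^ Suc r) < N v y ^ Suc (q ^ r)"
    using c(1) by simp
  then have "q ^ Suc r < Suc (q ^ r)"
    using y1 power_strict_increasing_iff by blast
  moreover have "q \<ge> 2"
    using \<open>p dvd q\<close> \<open>q > 0\<close> p_pos dvd_imp_le[of p q] by linarith
  then have "q ^ Suc r \<ge> 2 * q ^ r"
    by simp
  ultimately show False
    using \<open>q > 0\<close> zero_less_power[of q r] by linarith
qed

text \<open>
  At a place where \<open>y\<close> is large the leading term dominates, so its coefficient is approximated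
  by \<open>p\<close>-th powers, hence is one. Subtract it and repeat.
\<close>

lemma coeffs_powers:
  assumes v: "v \<in> M" and unb: "\<And>B. \<exists>y\<in>Y. N v y > B" and "p dvd q" "q > 0"
    and pow: "\<And>y. y \<in> Y \<Longrightarrow> \<exists>s. (\<Sum>i\<le>r. b i * y ^ (q ^ i)) + \<gamma> = s ^ p"
    and i: "1 \<le> i" "i \<le> r"
  shows "\<exists>s. b i = s ^ p"
  using pow i
proof (induction r)
  case (Suc r)
  obtain s0 where s0: "b (Suc r) = s0 ^ p"
    using leading_coeff_power[OF v unb assms(3,4) Suc.prems(1)] by blast
  obtain m where m: "q ^ Suc r = m * p"
    using \<open>p dvd q\<close> by (metis dvd_def dvd_mult2 mult.commute power_Suc)
  show ?case
  proof (cases "i = Suc r")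
    case True
    then show ?thesis
      using s0 by blast
  next
    case False
    have "\<exists>s. (\<Sum>i\<le>r. b i * y ^ (q ^ i)) + \<gamma> = s ^ p" if y: "y \<in> Y" for y
    proof -
      obtain s where "(\<Sum>i\<le>Suc r. b i * y ^ (q ^ i)) + \<gamma> = s ^ p"
        using Suc.prems(1)[OF y] by blast
      moreover have "b (Suc r) * y ^ (q ^ Suc r) = (s0 * y ^ m) ^ p"
        unfolding m s0 by (simp add: power_mult power_mult_distrib)
      ultimately have "(\<Sum>i\<le>r. b i * y ^ (q ^ i)) + \<gamma> = (s - s0 * y ^ m) ^ p"
        by (simp add: p_diff algebra_simps del: power_Suc)
      then show ?thesis
        by blast
    qed
    then show ?thesis
      using Suc False by auto
  qed
qed simp

end

section \<open>Integral points in the orbit\<close>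

context function_field
begin

lemma p_inj: "x ^ p = y ^ p \<Longrightarrow> x = (y :: 'k)"
  using p_diff[of x y] p_pos by simp

text \<open>For nonzero \<open>g\<close> this is the K^p-line through \<open>g\<close>, including 0;
  Frobenius being additive, it is closed under addition.\<close>

definition ppow :: "'k \<Rightarrow> 'k set" where
  "ppow g = {g * s ^ p |s. True}"

lemma ppowI: "g * s ^ p \<in> ppow g"
  by (auto simp: ppow_def)

lemma ppowE:
  assumes "x \<in> ppow g"
  obtains s where "x = g * s ^ p"
  using assms by (auto simp: ppow_def)

lemma ppow_add:
  assumes "x \<in> ppow g" "y \<in> ppow g"
  shows "x + y \<in> ppow g"
proof -
  obtain s u where "x = g * s ^ p" "y = g * u ^ p"
    using assms by (auto simp: ppow_def)
  then have "x + y = g * (s + u) ^ p"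
    by (simp add: p_add algebra_simps)
  then show ?thesis
    by (auto simp: ppow_def)
qed

lemma ppow_0: "0 \<in> ppow g"
  using ppowI[of g 0] by simp

lemma ppow_minus: "x \<in> ppow g \<Longrightarrow> - x \<in> ppow g"
  by (metis minus_mult_right p_minus ppowE ppowI)

lemma ppow_diff: "x \<in> ppow g \<Longrightarrow> y \<in> ppow g \<Longrightarrow> x - y \<in> ppow g"
  using ppow_add[of x g "- y"] ppow_minus[of y g] by simp

lemma ppow_sum: "(\<And>i. i \<in> A \<Longrightarrow> f i \<in> ppow g) \<Longrightarrow> sum f A \<in> ppow g"
  by (induction A rule: infinite_finite_induct) (auto intro: ppow_add ppow_0)

lemma ppow_mult: "x \<in> ppow g \<Longrightarrow> x * y ^ p \<in> ppow g"
  by (elim ppowE) (simp add: ppowI mult.assoc flip: power_mult_distrib)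

lemma ppow_mult': "x \<in> ppow g \<Longrightarrow> y ^ p * x \<in> ppow g"
  using ppow_mult[of x g y] by (simp add: mult.commute)

text \<open>Only the coefficients are raised to the power p, not the variable; the variable is
  accounted for by moving the point from x to x^p, as in \<open>ev_frob\<close>.\<close>

definition frob :: "'f poly \<Rightarrow> 'f poly" where
  "frob = map_poly (\<lambda>c. c ^ p)"

lemma frob_0 [simp]: "frob 0 = 0"
  by (simp add: frob_def)

lemma frob_pCons [simp]: "frob (pCons c Q) = pCons (c ^ p) (frob Q)"
  using p_pos by (simp add: frob_def map_poly_pCons)

lemma ev_frob: "ev (x ^ p) (frob Q) = ev x Q ^ p"
  by (induction Q) (auto simp: p_add const_power power_mult_distrib)

lemma bij_frob: "bij frob"
proof (rule bijI)
  have const_inj: "const c = const d \<Longrightarrow> c = d" for c d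
    using const_add[of c "- d"] const_uminus[of d] by (metis add.right_inverse const_eq_0_iff diff_conv_add_uminus eq_iff_diff_eq_0)
  have root: "c ^ p = d ^ p \<Longrightarrow> c = d" for c d :: 'f
    using const_inj p_inj by (metis const_power)
  show "inj frob"
  proof (rule injI)
    fix P Q assume "frob P = frob Q"
    then have "coeff P i ^ p = coeff Q i ^ p" for i
      using p_pos by (metis coeff_map_poly frob_def zero_power)
    then show "P = Q"
      using root by (intro poly_eqI) blast
  qed
  have "\<exists>P. Q = frob P" for Q
  proof (induction Q)
    case (pCons c Q)
    then obtain P where "Q = frob P"
      by blast
    moreover obtain d where "const c = const d ^ p"
      using const_root[of c] p_CHAR by auto
    then have "c = d ^ p"
      by (intro const_inj) (simp add: const_power)
    ultimately show ?case
      by (intro exI[of _ "pCons d P"]) simp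
  qed (auto intro: exI[of _ 0])
  then show "surj frob"
    by (metis surjI surj_def)
qed

text \<open>Pigeonhole over the finitely many constant terms; this fixes c in Q = t R + c.\<close>

lemma infinite_pCons:
  assumes "infinite (A :: 'f poly set)"
  shows "\<exists>c. infinite {Q. pCons c Q \<in> A}"
proof (rule ccontr)
  assume "\<not> ?thesis"
  then have "finite (\<Union>c. pCons c ` {Q. pCons c Q \<in> A})"
    by simp
  moreover have "A \<subseteq> (\<Union>c. pCons c ` {Q. pCons c Q \<in> A})"
  proof
    fix P assume "P \<in> A"
    then show "P \<in> (\<Union>c. pCons c ` {Q. pCons c Q \<in> A})"
      by (cases P) auto
  qed
  ultimately show False
    using assms finite_subset by blast
qed

text \<open>
  \<open>E Q\<close> is \<open>\<phi>\<^sub>Q(\<beta>)\<close> where \<open>\<phi>\<^sub>t = \<Sum>a\<^sub>i \<tau>\<^sup>i\<close>; only this recursion is used. The field element \<open>a\<^sub>0\<close>,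
  initially \<open>t\<close>, is replaced by its \<open>p\<close>-th root in the descent.
\<close>

definition orbit :: "nat \<Rightarrow> nat \<Rightarrow> (nat \<Rightarrow> 'k) \<Rightarrow> 'k \<Rightarrow> ('f poly \<Rightarrow> 'k) \<Rightarrow> bool" where
  "orbit q r a \<beta> E \<longleftrightarrow> r \<ge> 1 \<and> a r \<noteq> 0 \<and> E 0 = 0 \<and> inj E \<and>
    (\<forall>c Q. E (pCons c Q) = const c * \<beta> + (\<Sum>i\<le>r. a i * E Q ^ (q ^ i))) \<and>
    (\<forall>Q. Q \<noteq> 0 \<longrightarrow> ev (a 0) Q \<noteq> 0)"

text \<open>At a pole of t the pole order m is a positive integer, and a p^m-th power would have
  order divisible by p^m > m.\<close>

lemma not_infinitely_divisible: "\<exists>k. \<nexists>w. t = w ^ (p ^ k)"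
proof -
  have "\<exists>v\<in>M. N v t > 1"
    by (rule ex_place_gt_1) simp
  then obtain v where v: "v \<in> M" "N v t > 1"
    by blast
  interpret valued "N v"
    using v(1) by (rule N_valued)
  obtain m :: int where m: "N v t = gen v powi m"
    using gen(3)[OF v(1) t_nonzero] by blast
  have g: "gen v > 1"
    by (rule gen(1)[OF v(1)])
  have "m > 0"
    using v(2) g unfolding m by (metis less_irrefl linorder_not_le order_less_le_trans power_int_0_right power_int_increasing less_imp_le)
  have "\<nexists>w. t = w ^ (p ^ nat m)"
  proof
    assume "\<exists>w. t = w ^ (p ^ nat m)"
    then obtain w where w: "t = w ^ (p ^ nat m)"
      by blast
    then have "w \<noteq> 0"
      using t_nonzero zero_power[of "p ^ nat m"] p_pos by auto
    then obtain j :: int where j: "N v w = gen v powi j"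
      using gen(3)[OF v(1)] by blast
    have "gen v powi m = gen v powi (j * int (p ^ nat m))"
      unfolding m[symmetric] by (subst w) (simp add: power j power_int_mult flip: of_nat_power)
    then have eq: "m = j * int (p ^ nat m)"
      using g by (metis linorder_neqE_linordered_idom order_less_irrefl power_int_strict_increasing)
    then have "int (p ^ nat m) dvd m"
      by (metis dvd_triv_right)
    then have "int (p ^ nat m) \<le> m"
      using \<open>m > 0\<close> zdvd_imp_le by blast
    then have "p ^ nat m \<le> nat m"
      by linarith
    moreover have "nat m < p ^ nat m"
      using p_pos by (intro power_gt_expt) auto
    ultimately show False
      by simp
  qed
  then show ?thesis
    by blast
qed

section \<open>One step of the descent: the data lie in g K^p up to p-th powers\<close>

context
  fixes q e :: nat
  assumes q: "q = p ^ e" "e > 0"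
begin

lemma q_pos: "q > 0" "p dvd q"
  using q p_pos by (auto intro: dvd_power)

lemma qi_add: "(x + y :: 'k) ^ (q ^ i) = x ^ (q ^ i) + y ^ (q ^ i)"
  by (rule freshmans_dream'[OF prime_CHAR, of _ "e * i"]) (simp add: q p_CHAR power_mult)

lemma qi_sum: "(\<Sum>j\<in>A. f j :: 'k) ^ (q ^ i) = (\<Sum>j\<in>A. f j ^ (q ^ i))"
  by (rule freshmans_dream_sum'[OF prime_CHAR, of _ "e * i"]) (simp add: q p_CHAR power_mult)

lemma qi_power: "i \<ge> 1 \<Longrightarrow> \<exists>s. (x :: 'k) ^ (q ^ i) = s ^ p"
proof -
  assume "i \<ge> 1"
  then obtain m where "q ^ i = m * p"
    using q_pos(2) by (metis dvd_def dvd_power dvd_trans less_eq_Suc_le One_nat_def mult.commute)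
  then show ?thesis
    by (metis power_mult)
qed

context
  fixes r :: nat and a :: "nat \<Rightarrow> 'k" and \<beta> :: 'k and E :: "'f poly \<Rightarrow> 'k" and S :: "'v set"
  assumes E: "orbit q r a \<beta> E" and finS: "finite S"
    and a_int: "\<And>v i. v \<in> M - S \<Longrightarrow> i \<le> r \<Longrightarrow> N v (a i) \<le> 1"
    and \<beta>_int: "\<And>v. v \<in> M - S \<Longrightarrow> N v \<beta> \<le> 1"
begin

private definition F :: "'k \<Rightarrow> 'k" where
  "F x = (\<Sum>i\<le>r. a i * x ^ (q ^ i))"

private lemma E_0: "E 0 = 0" and E_inj: "inj E" and r: "r \<ge> 1" "a r \<noteq> 0"
  and transcendental: "Q \<noteq> 0 \<Longrightarrow> ev (a 0) Q \<noteq> 0"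
  and E_pCons: "E (pCons c Q) = const c * \<beta> + F (E Q)"
  using E by (auto simp: orbit_def F_def)

private lemma F_add: "F (x + y) = F x + F y"
  by (simp add: F_def qi_add sum.distrib algebra_simps)

lemma E_integral: "v \<in> M - S \<Longrightarrow> N v (E Q) \<le> 1"
proof (induction Q)
  case 0
  then show ?case
    using valued.zero[OF N_valued] by (simp add: E_0)
next
  case (pCons c Q)
  then have v: "v \<in> M"
    by simp
  interpret valued "N v"
    using v by (rule N_valued)
  have "N v (const c * \<beta>) \<le> 1"
    using valued_const_le[OF valued_axioms, of c] \<beta>_int[OF pCons.prems]
    by (simp add: mult mult_le_one nonneg)
  moreover have "N v (F (E Q)) \<le> 1"
    unfolding F_def
  proof (rule sum_le)
    fix i assume "i \<in> {..r}"
    moreover have "N v (E Q) ^ (q ^ i) \<le> 1"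
      using pCons.IH[OF pCons.prems] nonneg by (intro power_le_one)
    ultimately show "N v (a i * E Q ^ q ^ i) \<le> 1"
      using a_int[OF pCons.prems, of i] nonneg zero_le_power[OF nonneg]
      unfolding mult power by (intro mult_le_one) auto
  qed simp
  ultimately show ?case
    unfolding E_pCons by (rule add_le)
qed

text \<open>Injectivity of \<open>E\<close>, which comes from non-torsion, turns infinitely many Q
  into infinitely many S-integers. These are unbounded at a place of \<open>S\<close>, where
  \<open>coeffs_powers\<close> applies to \<open>b i / g\<close>.\<close>

private lemma coeffs_in_ppow:
  assumes A: "infinite A" and g: "g \<noteq> 0"
    and pow: "\<And>Q. Q \<in> A \<Longrightarrow> (\<Sum>i\<le>m. b i * E Q ^ (q ^ i)) + \<gamma> \<in> ppow g"
    and i: "1 \<le> i" "i \<le> m"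
  shows "b i \<in> ppow g"
proof -
  have "infinite (E ` A)"
    using A E_inj by (meson finite_imageD inj_on_subset subset_UNIV)
  then obtain v where v: "v \<in> M" "\<forall>B. \<exists>y\<in>E ` A. N v y > B"
    using unbounded[OF finS, of "E ` A"] E_integral by blast
  have "\<exists>s. b i / g = s ^ p"
  proof (rule coeffs_powers[OF v(1) _ q_pos(2,1) _ i, of "E ` A" _ "\<gamma> / g"])
    show "\<exists>y\<in>E ` A. N v y > B" for B
      using v(2) by blast
    fix y assume "y \<in> E ` A"
    then obtain Q where "Q \<in> A" "y = E Q"
      by blast
    then obtain s where "(\<Sum>i\<le>m. b i * y ^ (q ^ i)) + \<gamma> = g * s ^ p"
      using pow ppowE by metis
    then have "((\<Sum>i\<le>m. b i * y ^ (q ^ i)) + \<gamma>) / g = s ^ p"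
      using g by simp
    then have "(\<Sum>i\<le>m. b i / g * y ^ (q ^ i)) + \<gamma> / g = s ^ p"
      by (simp add: add_divide_distrib sum_divide_distrib)
    then show "\<exists>s. (\<Sum>i\<le>m. b i / g * y ^ (q ^ i)) + \<gamma> / g = s ^ p"
      by blast
  qed
  then show ?thesis
    using g ppowI[of g] by (auto simp: field_simps)
qed

context
  fixes A :: "'f poly set" and g :: 'k
  assumes A: "infinite A" and g: "g \<noteq> 0" and pow: "\<And>Q. Q \<in> A \<Longrightarrow> E Q \<in> ppow g"
begin

lemma coeff_in_ppow:
  assumes "1 \<le> i" "i \<le> r"
  shows "a i \<in> ppow g"
proof -
  obtain c where c: "infinite {Q. pCons c Q \<in> A}"
    using infinite_pCons[OF A] by blast
  show ?thesis
  proof (rule coeffs_in_ppow[OF c g _ assms, where \<gamma> = "const c * \<beta>"])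
    fix Q assume "Q \<in> {Q. pCons c Q \<in> A}"
    then show "(\<Sum>i\<le>r. a i * E Q ^ q ^ i) + const c * \<beta> \<in> ppow g"
      using pow[of "pCons c Q"] by (simp add: E_pCons F_def add.commute)
  qed
qed

text \<open>Read off the coefficient of \<open>\<tau>\<^sup>r\<close> in \<open>\<phi>\<^sub>t \<phi>\<^sub>t\<close>.\<close>

lemma constant_coeff_power: "\<exists>s. a 0 = s ^ p"
proof -
  \<comment> \<open>The coefficient of tau^k in phi_t phi_t, by the rule tau^i a = a^(q^i)
    tau^i.\<close>
  define d where "d k = (\<Sum>i\<le>r. \<Sum>j\<le>r. if i + j = k then a i * a j ^ (q ^ i) else 0)" for k
  have FF: "F (F y) = (\<Sum>k\<le>2 * r. d k * y ^ (q ^ k))" for y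
  proof -
    have "F (F y) = (\<Sum>i\<le>r. \<Sum>j\<le>r. a i * a j ^ (q ^ i) * y ^ (q ^ (i + j)))"
      unfolding F_def qi_sum sum_distrib_left
      by (simp add: power_mult_distrib power_mult[symmetric] power_add mult_ac)
    also have "\<dots> = (\<Sum>i\<le>r. \<Sum>j\<le>r. \<Sum>k\<le>2 * r. if i + j = k then a i * a j ^ (q ^ i) * y ^ (q ^ k) else 0)"
      by (intro sum.cong refl) (simp add: sum.delta)
    also have "\<dots> = (\<Sum>i\<le>r. \<Sum>k\<le>2 * r. \<Sum>j\<le>r. if i + j = k then a i * a j ^ (q ^ i) * y ^ (q ^ k) else 0)"
      by (intro sum.cong refl sum.swap)
    also have "\<dots> = (\<Sum>k\<le>2 * r. \<Sum>i\<le>r. \<Sum>j\<le>r. if i + j = k then a i * a j ^ (q ^ i) * y ^ (q ^ k) else 0)"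
      by (rule sum.swap)
    also have "\<dots> = (\<Sum>k\<le>2 * r. d k * y ^ (q ^ k))"
      unfolding d_def sum_distrib_right by (intro sum.cong refl) auto
    finally show ?thesis .
  qed
  obtain c where c: "infinite {Q. pCons c Q \<in> A}"
    using infinite_pCons[OF A] by blast
  then obtain c' where c': "infinite {Q. pCons c (pCons c' Q) \<in> A}"
    using infinite_pCons[OF c] by auto
  have dr: "d r \<in> ppow g"
  proof (rule coeffs_in_ppow[OF c' g _ r(1), where m = "2 * r" and \<gamma> = "const c * \<beta> + F (const c' * \<beta>)"])
    fix Q assume "Q \<in> {Q. pCons c (pCons c' Q) \<in> A}"
    then show "(\<Sum>i\<le>2 * r. d i * E Q ^ q ^ i) + (const c * \<beta> + F (const c' * \<beta>)) \<in> ppow g"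
      using pow[of "pCons c (pCons c' Q)"] by (simp add: E_pCons F_add FF add_ac)
  qed simp
  \<comment> \<open>Only i = 0 remains to be understood: for i >= 1 the second factor is a p-th
    power and \<open>a i\<close> lies in g K^p.\<close>
  have "d r = (\<Sum>i\<le>r. a i * a (r - i) ^ (q ^ i))"
    unfolding d_def
  proof (intro sum.cong refl)
    fix i assume "i \<in> {..r}"
    then have "(\<Sum>j\<le>r. if i + j = r then a i * a j ^ (q ^ i) else 0)
        = (\<Sum>j\<le>r. if j = r - i then a i * a j ^ (q ^ i) else 0)"
      by (intro sum.cong refl if_cong) auto
    then show "(\<Sum>j\<le>r. if i + j = r then a i * a j ^ (q ^ i) else 0) = a i * a (r - i) ^ (q ^ i)"
      by simp
  qed
  also have "\<dots> = a 0 * a r + (\<Sum>i\<in>{1..r}. a i * a (r - i) ^ (q ^ i))"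
    by (simp add: atMost_atLeast0 sum.atLeast_Suc_atMost)
  finally have "a 0 * a r = d r - (\<Sum>i\<in>{1..r}. a i * a (r - i) ^ (q ^ i))"
    by simp
  moreover have "(\<Sum>i\<in>{1..r}. a i * a (r - i) ^ (q ^ i)) \<in> ppow g"
  proof (rule ppow_sum)
    fix i assume i: "i \<in> {1..r}"
    then obtain s where s: "a (r - i) ^ (q ^ i) = s ^ p"
      using qi_power[of i] by auto
    show "a i * a (r - i) ^ q ^ i \<in> ppow g"
      unfolding s using i by (intro ppow_mult coeff_in_ppow) auto
  qed
  ultimately have "a 0 * a r \<in> ppow g"
    using dr by (simp add: ppow_diff)
  then obtain u where u: "a 0 * a r = g * u ^ p"
    by (rule ppowE)
  obtain s where s: "a r = g * s ^ p"
    using coeff_in_ppow[OF r(1)] by (auto elim: ppowE)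
  have "s \<noteq> 0"
    using s r(2) p_pos by auto
  then have "a 0 = (u / s) ^ p"
    using u g by (simp add: s power_divide field_simps)
  then show ?thesis
    by blast
qed

text \<open>Modulo g K^p the terms with tau^i, i >= 1, vanish and phi_t acts as multiplication by
  a_0 up to the constant term. Being a p-th power, a_0 preserves g K^p, so the congruence survives
  the induction.\<close>

lemma E_cong_linear: "E Q - ev (a 0) Q * \<beta> \<in> ppow g"
proof (induction Q)
  case 0
  then show ?case
    by (simp add: E_0 ppow_0)
next
  case (pCons c Q)
  obtain \<theta> where \<theta>: "a 0 = \<theta> ^ p"
    using constant_coeff_power by blast
  have "F (E Q) = a 0 * E Q + (\<Sum>i\<in>{1..r}. a i * E Q ^ (q ^ i))"
    by (simp add: F_def atMost_atLeast0 sum.atLeast_Suc_atMost)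
  then have "E (pCons c Q) - ev (a 0) (pCons c Q) * \<beta>
      = \<theta> ^ p * (E Q - ev (a 0) Q * \<beta>) + (\<Sum>i\<in>{1..r}. a i * E Q ^ (q ^ i))"
    by (simp add: E_pCons \<theta> algebra_simps)
  also have "\<dots> \<in> ppow g"
  proof (intro ppow_add ppow_mult' pCons.IH ppow_sum)
    fix i assume i: "i \<in> {1..r}"
    then obtain s where s: "E Q ^ (q ^ i) = s ^ p"
      using qi_power[of i] by auto
    show "a i * E Q ^ q ^ i \<in> ppow g"
      unfolding s using i by (intro ppow_mult coeff_in_ppow) auto
  qed
  finally show ?case .
qed

text \<open>Take Q nonzero in \<open>A\<close>. Writing Q as \<open>frob P\<close> makes Q(a_0) a
  p-th power, nonzero by transcendence, which can be divided out of Q(a_0) \<beta>.\<close>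

lemma base_in_ppow: "\<beta> \<in> ppow g"
proof -
  obtain \<theta> where \<theta>: "a 0 = \<theta> ^ p"
    using constant_coeff_power by blast
  obtain Q where Q: "Q \<in> A" "Q \<noteq> 0"
    using A by (metis finite.emptyI finite.insertI finite_subset insertCI subsetI)
  obtain P where P: "Q = frob P"
    using bij_frob by (metis bij_pointE)
  define x where "x = ev \<theta> P"
  have x: "ev (a 0) Q = x ^ p"
    by (simp add: x_def \<theta> P ev_frob)
  then have "x \<noteq> 0"
    using transcendental[OF Q(2)] p_pos by auto
  have "E Q - (E Q - x ^ p * \<beta>) \<in> ppow g"
    using ppow_diff[OF pow[OF Q(1)] E_cong_linear[of Q]] x by simp
  then have "x ^ p * \<beta> \<in> ppow g"
    by simp
  then have "(1 / x) ^ p * (x ^ p * \<beta>) \<in> ppow g"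
    by (rule ppow_mult')
  then show ?thesis
    using \<open>x \<noteq> 0\<close> by (simp add: power_divide)
qed

text \<open>The conclusion reaches every Q, not only those in \<open>A\<close>; this lets the p-th
  root of E/g be defined on all polynomials.\<close>

lemma E_in_ppow: "E Q \<in> ppow g"
proof -
  obtain \<theta> where \<theta>: "a 0 = \<theta> ^ p"
    using constant_coeff_power by blast
  obtain P where P: "Q = frob P"
    using bij_frob by (metis bij_pointE)
  have "(E Q - ev (a 0) Q * \<beta>) + ev \<theta> P ^ p * \<beta> \<in> ppow g"
    by (intro ppow_add E_cong_linear ppow_mult' base_in_ppow)
  then show ?thesis
    by (simp add: \<theta> P ev_frob)
qed

text \<open>Conjugate \<open>\<phi>\<close> by \<open>g\<close>, so that all data become \<open>p\<close>-th powers, and take \<open>p\<close>-th roots.\<close>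

lemma descent:
  "\<exists>a' \<beta>' E'. orbit q r a' \<beta>' E' \<and> a 0 = a' 0 ^ p \<and> (\<forall>Q. E (frob Q) = g * E' Q ^ p)"
proof -
  obtain \<beta>' where \<beta>': "\<beta> = g * \<beta>' ^ p"
    using base_in_ppow by (rule ppowE)
  have "\<exists>s. E (frob Q) = g * s ^ p" for Q
    using E_in_ppow by (metis ppowE)
  then obtain E' where E': "\<And>Q. E (frob Q) = g * E' Q ^ p"
    by metis
  \<comment> \<open>The conjugate g^-1 phi_t g has the coefficients a_i g^(q^i - 1), here multiplied
    by g. For i >= 1, \<open>a i\<close> is in g K^p and g^(q^i) is a p-th power; for i = 0,
    \<open>a 0\<close> is a p-th power.\<close>
  have "\<exists>s. a i * g ^ (q ^ i) = g * s ^ p" if i: "i \<le> r" for i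
  proof (cases "i = 0")
    case True
    then show ?thesis
      using constant_coeff_power by (auto simp: mult.commute)
  next
    case False
    then have "a i \<in> ppow g" "\<exists>u. g ^ (q ^ i) = u ^ p"
      using coeff_in_ppow[of i] qi_power[of i g] i by auto
    then obtain s u where "a i = g * s ^ p" "g ^ (q ^ i) = u ^ p"
      by (metis ppowE)
    then show ?thesis
      by (intro exI[of _ "s * u"]) (simp add: power_mult_distrib)
  qed
  then obtain a' where a': "\<And>i. i \<le> r \<Longrightarrow> a i * g ^ (q ^ i) = g * a' i ^ p"
    by metis
  have a0: "a 0 = a' 0 ^ p"
    using a'[of 0] g by simp
  have "orbit q r a' \<beta>' E'"
    unfolding orbit_def
  proof (intro conjI allI impI)
    show "r \<ge> 1"
      by (rule r)
    show "a' r \<noteq> 0"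
      using a'[of r] r g by auto
    show "E' 0 = 0"
      using E'[of 0] g E_0 by simp
    show "inj E'"
    proof (rule injI)
      fix P Q assume "E' P = E' Q"
      then have "E (frob P) = E (frob Q)"
        by (simp add: E')
      then show "P = Q"
        using E_inj bij_frob by (meson bij_is_inj injD)
    qed
    show "ev (a' 0) Q \<noteq> 0" if "Q \<noteq> 0" for Q
    proof
      assume "ev (a' 0) Q = 0"
      then have "ev (a 0) (frob Q) = 0"
        by (simp add: a0 ev_frob)
      then have "frob Q = frob 0"
        using transcendental by auto
      then show False
        using that bij_frob by (metis bij_is_inj injD)
    qed
    fix c Q
    have "g * E' (pCons c Q) ^ p = E (pCons (c ^ p) (frob Q))"
      by (simp flip: E')
    also have "\<dots> = const c ^ p * \<beta> + F (E (frob Q))"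
      by (simp add: E_pCons const_power)
    also have "F (E (frob Q)) = (\<Sum>i\<le>r. (a i * g ^ (q ^ i)) * (E' Q ^ p) ^ (q ^ i))"
      by (simp add: F_def E' power_mult_distrib mult.assoc)
    also have "\<dots> = (\<Sum>i\<le>r. g * (a' i * E' Q ^ (q ^ i)) ^ p)"
      by (intro sum.cong refl) (simp add: a' power_mult_distrib mult.assoc mult.commute[of p] flip: power_mult)
    also have "\<dots> = g * (\<Sum>i\<le>r. a' i * E' Q ^ (q ^ i)) ^ p"
      by (simp add: freshmans_dream_sum[OF prime_CHAR p_CHAR] sum_distrib_left)
    also have "const c ^ p * \<beta> + g * (\<Sum>i\<le>r. a' i * E' Q ^ (q ^ i)) ^ p
        = g * (const c * \<beta>' + (\<Sum>i\<le>r. a' i * E' Q ^ (q ^ i))) ^ p"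
      by (simp add: \<beta>' p_add power_mult_distrib algebra_simps)
    finally show "E' (pCons c Q) = const c * \<beta>' + (\<Sum>i\<le>r. a' i * E' Q ^ (q ^ i))"
      using g p_inj by simp
  qed
  then show ?thesis
    using a0 E' by blast
qed

end

end

text \<open>Induction on k: a descent step replaces a_0 by its p-th root, which lowers k by one. For
  k = 0 the assumption is contradictory, with w = a_0.\<close>

theorem finite_integral_orbit:
  assumes "orbit q r a \<beta> E" "finite S" "\<nexists>w. a 0 = w ^ (p ^ k)"
  shows "finite {Q. \<forall>v\<in>M - S. 1 \<le> N v (E Q)}"
  using assms
proof (induction k arbitrary: a \<beta> E S)
  case 0
  then show ?case
    by auto
next
  case (Suc k)
  note E = Suc.prems(1)
  show ?case
  proof (rule ccontr)
    \<comment> \<open>0 is dropped because \<open>E 0 = 0\<close>; on \<open>A\<close> the values of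
      \<open>E\<close> are nonzero, and units outside the enlarged set \<open>S1\<close>.\<close>
    define A where "A = {Q. \<forall>v\<in>M - S. 1 \<le> N v (E Q)} - {0}"
    assume "infinite {Q. \<forall>v\<in>M - S. 1 \<le> N v (E Q)}"
    then have infA: "infinite A"
      by (simp add: A_def)
    \<comment> \<open>The empty set at 0 keeps \<open>bad\<close> finite for vanishing coefficients,
      which are integral everywhere.\<close>
    define bad where "bad x = (if x = 0 then {} else {v \<in> M. N v x \<noteq> 1})" for x
    have fin_bad: "finite (bad x)" for x
      using finite_places_not_1[of x] by (simp add: bad_def)
    define S1 where "S1 = S \<union> bad \<beta> \<union> (\<Union>i\<le>r. bad (a i))"
    have S1: "finite S1"
      using Suc.prems(2) fin_bad by (simp add: S1_def)
    have int: "N v x \<le> 1" if "v \<in> M" "v \<notin> bad x" for v x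
      using that valued.zero[OF N_valued] by (cases "x = 0") (auto simp: bad_def)
    have a_int: "N v (a i) \<le> 1" if "v \<in> M - S1" "i \<le> r" for v i
      using that by (intro int) (auto simp: S1_def)
    have \<beta>_int: "N v \<beta> \<le> 1" if "v \<in> M - S1" for v
      using that by (intro int) (auto simp: S1_def)
    have unit: "N v (E Q) = 1" if "Q \<in> A" "v \<in> M - S1" for Q v
    proof (rule antisym)
      show "N v (E Q) \<le> 1"
        by (rule E_integral[OF E S1 a_int \<beta>_int that(2)])
      show "1 \<le> N v (E Q)"
        using that by (auto simp: A_def S1_def)
    qed
    have nz: "E Q \<noteq> 0" if "Q \<in> A" for Q
    proof
      assume "E Q = 0"
      moreover have "E 0 = 0" "inj E"
        using E by (simp_all add: orbit_def)
      ultimately have "Q = 0"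
        by (metis injD)
      then show False
        using that by (simp add: A_def)
    qed
    obtain G where G: "finite G" "0 \<notin> G"
      "\<And>u. u \<noteq> 0 \<Longrightarrow> \<forall>v\<in>M - S1. N v u = 1 \<Longrightarrow> \<exists>g\<in>G. \<exists>w. w \<noteq> 0 \<and> u = g * w ^ p"
      using units_mod_powers[OF S1] by blast
    have "A \<subseteq> (\<Union>g\<in>G. {Q \<in> A. E Q \<in> ppow g})"
    proof
      fix Q assume Q: "Q \<in> A"
      then obtain g w where "g \<in> G" "E Q = g * w ^ p"
        using G(3)[OF nz[OF Q]] unit by blast
      then show "Q \<in> (\<Union>g\<in>G. {Q \<in> A. E Q \<in> ppow g})"
        using Q ppowI by auto
    qed
    then obtain g where g: "g \<in> G" "infinite {Q \<in> A. E Q \<in> ppow g}"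
      using infA G(1) by (meson finite_UN_I finite_subset)
    have g0: "g \<noteq> 0"
      using G(2) g(1) by blast
    obtain a' \<beta>' E' where d: "orbit q r a' \<beta>' E'" "a 0 = a' 0 ^ p" "\<And>Q. E (frob Q) = g * E' Q ^ p"
      using descent[OF E S1 a_int \<beta>_int g(2) g0] by auto
    have "\<nexists>w. a' 0 = w ^ (p ^ k)"
    proof
      assume "\<exists>w. a' 0 = w ^ (p ^ k)"
      then obtain w where "a' 0 = w ^ (p ^ k)"
        by blast
      then have "a 0 = w ^ (p ^ Suc k)"
        by (simp add: d(2) mult.commute flip: power_mult)
      then show False
        using Suc.prems(3) by blast
    qed
    \<comment> \<open>Outside \<open>bad g\<close> the factor g has value 1, so \<open>E'\<close>
      inherits the lower bound. As the descent relation holds for all Q, this one g serves the whole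
      of \<open>A\<close>.\<close>
    moreover have "finite (S1 \<union> bad g)"
      using S1 fin_bad by simp
    ultimately have "finite {Q. \<forall>v\<in>M - (S1 \<union> bad g). 1 \<le> N v (E' Q)}"
      using d(1) by (intro Suc.IH)
    moreover have "frob -` A \<subseteq> {Q. \<forall>v\<in>M - (S1 \<union> bad g). 1 \<le> N v (E' Q)}"
    proof (intro subsetI CollectI ballI)
      fix Q v assume Q: "Q \<in> frob -` A" and v: "v \<in> M - (S1 \<union> bad g)"
      then interpret valued "N v"
        by (intro N_valued) simp
      have "N v (E (frob Q)) = 1"
        using unit[of "frob Q" v] Q v by simp
      moreover have "N v g = 1"
        using v g0 by (auto simp: bad_def)
      ultimately have "N v (E' Q) ^ p = 1"
        by (simp add: d(3) mult power)
      then show "1 \<le> N v (E' Q)"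
        using nonneg p_pos by (metis linorder_not_le power_less_one_iff less_irrefl)
    qed
    ultimately have "finite (frob -` A)"
      using finite_subset by blast
    then have "finite (frob ` (frob -` A))"
      by (rule finite_imageI)
    then show False
      using infA bij_is_surj[OF bij_frob] by simp
  qed
qed

end

end

section \<open>Drinfeld modules\<close>

text \<open>Families may repeat vectors: two equal members are related by the coefficients 1 and
  -1.\<close>

lemma (in vector_space) dependent_family:
  assumes "finite I" "finite T" "card T < card I" "span T = UNIV"
  shows "\<exists>u. (\<exists>i\<in>I. u i \<noteq> 0) \<and> (\<Sum>i\<in>I. scale (u i) (f i)) = 0"
proof (cases "inj_on f I")
  case True
  have "dependent (f ` I)"
  proof (rule ccontr)
    assume "\<not> ?thesis"
    then have "card (f ` I) \<le> card T"
      using independent_span_bound[OF assms(2), of "f ` I"] assms(4) by simp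
    then show False
      using assms(3) True by (simp add: card_image)
  qed
  then obtain u where "\<exists>v\<in>f ` I. u v \<noteq> 0" "(\<Sum>v\<in>f ` I. scale (u v) v) = 0"
    using dependent_finite[of "f ` I"] assms(1) by auto
  then show ?thesis
    using True by (intro exI[of _ "u \<circ> f"]) (auto simp: sum.reindex)
next
  case False
  then obtain i j where ij: "i \<in> I" "j \<in> I" "i \<noteq> j" "f i = f j"
    by (auto simp: inj_on_def)
  define u :: "_ \<Rightarrow> 'a" where "u k = (if k = i then 1 else if k = j then - 1 else 0)" for k
  have "(\<Sum>k\<in>I. scale (u k) (f k)) = (\<Sum>k\<in>{i, j}. scale (u k) (f k))"
    using ij assms(1) by (intro sum.mono_neutral_right) (auto simp: u_def)
  also have "\<dots> = 0"
    using ij by (simp add: u_def)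
  finally show ?thesis
    using ij by (intro exI[of _ u]) (auto simp: u_def intro!: bexI[of _ i])
qed

lemma common_denominator:
  fixes u :: "'i \<Rightarrow> 'f::field poly fract"
  assumes "finite I"
  shows "\<exists>d a. d \<noteq> 0 \<and> (\<forall>i\<in>I. Fraction_Field.Fract d 1 * u i = Fraction_Field.Fract (a i) 1)"
  using assms
proof (induction I rule: finite_induct)
  case empty
  show ?case
    by (intro exI[of _ 1]) auto
next
  case (insert k I)
  then obtain d a where d: "d \<noteq> 0" "\<forall>i\<in>I. Fraction_Field.Fract d 1 * u i = Fraction_Field.Fract (a i) 1"
    by blast
  obtain x y where xy: "u k = Fraction_Field.Fract x y" "y \<noteq> 0"
    by (cases "u k") auto
  have "Fraction_Field.Fract (d * y) 1 * u i = Fraction_Field.Fract (if i = k then d * x else y * a i) 1"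
    if "i \<in> insert k I" for i
  proof (cases "i = k")
    case True
    then show ?thesis
      using xy by (simp add: eq_fract mult_ac)
  next
    case False
    then have "Fraction_Field.Fract y 1 * (Fraction_Field.Fract d 1 * u i) = Fraction_Field.Fract (y * a i) 1"
      using d that by simp
    then show ?thesis
      using False by (simp add: mult_ac flip: mult.assoc)
  qed
  then show ?case
    using d(1) xy(2) by (intro exI[of _ "d * y"] exI[of _ "\<lambda>i. if i = k then d * x else y * a i"]) auto
qed

section \<open>The field K as a finite extension of F_q(t)\<close>

locale Fqt_extension =
  fixes \<iota> :: "'f::{finite,field} poly fract \<Rightarrow> 'k::field"
  assumes finite_ext: "finite_extension_of_Fqt \<iota>"
begin

lemma iota_hom: "\<iota> (x + y) = \<iota> x + \<iota> y" "\<iota> (x * y) = \<iota> x * \<iota> y" "\<iota> 1 = 1"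
  using finite_ext
  by (auto simp: finite_extension_of_Fqt_def ring_hom_def ring_of_type_algebra_def)

lemma iota_0 [simp]: "\<iota> 0 = 0"
  using iota_hom(1)[of 0 0] by (metis add.right_neutral add_left_cancel)

lemma iota_eq_0_iff [simp]: "\<iota> x = 0 \<longleftrightarrow> x = 0"
  by (metis iota_0 iota_hom(2,3) mult_zero_left right_inverse zero_neq_one)

definition con :: "'f \<Rightarrow> 'k" where
  "con c = \<iota> (Fraction_Field.Fract [:c:] 1)"

definition t :: 'k where
  "t = \<iota> (Fraction_Field.Fract [:0, 1:] 1)"

sublocale constants con
proof
  show "con (a + b) = con a + con b" "con (a * b) = con a * con b" for a b
    by (simp_all add: con_def mult.commute flip: iota_hom)
  show "con 1 = 1"
    by (simp add: con_def One_fract_def[symmetric] iota_hom flip: one_pCons)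
qed

lemma ev_t: "ev t P = \<iota> (Fraction_Field.Fract P 1)"
proof (induction P)
  case 0
  then show ?case
    by (simp add: Zero_fract_def[symmetric])
next
  case (pCons c P)
  have "pCons c P = [:c:] + [:0, 1:] * P"
    by simp
  then have "\<iota> (Fraction_Field.Fract (pCons c P) 1) = con c + t * \<iota> (Fraction_Field.Fract P 1)"
    unfolding con_def t_def by (simp flip: iota_hom)
  then show ?case
    using pCons by simp
qed

lemma ev_t_eq_0: "ev t P = 0 \<Longrightarrow> P = 0"
  by (simp add: ev_t Zero_fract_def eq_fract)

sublocale vs: vector_space "\<lambda>c x. \<iota> c * x"
  by unfold_locales (auto simp: iota_hom algebra_simps)

lemma ex_basis: "\<exists>B. finite B \<and> vs.independent B \<and> vs.span B = UNIV"
proof -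
  obtain T where T: "finite T" "vs.span T = UNIV"
    using finite_ext by (auto simp: finite_extension_of_Fqt_def)
  obtain B where B: "vs.independent B" "UNIV \<subseteq> vs.span B"
    using vs.maximal_independent_subset_extend[of "{}" UNIV] vs.independent_empty by (metis subset_UNIV)
  then have "finite B"
    using vs.independent_span_bound[OF T(1) B(1)] T(2) by simp
  then show ?thesis
    using B by blast
qed

definition Basis :: "'k set" where
  "Basis = (SOME B. finite B \<and> vs.independent B \<and> vs.span B = UNIV)"

lemma Basis: "finite Basis" "vs.independent Basis" "vs.span Basis = UNIV"
  using someI_ex[OF ex_basis] unfolding Basis_def by blast+

text \<open>The degree of K over F_q(t) serves as n; clearing denominators brings the coefficients
  of a relation into F_q[t].\<close>

sublocale dependent con t "card Basis"
proof
  show "ev t P = 0 \<Longrightarrow> P = 0" for P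
    by (rule ev_t_eq_0)
  fix z :: "nat \<Rightarrow> 'k"
  obtain u where u: "\<exists>i\<in>{..card Basis}. u i \<noteq> 0" "(\<Sum>i\<le>card Basis. \<iota> (u i) * z i) = 0"
    using vs.dependent_family[of "{..card Basis}" Basis z] Basis by auto
  obtain d a where d: "d \<noteq> 0" "\<And>i. i \<le> card Basis \<Longrightarrow> Fraction_Field.Fract d 1 * u i = Fraction_Field.Fract (a i) 1"
    using common_denominator[of "{..card Basis}" u] by auto
  have ev_a: "ev t (a i) = \<iota> (Fraction_Field.Fract d 1) * \<iota> (u i)" if "i \<le> card Basis" for i
    by (simp only: ev_t d(2)[OF that, symmetric] iota_hom)
  have "(\<Sum>i\<le>card Basis. ev t (a i) * z i) = (\<Sum>i\<le>card Basis. \<iota> (Fraction_Field.Fract d 1) * (\<iota> (u i) * z i))"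
    by (intro sum.cong refl) (simp add: ev_a mult.assoc)
  also have "\<dots> = \<iota> (Fraction_Field.Fract d 1) * (\<Sum>i\<le>card Basis. \<iota> (u i) * z i)"
    by (simp only: sum_distrib_left)
  also have "\<dots> = 0"
    using u(2) by simp
  finally have "(\<Sum>i\<le>card Basis. ev t (a i) * z i) = 0" .
  moreover obtain i where i: "i \<le> card Basis" "u i \<noteq> 0"
    using u(1) by auto
  then have "ev t (a i) \<noteq> 0"
    using d(1) by (simp add: ev_a Zero_fract_def eq_fract)
  then have "a i \<noteq> 0"
    by auto
  ultimately show "\<exists>c. (\<exists>i\<le>card Basis. c i \<noteq> 0) \<and> (\<Sum>i\<le>card Basis. ev t (c i) * z i) = 0"
    using i by blast
qed

text \<open>
  Regarded as a vector space over \<open>F\<^sub>q(t)\<close> through the \<open>p\<close>-th power map, \<open>K\<close> is spanned by the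
  \<open>t\<^sup>j b\<close> with \<open>j < p\<close> and \<open>b\<close> in a basis.
\<close>

lemma frobenius_dependent:
  assumes p: "p = CHAR('k)"
  shows "\<exists>h. (\<exists>i\<le>p. h i \<noteq> 0) \<and> (\<Sum>i\<le>p. h i ^ p * z i) = (0 :: 'k)"
proof -
  have pr: "prime p"
    using prime_CHAR p by simp
  have p0: "p > 0"
    using prime_gt_0_nat[OF pr] .
  have add: "(x + y) ^ p = x ^ p + y ^ p" for x y :: 'k
    by (rule freshmans_dream[OF prime_CHAR p])
  interpret fr: vector_space "\<lambda>c x. \<iota> c ^ p * x"
    by unfold_locales (auto simp: iota_hom add power_mult_distrib algebra_simps)
  define T where "T = (\<lambda>(j, b). t ^ j * b) ` ({..<p} \<times> Basis)"
  have T: "t ^ j * b \<in> T" if "j < p" "b \<in> Basis" for j b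
    using that by (auto simp: T_def)
  have finT: "finite T"
    using Basis(1) by (simp add: T_def)
  have "card T \<le> card ({..<p} \<times> Basis)"
    unfolding T_def using Basis(1) by (intro card_image_le) simp
  then have cardT: "card T \<le> p * card Basis"
    by (simp add: card_cartesian_product)
  \<comment> \<open>Multiplication by t raises j; at j = p the factor t^p is the scalar t acting
    through the p-th power map.\<close>
  have t_closed: "t * x \<in> fr.span T" if "x \<in> fr.span T" for x
    using that
  proof (induction rule: fr.span_induct_alt)
    case base
    then show ?case
      by (simp add: fr.span_zero)
  next
    case (step c x y)
    obtain j b where jb: "x = t ^ j * b" "j < p" "b \<in> Basis"
      using step(1) by (auto simp: T_def)
    have "t * x \<in> fr.span T"
    proof (cases "Suc j < p")
      case True
      then show ?thesis
        using T[of "Suc j" b] jb by (auto intro: fr.span_base simp: mult.assoc)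
    next
      case False
      then have "t * x = \<iota> (Fraction_Field.Fract [:0, 1:] 1) ^ p * b"
        using jb by (simp add: t_def[symmetric] flip: power_Suc mult.assoc) (metis Suc_lessI)
      moreover have "b \<in> fr.span T"
        using T[of 0 b] jb p0 by (auto intro: fr.span_base)
      ultimately show ?thesis
        using fr.span_scale by simp
    qed
    then have "\<iota> c ^ p * (t * x) + t * y \<in> fr.span T"
      using step by (intro fr.span_add fr.span_scale)
    then show ?case
      by (simp add: algebra_simps)
  qed
  have root: "\<exists>d. con c = \<iota> d ^ p" for c
    using const_root[of c] p by (auto simp: con_def)
  have ev_closed: "ev t P * b \<in> fr.span T" if "b \<in> Basis" for P b
  proof (induction P)
    case 0
    then show ?case
      by (simp add: fr.span_zero)
  next
    case (pCons c P)
    obtain d where d: "con c = \<iota> d ^ p"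
      using root by blast
    have "b \<in> fr.span T"
      using T[of 0 b] that p0 by (auto intro: fr.span_base)
    then have "\<iota> d ^ p * b + t * (ev t P * b) \<in> fr.span T"
      using pCons t_closed by (intro fr.span_add fr.span_scale) auto
    then show ?case
      by (simp add: d algebra_simps)
  qed
  \<comment> \<open>P/Q = Q^-p (Q^(p-1) P), where Q^-p is the action of the scalar 1/Q in the
    twisted structure.\<close>
  have scaled: "\<iota> c * b \<in> fr.span T" if "b \<in> Basis" for c b
  proof -
    obtain P Q where PQ: "c = Fraction_Field.Fract P Q" "Q \<noteq> 0"
      by (cases c) auto
    define x where "x = Fraction_Field.Fract Q 1"
    have x: "x \<noteq> 0"
      using PQ by (simp add: x_def Zero_fract_def eq_fract)
    have "c * x = Fraction_Field.Fract P 1"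
      using PQ by (simp add: x_def eq_fract)
    then have "c = inverse x * Fraction_Field.Fract P 1"
      using x by (simp add: field_simps)
    then have "\<iota> c = \<iota> (inverse x) * ev t P"
      by (simp add: ev_t iota_hom)
    also have "ev t P = \<iota> (inverse x) ^ (p - 1) * (\<iota> x ^ (p - 1) * ev t P)"
      using x by (simp add: mult.assoc[symmetric] flip: power_mult_distrib iota_hom(2)) (simp add: iota_hom)
    also have "\<iota> x ^ (p - 1) * ev t P = ev t (Q ^ (p - 1) * P)"
      by (simp add: x_def ev_mult ev_power flip: ev_t)
    finally have "\<iota> c = \<iota> (inverse x) ^ p * ev t (Q ^ (p - 1) * P)"
      using p0 by (simp add: power_eq_if mult.assoc)
    then have "\<iota> c * b = \<iota> (inverse x) ^ p * (ev t (Q ^ (p - 1) * P) * b)"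
      by (simp add: mult.assoc)
    then show ?thesis
      using fr.span_scale[OF ev_closed[OF that]] by metis
  qed
  have "x \<in> fr.span T" for x
  proof -
    have "x \<in> vs.span Basis"
      using Basis(3) by simp
    then show ?thesis
    proof (induction rule: vs.span_induct_alt)
      case base
      then show ?case
        by (rule fr.span_zero)
    next
      case (step c x y)
      then show ?case
        by (intro fr.span_add scaled)
    qed
  qed
  then have spanT: "fr.span T = UNIV"
    by blast
  have "Basis \<noteq> {}"
    using Basis(3) vs.span_empty by (metis UNIV_I singletonD zero_neq_one)
  then have "card Basis > 0"
    using Basis(1) by (simp add: card_gt_0_iff)
  \<comment> \<open>The family of all b^p z_i has (p + 1) |Basis| members, against at most p |Basis|
    spanning vectors.\<close>
  then have "card T < card ({..p} \<times> Basis)"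
    using cardT by (simp add: card_cartesian_product)
  then obtain u where u: "\<exists>i\<in>{..p} \<times> Basis. u i \<noteq> 0"
    "(\<Sum>i\<in>{..p} \<times> Basis. \<iota> (u i) ^ p * (case i of (i, b) \<Rightarrow> b ^ p * z i)) = 0"
    using fr.dependent_family[of "{..p} \<times> Basis" T "\<lambda>(i, b). b ^ p * z i"] finT Basis(1) spanT by auto
  \<comment> \<open>Coefficients and factors b^p combine into p-th powers of \<open>h i\<close>;
    independence of \<open>Basis\<close> makes some \<open>h i\<close> nonzero.\<close>
  define h where "h i = (\<Sum>b\<in>Basis. \<iota> (u (i, b)) * b)" for i
  have "(\<Sum>i\<le>p. h i ^ p * z i) = (\<Sum>i\<le>p. \<Sum>b\<in>Basis. \<iota> (u (i, b)) ^ p * (b ^ p * z i))"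
    by (simp add: h_def freshmans_dream_sum[OF prime_CHAR p] power_mult_distrib sum_distrib_right mult.assoc)
  also have "\<dots> = 0"
    using u(2) by (simp add: sum.cartesian_product case_prod_unfold)
  finally have "(\<Sum>i\<le>p. h i ^ p * z i) = 0" .
  moreover have "\<exists>i\<le>p. h i \<noteq> 0"
  proof -
    obtain i b where ib: "i \<le> p" "b \<in> Basis" "u (i, b) \<noteq> 0"
      using u(1) by auto
    have "h i \<noteq> 0"
    proof
      assume "h i = 0"
      then have "u (i, b) = 0"
        using vs.independentD[OF Basis(2) Basis(1) subset_refl, of "\<lambda>b. u (i, b)"] ib(2)
        by (simp add: h_def)
      then show False
        using ib(3) by simp
    qed
    then show ?thesis
      using ib(1) by blast
  qed
  ultimately show ?thesis
    by blast
qed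

end

section \<open>Equivalence of absolute values and the order of a finite field\<close>

lemma equiv_abs: "equiv nontrivial_absolute_values (equivalent_abs :: (('k::field \<Rightarrow> real) \<times> _) set)"
proof (rule equivI)
  have nn: "N x \<ge> 0" if "N \<in> nontrivial_absolute_values" for N :: "'k \<Rightarrow> real" and x
    using that by (auto simp: nontrivial_absolute_values_def absolute_value_def ring_of_type_algebra_def)
  show "(equivalent_abs :: (('k \<Rightarrow> real) \<times> _) set) \<subseteq> nontrivial_absolute_values \<times> nontrivial_absolute_values"
    by (auto simp: equivalent_abs_def)
  show "refl_on nontrivial_absolute_values (equivalent_abs :: (('k \<Rightarrow> real) \<times> _) set)"
    using nn by (auto simp: refl_on_def equivalent_abs_def intro!: exI[of _ 1])
  show "sym (equivalent_abs :: (('k \<Rightarrow> real) \<times> _) set)"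
  proof (rule symI)
    fix N N' :: "'k \<Rightarrow> real" assume "(N, N') \<in> equivalent_abs"
    then obtain s where s: "N \<in> nontrivial_absolute_values" "N' \<in> nontrivial_absolute_values" "s > 0"
      "\<And>x. N' x = N x powr s"
      by (auto simp: equivalent_abs_def)
    then have "N x = N' x powr (1 / s)" for x
      using nn[OF s(1), of x] by (simp add: powr_powr)
    then show "(N', N) \<in> equivalent_abs"
      using s by (auto simp: equivalent_abs_def intro!: exI[of _ "1 / s"])
  qed
  show "trans (equivalent_abs :: (('k \<Rightarrow> real) \<times> _) set)"
  proof (rule transI)
    fix N N' N'' :: "'k \<Rightarrow> real" assume "(N, N') \<in> equivalent_abs" "(N', N'') \<in> equivalent_abs"
    then obtain s r where s: "N \<in> nontrivial_absolute_values" "N'' \<in> nontrivial_absolute_values"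
      "s > 0" "r > 0" "\<And>x. N' x = N x powr s" "\<And>x. N'' x = N' x powr r"
      by (auto simp: equivalent_abs_def)
    then have "N'' x = N x powr (s * r)" for x
      by (simp add: powr_powr)
    then show "(N, N'') \<in> equivalent_abs"
      using s by (auto simp: equivalent_abs_def intro!: exI[of _ "s * r"])
  qed
qed

lemma valued_imp_nontrivial_absolute_value:
  assumes "valued N"
  shows "N \<in> nontrivial_absolute_values"
proof -
  interpret valued N by fact
  have "N (x + y) \<le> N x + N y" for x y
    using ultra[of x y] nonneg[of x] nonneg[of y] by linarith
  then show ?thesis
    using nonneg zero_iff mult nontriv
    by (auto simp: nontrivial_absolute_values_def absolute_value_def ring_of_type_algebra_def)
qed

text \<open>For a prime r dividing q, Sylow's theorem with exponent 1 gives an additive subgroup of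
  order r, hence a nonzero x with r x = 0. So r is the characteristic.\<close>

lemma card_finite_field: "\<exists>e>0. CARD('f::{finite,field}) = CHAR('f) ^ e"
proof -
  have pr: "prime CHAR('f)"
    by (simp add: finite_imp_CHAR_pos prime_CHAR_semidom)
  have only: "r = CHAR('f)" if r: "prime r" "r dvd CARD('f)" for r
  proof -
    obtain m where m: "CARD('f) = r ^ 1 * m"
      using r(2) by (auto simp: dvd_def)
    define G :: "'f monoid" where "G = \<lparr>carrier = UNIV, monoid.mult = (+), one = 0\<rparr>"
    have "group G"
    proof (rule groupI)
      fix x assume "x \<in> carrier G"
      show "\<exists>y\<in>carrier G. y \<otimes>\<^bsub>G\<^esub> x = \<one>\<^bsub>G\<^esub>"
        by (intro bexI[of _ "- x"]) (auto simp: G_def)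
    qed (auto simp: G_def add.assoc)
    then interpret group G .
    obtain H where H: "subgroup H G" "card H = r ^ 1"
      using sylow_thm[OF r(1) is_group, of 1 m] m by (auto simp: G_def Coset.order_def)
    have "\<exists>x\<in>H. x \<noteq> 0"
    proof (rule ccontr)
      assume "\<not> ?thesis"
      then have "H \<subseteq> {0}"
        by auto
      then have "card H \<le> 1"
        by (metis card_mono finite.emptyI finite_insert is_singletonI is_singleton_altdef)
      then show False
        using H(2) prime_gt_1_nat[OF r(1)] by simp
    qed
    then obtain x where x: "x \<in> H" "x \<noteq> 0"
      by blast
    interpret H: group "G\<lparr>carrier := H\<rparr>"
      using subgroup.subgroup_is_group[OF H(1) is_group] .
    have pw: "x [^]\<^bsub>G\<lparr>carrier := H\<rparr>\<^esub> k = of_nat k * x" for k :: nat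
      by (induction k) (auto simp: G_def algebra_simps)
    have "x [^]\<^bsub>G\<lparr>carrier := H\<rparr>\<^esub> Coset.order (G\<lparr>carrier := H\<rparr>) = \<one>\<^bsub>G\<lparr>carrier := H\<rparr>\<^esub>"
      using x by (intro H.pow_order_eq_1) simp
    then have "of_nat r * x = 0"
      using pw[of r] H(2) by (simp add: Coset.order_def G_def)
    then have "CHAR('f) dvd r"
      using x by (simp add: of_nat_eq_0_iff_char_dvd)
    then show ?thesis
      using pr r(1) primes_dvd_imp_eq[of "CHAR('f)" r] by simp
  qed
  have "CARD('f) \<noteq> 0"
    by simp
  then obtain m where m: "CARD('f) = CHAR('f) ^ multiplicity CHAR('f) CARD('f) * m" "\<not> CHAR('f) dvd m"
    using multiplicity_decompose'[of "CARD('f)" "CHAR('f)"] pr not_prime_unit by metis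
  have "m = 1"
  proof (rule ccontr)
    assume "m \<noteq> 1"
    then obtain r where r: "prime r" "r dvd m"
      using prime_factor_nat by blast
    then have "r = CHAR('f)"
      using only m(1) dvd_mult[OF r(2)] by metis
    then show False
      using m(2) r(2) by simp
  qed
  moreover have "multiplicity CHAR('f) CARD('f) \<noteq> 0"
  proof
    assume "multiplicity CHAR('f) CARD('f) = 0"
    then have "CARD('f) = 1"
      using m(1) \<open>m = 1\<close> by simp
    then have "(0 :: 'f) = 1"
      by (metis card_1_singletonE UNIV_I singletonD)
    then show False
      by simp
  qed
  ultimately show ?thesis
    using m(1) by (intro exI[of _ "multiplicity CHAR('f) CARD('f)"]) simp
qed

lemma poly_map_to_ac: "poly (map_poly to_ac P) (to_ac x) = to_ac (poly P x)"
  by (induction P) (auto simp: map_poly_pCons)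

lemma degree_1_eq: "degree P = 1 \<Longrightarrow> P = [:coeff P 0, coeff P 1:]"
  by (rule poly_eqI) (auto simp: coeff_pCons coeff_eq_0 split: nat.split)

section \<open>The action of a Drinfeld module as an orbit\<close>

context Fqt_extension
begin

context
  fixes \<phi> :: "'f poly \<Rightarrow> 'k poly"
  assumes \<phi>: "drinfeld_module \<iota> \<phi>"
begin

lemma q_ge_2: "CARD('f) \<ge> 2"
proof -
  obtain e where e: "e > 0" "CARD('f) = CHAR('f) ^ e"
    using card_finite_field by blast
  have "CHAR('f) \<ge> 2"
    by (rule prime_ge_2_nat[OF prime_CHAR_const])
  then show ?thesis
    using e self_le_power[of "CHAR('f)" e] by linarith
qed

lemma phi:
  shows phi_carrier: "coeff (\<phi> a) k \<noteq> 0 \<Longrightarrow> \<exists>i. k = CARD('f) ^ i"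
    and phi_mult: "\<phi> (a * b) = pcompose (\<phi> a) (\<phi> b)"
    and phi_add: "\<phi> (a + b) = \<phi> a + \<phi> b"
    and phi_1: "\<phi> 1 = [:0, 1:]"
    and phi_coeff: "coeff (\<phi> a) 1 = ev t a"
    and phi_nontrivial: "\<exists>a. \<phi> a \<noteq> monom (ev t a) 1"
  using \<phi>
  by (auto simp: drinfeld_module_def ring_hom_def tau_ring_def ring_of_type_algebra_def
      tau_coeff_def tau_monom_def ev_t Pi_iff)

lemma phi_0: "\<phi> 0 = 0"
  using phi_add[of 0 0] by (metis add.right_neutral add_left_cancel)

lemma phi_coeff_0: "coeff (\<phi> a) 0 = 0"
  using phi_carrier[of a 0] q_ge_2 by auto

text \<open>A nonzero constant is invertible, so phi_c has an inverse under composition and degree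
  1; its coefficient of X is prescribed.\<close>

lemma phi_const: "\<phi> [:c:] = [:0, con c:]"
proof (cases "c = 0")
  case True
  then show ?thesis
    by (simp add: phi_0)
next
  case False
  have "pcompose (\<phi> [:c:]) (\<phi> [:inverse c:]) = [:0, 1:]"
    using False phi_mult[of "[:c:]" "[:inverse c:]"] by (simp add: phi_1 flip: one_pCons)
  then have "degree (\<phi> [:c:]) * degree (\<phi> [:inverse c:]) = 1"
    by (simp flip: degree_pcompose)
  then have "degree (\<phi> [:c:]) = 1"
    by simp
  then show ?thesis
    using degree_1_eq[of "\<phi> [:c:]"] phi_coeff_0[of "[:c:]"] phi_coeff[of "[:c:]"] by simp
qed

text \<open>The degree is a power of q, as phi_t lies in K{tau}. Degree 1 would mean phi_t = t tau^0
  and then phi_a = a tau^0 for all a, against nontriviality.\<close>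

lemma ex_rank:
  "\<exists>r\<ge>1. degree (\<phi> [:0, 1:]) = CARD('f) ^ r"
proof -
  have nz: "\<phi> [:0, 1:] \<noteq> 0"
  proof
    assume 0: "\<phi> [:0, 1:] = 0"
    have "ev t [:0, 1:] = 0"
      unfolding phi_coeff[symmetric] 0 by simp
    then show False
      using ev_t_eq_0 by fastforce
  qed
  then obtain r where r: "degree (\<phi> [:0, 1:]) = CARD('f) ^ r"
    using phi_carrier[of "[:0, 1:]" "degree (\<phi> [:0, 1:])"] by auto
  have "r \<noteq> 0"
  proof
    assume "r = 0"
    then have T: "\<phi> [:0, 1:] = [:0, t:]"
      using r degree_1_eq[of "\<phi> [:0, 1:]"] phi_coeff_0[of "[:0, 1:]"] phi_coeff[of "[:0, 1:]"] by simp
    have "\<phi> a = monom (ev t a) 1" for a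
    proof (induction a)
      case 0
      then show ?case
        by (simp add: phi_0)
    next
      case (pCons c a)
      have "\<phi> (pCons c a) = \<phi> ([:c:] + [:0, 1:] * a)"
        by simp
      also have "\<dots> = [:0, con c:] + pcompose [:0, t:] (monom (ev t a) 1)"
        by (simp only: phi_add phi_mult phi_const T pCons)
      also have "\<dots> = monom (ev t (pCons c a)) 1"
        by (simp add: pcompose_pCons monom_Suc monom_0 smult_monom)
      finally show ?case .
    qed
    then show False
      using phi_nontrivial by blast
  qed
  then show ?thesis
    using r by (intro exI[of _ r]) auto
qed

lemma orbit_recursion:
  assumes r: "degree (\<phi> [:0, 1:]) = CARD('f) ^ r"
  shows "poly (\<phi> (pCons c Q)) x = con c * x + (\<Sum>i\<le>r. coeff (\<phi> [:0, 1:]) (CARD('f) ^ i) * poly (\<phi> Q) x ^ (CARD('f) ^ i))"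
proof -
  have "\<phi> (pCons c Q) = \<phi> ([:c:] + [:0, 1:] * Q)"
    by simp
  then have "poly (\<phi> (pCons c Q)) x = con c * x + poly (\<phi> [:0, 1:]) (poly (\<phi> Q) x)"
    by (simp only: phi_add phi_mult phi_const poly_add poly_pcompose) (simp add: mult.commute)
  also have "poly (\<phi> [:0, 1:]) y = (\<Sum>i\<le>r. coeff (\<phi> [:0, 1:]) (CARD('f) ^ i) * y ^ (CARD('f) ^ i))" for y
  proof -
    have inj: "inj_on (\<lambda>i. CARD('f) ^ i) {..r}"
      using q_ge_2 by (intro inj_onI) (simp add: power_inject_exp)
    have "poly (\<phi> [:0, 1:]) y = (\<Sum>k\<le>CARD('f) ^ r. coeff (\<phi> [:0, 1:]) k * y ^ k)"
      by (simp add: poly_altdef r)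
    also have "\<dots> = (\<Sum>k\<in>(\<lambda>i. CARD('f) ^ i) ` {..r}. coeff (\<phi> [:0, 1:]) k * y ^ k)"
    proof (rule sum.mono_neutral_right)
      show "(\<lambda>i. CARD('f) ^ i) ` {..r} \<subseteq> {..CARD('f) ^ r}"
        using q_ge_2 by (auto intro: power_increasing)
      show "\<forall>k\<in>{..CARD('f) ^ r} - (\<lambda>i. CARD('f) ^ i) ` {..r}. coeff (\<phi> [:0, 1:]) k * y ^ k = 0"
      proof
        fix k assume k: "k \<in> {..CARD('f) ^ r} - (\<lambda>i. CARD('f) ^ i) ` {..r}"
        have "coeff (\<phi> [:0, 1:]) k = 0"
        proof (rule ccontr)
          assume "coeff (\<phi> [:0, 1:]) k \<noteq> 0"
          then obtain i where "k = CARD('f) ^ i"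
            using phi_carrier by blast
          then show False
            using k q_ge_2 by (auto simp: power_increasing_iff)
        qed
        then show "coeff (\<phi> [:0, 1:]) k * y ^ k = 0"
          by simp
      qed
    qed simp
    also have "\<dots> = (\<Sum>i\<le>r. coeff (\<phi> [:0, 1:]) (CARD('f) ^ i) * y ^ (CARD('f) ^ i))"
      by (simp add: sum.reindex[OF inj])
    finally show ?thesis .
  qed
  finally show ?thesis .
qed

text \<open>Torsion is tested with nonconstant polynomials, so equal values only show that P - Q is
  constant. A nonzero constant forces \<beta> = 0, which phi_t annihilates, making \<beta>
  torsion.\<close>

lemma inj_of_nontorsion:
  assumes "\<not> torsion_point \<phi> (to_ac \<beta>)"
  shows "inj (\<lambda>Q. poly (\<phi> Q) \<beta>)"
proof (rule injI)
  fix P Q assume eq: "poly (\<phi> P) \<beta> = poly (\<phi> Q) \<beta>"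
  have nt: "R \<in> range (\<lambda>c. [:c:])" if "poly (\<phi> R) \<beta> = 0" for R
    using assms that by (auto simp: torsion_point_def drinfeld_act_def poly_map_to_ac)
  have "\<phi> P = \<phi> (P - Q) + \<phi> Q"
    by (simp flip: phi_add)
  then have 0: "poly (\<phi> (P - Q)) \<beta> = 0"
    using eq by simp
  then obtain c where c: "P - Q = [:c:]"
    using nt by blast
  show "P = Q"
  proof (cases "c = 0")
    case False
    then have "\<beta> = 0"
      using 0 by (simp add: c phi_const)
    then have "poly (\<phi> [:0, 1:]) \<beta> = 0"
      by (simp add: poly_0_coeff_0 phi_coeff_0)
    then show ?thesis
      using nt by fastforce
  qed (use c in auto)
qed

end

end

theorem theorem1p1:
  fixes \<iota> :: "'f::{finite,field} poly fract \<Rightarrow> 'k::field"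
    and \<phi> :: "'f poly \<Rightarrow> 'k poly"
    and absK :: "'k place \<Rightarrow> 'k \<Rightarrow> real"
    and C :: "'k place \<Rightarrow> 'c ring"
    and absC :: "'k place \<Rightarrow> 'c \<Rightarrow> real"
    and emb :: "'k place \<Rightarrow> 'k alg_closure \<Rightarrow> 'c"
    and S :: "'k place set"
    and \<beta> :: 'k
  assumes "finite_extension_of_Fqt \<iota>"
    and "drinfeld_module \<iota> \<phi>"
    and "place_data absK C absC emb"
    and "S \<subseteq> places" and "finite S"
    and "\<not> torsion_point \<phi> (to_ac \<beta>)"
  shows "finite {Q. S_integral absC emb S 0 (drinfeld_act \<phi> Q (to_ac \<beta>))}"
proof -
  interpret Fqt_extension \<iota>
    by unfold_locales fact
  note \<phi> = \<open>drinfeld_module \<iota> \<phi>\<close>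
  have absK: "absK v \<in> v" "v = equivalent_abs `` {absK v}" "absK v \<in> nontrivial_absolute_values"
    if place: "v \<in> places" for v
  proof -
    show v: "absK v \<in> v"
      using assms(3) place by (simp add: place_data_def)
    obtain N where N: "v = equivalent_abs `` {N}"
      using place unfolding places_def by (rule quotientE)
    have rel: "(N, absK v) \<in> equivalent_abs"
      using v N by auto
    show "v = equivalent_abs `` {absK v}"
      by (rule trans[OF N equiv_class_eq[OF equiv_abs rel]])
    show "absK v \<in> nontrivial_absolute_values"
      using rel by (simp add: equivalent_abs_def)
  qed
  interpret function_field con t "card Basis" places absK "CHAR('k)"
  proof (rule function_field.intro[OF dependent_axioms function_field_axioms.intro])
    show "CHAR('k) = CHAR('k)"
      by simp
    show "\<exists>h. (\<exists>i\<le>CHAR('k). h i \<noteq> 0) \<and> (\<Sum>i\<le>CHAR('k). h i ^ CHAR('k) * z i) = (0 :: 'k)" for z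
      by (rule frobenius_dependent) simp
    show "valued (absK v)" if "v \<in> places" for v
      using absK(3)[OF that] prime_CHAR by (intro valuedI)
    show "\<exists>v\<in>places. \<exists>s>0. \<forall>x. absK v x = N' x powr s" if "valued N'" for N'
    proof -
      have N': "N' \<in> nontrivial_absolute_values"
        using that by (rule valued_imp_nontrivial_absolute_value)
      define v where "v = equivalent_abs `` {N'}"
      have v: "v \<in> places"
        unfolding v_def places_def using N' by (rule quotientI)
      then have "(N', absK v) \<in> equivalent_abs"
        using absK(1)[OF v] by (simp add: v_def)
      then show ?thesis
        using v by (auto simp: equivalent_abs_def)
    qed
    show "\<exists>x. absK w x \<noteq> absK v x powr s" if "v \<in> places" "w \<in> places" "v \<noteq> w" "s > 0" for v w s
    proof (rule ccontr)
      assume "\<not> ?thesis"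
      then have "(absK v, absK w) \<in> equivalent_abs"
        using absK(3) that by (auto simp: equivalent_abs_def)
      then have "v = w"
        using absK(2)[OF that(1)] absK(2)[OF that(2)] equiv_class_eq[OF equiv_abs] by metis
      then show False
        using that by simp
    qed
  qed
  obtain e where e: "e > 0" "CARD('f) = CHAR('f) ^ e"
    using card_finite_field by blast
  then have q: "CARD('f) = CHAR('k) ^ e"
    by (simp add: CHAR_eq)
  obtain r where r: "r \<ge> 1" "degree (\<phi> [:0, 1:]) = CARD('f) ^ r"
    using ex_rank[OF \<phi>] by blast
  define a where "a i = coeff (\<phi> [:0, 1:]) (CARD('f) ^ i)" for i
  have a0: "a 0 = t"
    using phi_coeff[OF \<phi>, of "[:0, 1:]"] by (simp add: a_def)
  have orbit: "orbit CARD('f) r a \<beta> (\<lambda>Q. poly (\<phi> Q) \<beta>)"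
    unfolding orbit_def
  proof (intro conjI allI impI)
    show "a r \<noteq> 0"
    proof
      assume "a r = 0"
      then have "\<phi> [:0, 1:] = 0"
        by (simp add: a_def flip: r(2))
      then show False
        using r(2) by simp
    qed
    show "inj (\<lambda>Q. poly (\<phi> Q) \<beta>)"
      by (rule inj_of_nontorsion[OF \<phi> assms(6)])
    show "poly (\<phi> 0) \<beta> = 0"
      by (simp add: phi_0[OF \<phi>])
    show "ev (a 0) Q \<noteq> 0" if "Q \<noteq> 0" for Q
      using that ev_t_eq_0 by (auto simp: a0)
    show "poly (\<phi> (pCons c Q)) \<beta> = con c * \<beta> + (\<Sum>i\<le>r. a i * poly (\<phi> Q) \<beta> ^ CARD('f) ^ i)" for c Q
      unfolding a_def by (rule orbit_recursion[OF \<phi> r(2)])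
  qed (rule r)
  obtain k where "\<nexists>w. a 0 = w ^ (CHAR('k) ^ k)"
    using not_infinitely_divisible by (auto simp: a0)
  then have fin: "finite {Q. \<forall>v\<in>places - S. 1 \<le> absK v (poly (\<phi> Q) \<beta>)}"
    by (rule finite_integral_orbit[OF q e(1) orbit assms(5)])
  have abs_emb: "absC v (emb v (to_ac x)) = absK v x" if "v \<in> places" for v x
    using assms(3) that by (simp add: place_data_def is_Cv_def)
  have "{Q. S_integral absC emb S 0 (drinfeld_act \<phi> Q (to_ac \<beta>))} \<subseteq>
    {Q. \<forall>v\<in>places - S. 1 \<le> absK v (poly (\<phi> Q) \<beta>)}"
  proof (intro subsetI CollectI ballI)
    fix Q v
    assume Q: "Q \<in> {Q. S_integral absC emb S 0 (drinfeld_act \<phi> Q (to_ac \<beta>))}" and v: "v \<in> places - S"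
    interpret valued "absK v"
      using v by (intro N_valued) simp
    \<comment> \<open>The identity, taken for both morphisms, turns integrality at v into
      |phi_Q(\<beta>)|_v >= 1.\<close>
    have id: "(\<lambda>x. x) \<in> (K_morphisms :: ('k alg_closure \<Rightarrow> _) set)"
      by (auto simp: K_morphisms_def ring_hom_def ring_of_type_algebra_def)
    have zero_emb: "absC v (emb v 0) = 0"
      using abs_emb[of v 0] v by simp
    have "\<forall>\<sigma>\<in>K_morphisms. \<forall>\<sigma>'\<in>K_morphisms. absC v (emb v (\<sigma>' 0)) \<le> 1 \<longrightarrow>
        absC v (emb v (\<sigma>' 0 - \<sigma> (drinfeld_act \<phi> Q (to_ac \<beta>)))) \<ge> 1"
      using Q v by (simp add: S_integral_def)
    from bspec[OF bspec[OF this id] id]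
    have "absC v (emb v (0 - drinfeld_act \<phi> Q (to_ac \<beta>))) \<ge> 1"
      using zero_emb by simp
    also have "0 - drinfeld_act \<phi> Q (to_ac \<beta>) = to_ac (- poly (\<phi> Q) \<beta>)"
      by (simp add: drinfeld_act_def poly_map_to_ac)
    also have "absC v (emb v (to_ac (- poly (\<phi> Q) \<beta>))) = absK v (poly (\<phi> Q) \<beta>)"
      using abs_emb v minus by (simp del: to_ac_minus)
    finally show "1 \<le> absK v (poly (\<phi> Q) \<beta>)" .
  qed
  then show ?thesis
    using fin finite_subset by blast
qed

end
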